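(* Given any positive function $r:(0,\infty)\to(0,\infty)$ satisfying $r(t)=o(t^{-4})$ as $t\to\infty$, there exists $x\in D(A)$ such that $E_x(t)\neq o(r(t))$ as $t\to\infty$, i.e. $E_x(t)/r(t)$ does not converge to $0$ as $t\to\infty$.
   Context: All function spaces are complex. Let $X=H^1(-1,0)\times L^2(-1,0)\times L^2(0,1)$ and $Y=H^2(-1,0)\times H^1(-1,0)\times H^2(0,1)$, both with their natural Hilbert space norms. Let $A$ be the operator on $X$ given by $Ax=(v,u'',w'')$ for $x=(u,v,w)$ in the domain $$D(A)=\{(u,v,w)\in Y: u'(-1)=w(1)=0,\ v(0)=w(0),\ u'(0)=w'(0)\}.$$ The operator $A$ generates a uniformly bounded $C_0$-semigroup $(T(t))_{t\ge0}$ on $X$. This is the semigroup formulation, with $z(t)=(u(\cdot,t),u_t(\cdot,t),w(\cdot,t))=T(t)x$ and $z(0)=x$, of the coupled wave-heat system: $u_{tt}=u_{\xi\xi}$ for $\xi\in(-1,0)$, $w_t=w_{\xi\xi}$ for $\xi\in(0,1)$, $u_\xi(-1,t)=0$, $w(1,t)=0$, $u_t(0,t)=w(0,t)$, $u_\xi(0,t)=w_\xi(0,t)$ for $t>0$. For $x\in X$, write $T(t)x=(u(\cdot,t),v(\cdot,t),w(\cdot,t))$ (so that $v=u_t$). The energy is $$E_x(t)=\frac12\left(\int_{-1}^0 |u_\xi(\xi,t)|^2+|v(\xi,t)|^2\,d\xi+\int_0^1|w(\xi,t)|^2\,d\xi\right),\quad t\ge0.$$ For functions $f,g$ on $(0,\infty)$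 with values in $[0,\infty)$ and $g>0$, $f(t)=o(g(t))$ as $t\to\infty$ means $f(t)/g(t)\to0$ as $t\to\infty$. *)

theory Defs
  imports "HOL-Analysis.Analysis" "HOL-Library.Function_Algebras"
begin

text \<open>
  Elements of \<open>L\<^sup>2\<close> and of the Sobolev spaces are represented by functions on the real line;
  their values outside the interval are irrelevant. Two representatives denote the same element
  iff they agree almost everywhere on the interval, i.e. iff the norm of their difference is zero.
\<close>

section \<open>Lebesgue and Sobolev spaces on a bounded interval\<close>

definition L2 :: "real \<Rightarrow> real \<Rightarrow> (real \<Rightarrow> complex) set" where
  "L2 a b = {f \<in> borel_measurable (lebesgue_on {a<..<b}).
               integrable (lebesgue_on {a<..<b}) (\<lambda>\<xi>. (cmod (f \<xi>))\<^sup>2)}"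

definition L2_nrm :: "real \<Rightarrow> real \<Rightarrow> (real \<Rightarrow> complex) \<Rightarrow> real" where
  "L2_nrm a b f = sqrt (\<integral>\<xi>. (cmod (f \<xi>))\<^sup>2 \<partial>lebesgue_on {a<..<b})"

text \<open>
  Real-valued test functions suffice for complex-valued weak derivatives, by linearity.
\<close>

definition test_funs :: "real \<Rightarrow> real \<Rightarrow> (real \<Rightarrow> real) set" where
  "test_funs a b = {\<phi>. (\<forall>n x. (deriv ^^ n) \<phi> differentiable at x) \<and>
                        (\<exists>c d. a < c \<and> d < b \<and> (\<forall>x. x \<notin> {c..d} \<longrightarrow> \<phi> x = 0))}"

definition has_weak_deriv ::
    "real \<Rightarrow> real \<Rightarrow> (real \<Rightarrow> complex) \<Rightarrow> (real \<Rightarrow> complex) \<Rightarrow> bool" where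
  "has_weak_deriv a b f g \<longleftrightarrow>
     (\<forall>\<phi>\<in>test_funs a b.
        (\<integral>\<xi>. complex_of_real (deriv \<phi> \<xi>) * f \<xi> \<partial>lebesgue_on {a<..<b}) =
        - (\<integral>\<xi>. complex_of_real (\<phi> \<xi>) * g \<xi> \<partial>lebesgue_on {a<..<b}))"

definition H1 :: "real \<Rightarrow> real \<Rightarrow> (real \<Rightarrow> complex) set" where
  "H1 a b = {f \<in> L2 a b. \<exists>g\<in>L2 a b. has_weak_deriv a b f g}"

text \<open>Unique up to equality almost everywhere; meaningful for \<open>f \<in> H1 a b\<close> only.\<close>

definition weak_deriv :: "real \<Rightarrow> real \<Rightarrow> (real \<Rightarrow> complex) \<Rightarrow> (real \<Rightarrow> complex)" where
  "weak_deriv a b f = (SOME g. g \<in> L2 a b \<and> has_weak_deriv a b f g)"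

definition H2 :: "real \<Rightarrow> real \<Rightarrow> (real \<Rightarrow> complex) set" where
  "H2 a b = {f \<in> H1 a b. weak_deriv a b f \<in> H1 a b}"

definition H1_nrm :: "real \<Rightarrow> real \<Rightarrow> (real \<Rightarrow> complex) \<Rightarrow> real" where
  "H1_nrm a b f = sqrt ((L2_nrm a b f)\<^sup>2 + (L2_nrm a b (weak_deriv a b f))\<^sup>2)"

text \<open>
  The value at a point \<open>c\<close> of the closed interval of an element of \<open>H1 a b\<close>,
  i.e. the value at \<open>c\<close> of its representative that is continuous on \<open>{a..b}\<close>.
\<close>

definition pt_val :: "real \<Rightarrow> real \<Rightarrow> (real \<Rightarrow> complex) \<Rightarrow> real \<Rightarrow> complex" where
  "pt_val a b f c =
     (THE z. \<exists>g. continuous_on {a..b} g \<and> (AE \<xi> in lebesgue_on {a<..<b}. f \<xi> = g \<xi>) \<and> g c = z)"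

section \<open>Strongly continuous semigroups and their generators\<close>

text \<open>
  The space is given by a carrier \<open>X\<close> of representatives with scalar multiplication \<open>scl\<close>
  and norm \<open>N\<close>; \<open>x\<close> and \<open>y\<close> represent the same element iff \<open>N (x - y) = 0\<close>, and all identities
  between elements are understood in this sense.
\<close>

definition C0_semigroup ::
    "'x::ab_group_add set \<Rightarrow> (complex \<Rightarrow> 'x \<Rightarrow> 'x) \<Rightarrow> ('x \<Rightarrow> real) \<Rightarrow> (real \<Rightarrow> 'x \<Rightarrow> 'x) \<Rightarrow> bool" where
  "C0_semigroup X scl N T \<longleftrightarrow>
     (\<forall>t\<ge>0. \<forall>x\<in>X. T t x \<in> X) \<and>
     (\<forall>t\<ge>0. \<forall>x\<in>X. \<forall>y\<in>X. \<forall>c. N (T t (scl c x + y) - (scl c (T t x) + T t y)) = 0) \<and>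
     (\<forall>t\<ge>0. \<exists>M. \<forall>x\<in>X. N (T t x) \<le> M * N x) \<and>
     (\<forall>x\<in>X. N (T 0 x - x) = 0) \<and>
     (\<forall>s\<ge>0. \<forall>t\<ge>0. \<forall>x\<in>X. N (T (s + t) x - T s (T t x)) = 0) \<and>
     (\<forall>x\<in>X. ((\<lambda>t. N (T t x - x)) \<longlongrightarrow> 0) (at_right 0))"

text \<open>
  The operator \<open>A\<close> with domain \<open>D\<close> is the infinitesimal generator of \<open>T\<close>: an element \<open>x\<close> is in \<open>D\<close>
  iff \<open>(T h x - x) / h\<close> converges in \<open>X\<close> as \<open>h\<close> tends to 0 from the right, and \<open>A x\<close> is the limit.
\<close>

definition is_generator ::
    "'x::ab_group_add set \<Rightarrow> (complex \<Rightarrow> 'x \<Rightarrow> 'x) \<Rightarrow> ('x \<Rightarrow> real) \<Rightarrow>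
     'x set \<Rightarrow> ('x \<Rightarrow> 'x) \<Rightarrow> (real \<Rightarrow> 'x \<Rightarrow> 'x) \<Rightarrow> bool" where
  "is_generator X scl N D A T \<longleftrightarrow>
     (\<forall>x\<in>X. \<forall>y\<in>X.
        ((\<lambda>h. N (scl (complex_of_real (1 / h)) (T h x - x) - y)) \<longlongrightarrow> 0) (at_right 0) \<longleftrightarrow>
        x \<in> D \<and> N (A x - y) = 0)"

section \<open>The coupled wave-heat system\<close>

type_synonym state = "(real \<Rightarrow> complex) \<times> (real \<Rightarrow> complex) \<times> (real \<Rightarrow> complex)"

definition state_scale :: "complex \<Rightarrow> state \<Rightarrow> state" where
  "state_scale c = (\<lambda>(u, v, w). (\<lambda>\<xi>. c * u \<xi>, \<lambda>\<xi>. c * v \<xi>, \<lambda>\<xi>. c * w \<xi>))"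

definition wh_space :: "state set" where
  "wh_space = H1 (-1) 0 \<times> L2 (-1) 0 \<times> L2 0 1"

definition wh_norm :: "state \<Rightarrow> real" where
  "wh_norm = (\<lambda>(u, v, w). sqrt ((H1_nrm (-1) 0 u)\<^sup>2 + (L2_nrm (-1) 0 v)\<^sup>2 + (L2_nrm 0 1 w)\<^sup>2))"

definition wh_dom :: "state set" where
  "wh_dom = {(u, v, w). u \<in> H2 (-1) 0 \<and> v \<in> H1 (-1) 0 \<and> w \<in> H2 0 1 \<and>
     pt_val (-1) 0 (weak_deriv (-1) 0 u) (-1) = 0 \<and> pt_val 0 1 w 1 = 0 \<and>
     pt_val (-1) 0 v 0 = pt_val 0 1 w 0 \<and>
     pt_val (-1) 0 (weak_deriv (-1) 0 u) 0 = pt_val 0 1 (weak_deriv 0 1 w) 0}"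

definition wh_op :: "state \<Rightarrow> state" where
  "wh_op = (\<lambda>(u, v, w). (v, weak_deriv (-1) 0 (weak_deriv (-1) 0 u),
                           weak_deriv 0 1 (weak_deriv 0 1 w)))"

definition wh_semigroup :: "(real \<Rightarrow> state \<Rightarrow> state) \<Rightarrow> bool" where
  "wh_semigroup T \<longleftrightarrow>
     C0_semigroup wh_space state_scale wh_norm T \<and>
     is_generator wh_space state_scale wh_norm wh_dom wh_op T"

definition energy :: "state \<Rightarrow> real" where
  "energy = (\<lambda>(u, v, w).
     1/2 * ((\<integral>\<xi>. (cmod (weak_deriv (-1) 0 u \<xi>))\<^sup>2 + (cmod (v \<xi>))\<^sup>2 \<partial>lebesgue_on {-1<..<0}) +
            (\<integral>\<xi>. (cmod (w \<xi>))\<^sup>2 \<partial>lebesgue_on {0<..<1})))"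

end

theory Submission
  imports Defs
begin

text \<open>
  The operator has eigenvalues that approach the imaginary axis just slowly enough: for every
  \<open>s = (n + 1/2) * pi\<close> with \<open>n\<close> large there is an eigenvalue \<open>\<Lambda>\<close> within distance \<open>5 / sqrt s\<close> of
  \<open>\<i> * s\<close> (\<open>eigenpair_exists\<close>). On the wave side an eigenvector is a pure \<open>cosh\<close>; on the heat side
  it is a multiple of \<open>sinh (\<mu> * (1 - \<xi>))\<close> with \<open>\<mu>\<^sup>2 = \<Lambda>\<close>, a boundary layer of width about \<open>1 / sqrt s\<close>
  that damps the motion at a rate \<open>\<bar>Re \<Lambda>\<bar>\<close> of at most \<open>5 / sqrt s\<close>. An eigenvector \<open>e\<close> of energy of order one has
  graph norm of order \<open>s\<close>, and it has lost only a bounded factor of its energy at time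
  \<open>t = sqrt s\<close>. So the energy of \<open>T t (e / s)\<close> at that time is of order \<open>1 / s\<^sup>2 = 1 / t ^ 4\<close>, although
  \<open>e / s\<close> has graph norm of order one. This is the rate \<open>1 / t ^ 4\<close>, attained along a sequence of
  initial values that changes with \<open>t\<close>.

  A gliding hump (\<open>gliding_hump\<close>) turns this into one initial value. If the energy of every orbit
  starting in the domain were \<open>o (r t)\<close>, choose indices \<open>\<nu> 0, \<nu> 1, ...\<close> one after the other so fast
  that in \<open>x = (\<Sum>j. (1/2) ^ j / s (\<nu> j) * e (\<nu> j))\<close>, at time \<open>t = sqrt (s (\<nu> k))\<close>, the \<open>k\<close>-th term has
  energy of order \<open>(1/4) ^ k / t ^ 4\<close>, a large multiple of \<open>r t\<close>; the earlier terms have decayed to at most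
  \<open>r t\<close>; and the later terms are negligible whatever the norm of \<open>T t\<close> is. The series converges in
  the domain because it converges together with its classical derivatives (\<open>eigvec_series\<close>).

  It remains to know the orbit of an eigenvector. The usual uniqueness argument for
  \<open>T t e = exp (\<Lambda> * t) * e\<close> needs local boundedness of the semigroup, hence the uniform boundedness
  principle and completeness. Here a shorter way is open: \<open>T t e\<close> is again an eigenvector for \<open>\<Lambda>\<close>,
  and the eigenspaces are one-dimensional (\<open>eigenspace_simple\<close>), so \<open>T t e = c t * e\<close> with a
  multiplicative function \<open>c\<close> that has right derivative \<open>\<Lambda>\<close> at 0, and \<open>c\<close> must be the exponential
  (\<open>T_simple_eigenvector\<close>). One-dimensionality is a statement about weak solutions, and both it and
  the evaluation of the domain conditions rest on the uniqueness of weak derivatives, that is, on the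
  existence of enough smooth bumps (\<open>AE_zero_of_interval_integrals\<close>, \<open>du_Bois_Reymond\<close>).

  All estimates are insensitive to constants, so the squared norm and the energy are only used through
  the inequality \<open>(p + q)\<^sup>2 \<le> 2 * p\<^sup>2 + 2 * q\<^sup>2\<close>, which is immediate pointwise, in place of
  Minkowski's inequality.
\<close>

section \<open>Smooth functions and bumps\<close>

definition smooth_fun :: "(real \<Rightarrow> real) \<Rightarrow> bool" where
  "smooth_fun f \<longleftrightarrow> (\<forall>n x. (deriv ^^ n) f differentiable at x)"

text \<open>
  Smoothness is the largest property that passes from a function to its derivative. The closure
  properties below are proved by exhibiting a family of functions that is stable under differentiation.
\<close>

lemma smooth_fun_coinduct:
  assumes "P f"
    and step: "\<And>f. P f \<Longrightarrow> \<exists>f'. (\<forall>x. (f has_real_derivative f' x) (at x)) \<and> P f'"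
  shows "smooth_fun f"
proof -
  have P': "(\<forall>x. f differentiable at x) \<and> P (deriv f)" if Pf: "P f" for f
  proof -
    obtain f' where f': "\<forall>x. (f has_real_derivative f' x) (at x)" "P f'"
      using step[OF Pf] by blast
    then have "deriv f = f'"
      by (intro ext DERIV_imp_deriv) auto
    with f' show ?thesis
      unfolding real_differentiable_def by blast
  qed
  have "P ((deriv ^^ n) f)" for n
    by (induction n) (use \<open>P f\<close> P' in auto)
  then show ?thesis
    using P' by (auto simp: smooth_fun_def)
qed

lemma smooth_fun_step:
  assumes "smooth_fun f"
  shows "(f has_real_derivative deriv f x) (at x)" "smooth_fun (deriv f)"
proof -
  have "(deriv ^^ 0) f differentiable at x"
    using assms unfolding smooth_fun_def by blast
  then show "(f has_real_derivative deriv f x) (at x)"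
    by (simp add: DERIV_deriv_iff_real_differentiable)
  have "(deriv ^^ n) (deriv f) = (deriv ^^ Suc n) f" for n
    by (simp add: funpow_swap1)
  then show "smooth_fun (deriv f)"
    using assms unfolding smooth_fun_def by metis
qed

lemma smooth_fun_antideriv:
  assumes "\<And>x. (f has_real_derivative f' x) (at x)" "smooth_fun f'"
  shows "smooth_fun f"
  using assms smooth_fun_step
  by (intro smooth_fun_coinduct[of "\<lambda>g. g = f \<or> smooth_fun g"]) blast+

lemma smooth_fun_const [intro]: "smooth_fun (\<lambda>_. c)"
  by (rule smooth_fun_coinduct[of "\<lambda>f. \<exists>c. f = (\<lambda>_. c)"]) (auto intro!: derivative_eq_intros)

text \<open>
  The algebra generated by the smooth functions is visibly stable under differentiation, hence consists
  of smooth functions. This avoids iterated Leibniz formulas.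
\<close>

inductive smooth_alg :: "(real \<Rightarrow> real) \<Rightarrow> bool" where
  base: "smooth_fun f \<Longrightarrow> smooth_alg f"
| add: "smooth_alg f \<Longrightarrow> smooth_alg g \<Longrightarrow> smooth_alg (\<lambda>x. f x + g x)"
| mult: "smooth_alg f \<Longrightarrow> smooth_alg g \<Longrightarrow> smooth_alg (\<lambda>x. f x * g x)"

lemma smooth_alg_smooth:
  assumes "smooth_alg f"
  shows "smooth_fun f"
proof (rule smooth_fun_coinduct[of smooth_alg, OF assms])
  fix f :: "real \<Rightarrow> real"
  assume "smooth_alg f"
  then show "\<exists>f'. (\<forall>x. (f has_real_derivative f' x) (at x)) \<and> smooth_alg f'"
  proof induction
    case (base f)
    then show ?case
      using smooth_fun_step smooth_alg.base by blast
  next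
    case (add f g)
    then obtain f' g' where *: "\<forall>x. (f has_real_derivative f' x) (at x)" "smooth_alg f'"
      "\<forall>x. (g has_real_derivative g' x) (at x)" "smooth_alg g'"
      by blast
    then show ?case
      by (intro exI[of _ "\<lambda>x. f' x + g' x"])
        (auto intro!: derivative_eq_intros smooth_alg.add)
  next
    case (mult f g)
    then obtain f' g' where *: "\<forall>x. (f has_real_derivative f' x) (at x)" "smooth_alg f'"
      "\<forall>x. (g has_real_derivative g' x) (at x)" "smooth_alg g'"
      by blast
    then show ?case using mult.hyps
      by (intro exI[of _ "\<lambda>x. f' x * g x + g' x * f x"])
        (auto intro!: derivative_eq_intros smooth_alg.add smooth_alg.mult)
  qed
qed

lemma smooth_fun_add: "smooth_fun f \<Longrightarrow> smooth_fun g \<Longrightarrow> smooth_fun (\<lambda>x. f x + g x)"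
  and smooth_fun_mult: "smooth_fun f \<Longrightarrow> smooth_fun g \<Longrightarrow> smooth_fun (\<lambda>x. f x * g x)"
  by (blast intro: smooth_alg_smooth smooth_alg.base smooth_alg.add smooth_alg.mult)+

text \<open>
  These are the real and imaginary parts of \<open>exp (\<kappa> * x)\<close>; they serve as integrating factors although
  test functions are real valued.
\<close>

lemma smooth_fun_exp_trig:
  "smooth_fun (\<lambda>x. exp (a * x) * cos (b * x))" "smooth_fun (\<lambda>x. exp (a * x) * sin (b * x))"
proof -
  define F where "F A B = (\<lambda>x. exp (a * x) * (A * cos (b * x) + B * sin (b * x)))" for A B
  have "smooth_fun (F A B)" for A B
  proof (rule smooth_fun_coinduct[of "\<lambda>f. \<exists>A B. f = F A B"])
    fix f assume "\<exists>A B. f = F A B"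
    then obtain A B where "f = F A B" by blast
    have "(F A B has_real_derivative F (a * A + b * B) (a * B - b * A) x) (at x)" for x
    proof -
      have "((\<lambda>x. exp (a * x) * (A * cos (b * x) + B * sin (b * x))) has_real_derivative
          exp (a * x) * (A * (- sin (b * x) * b) + B * (cos (b * x) * b))
            + (exp (a * x) * a) * (A * cos (b * x) + B * sin (b * x))) (at x)"
        by (rule derivative_eq_intros refl)+ simp
      then show ?thesis
        by (simp add: F_def algebra_simps)
    qed
    with \<open>f = F A B\<close> show "\<exists>f'. (\<forall>x. (f has_real_derivative f' x) (at x)) \<and> (\<exists>A B. f' = F A B)"
      by blast
  qed blast
  from this[of 1 0] this[of 0 1]
  show "smooth_fun (\<lambda>x. exp (a * x) * cos (b * x))" "smooth_fun (\<lambda>x. exp (a * x) * sin (b * x))"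
    by (simp_all add: F_def)
qed

text \<open>
  The classical flat function with polynomial prefactors in \<open>1 / x\<close>, a family that is stable under
  differentiation.
\<close>

definition flat_fun :: "real poly \<Rightarrow> real \<Rightarrow> real" where
  "flat_fun p x = (if x > 0 then poly p (1 / x) * exp (- (1 / x)) else 0)"

lemma poly_times_exp_neg_tendsto_0: "((\<lambda>y. poly p y * exp (- y)) \<longlongrightarrow> (0::real)) at_top"
proof -
  have "((\<lambda>y. \<Sum>i\<le>degree p. coeff p i * (y ^ i / exp y)) \<longlongrightarrow> (\<Sum>i\<le>degree p. coeff p i * 0)) at_top"
    by (intro tendsto_intros tendsto_power_div_exp_0)
  then show ?thesis
    by (simp add: poly_altdef sum_divide_distrib exp_minus divide_inverse sum_distrib_right mult.assoc)
qed

lemma flat_fun_has_derivative: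
  "(flat_fun p has_real_derivative flat_fun ([:0, 0, 1:] * (p - pderiv p)) x) (at x)"
proof -
  consider "x > 0" | "x < 0" | "x = 0" by linarith
  then show ?thesis
  proof cases
    case 1
    have inv: "((\<lambda>x. 1 / x) has_real_derivative - (1 / x * (1 / x))) (at x)"
      using 1 by (auto intro!: derivative_eq_intros simp: power2_eq_square)
    have "((\<lambda>x. poly p (1 / x) * exp (- (1 / x))) has_real_derivative
            (poly (pderiv p) (1 / x) * - (1 / x * (1 / x))) * exp (- (1 / x))
            + (exp (- (1 / x)) * - (- (1 / x * (1 / x)))) * poly p (1 / x)) (at x)"
      by (intro DERIV_mult DERIV_chain2[OF poly_DERIV] DERIV_chain2[OF DERIV_exp] DERIV_minus inv)
    also have "(poly (pderiv p) (1 / x) * - (1 / x * (1 / x))) * exp (- (1 / x))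
            + (exp (- (1 / x)) * - (- (1 / x * (1 / x)))) * poly p (1 / x)
          = flat_fun ([:0, 0, 1:] * (p - pderiv p)) x"
      using 1 by (simp add: flat_fun_def algebra_simps)
    finally have "((\<lambda>x. poly p (1 / x) * exp (- (1 / x))) has_real_derivative
            flat_fun ([:0, 0, 1:] * (p - pderiv p)) x) (at x)" .
    moreover have "\<forall>\<^sub>F y in nhds x. y > 0"
      using 1 eventually_nhds_in_open[of "{0<..}" x] by simp
    then have "\<forall>\<^sub>F y in nhds x. flat_fun p y = poly p (1 / y) * exp (- (1 / y))"
      by eventually_elim (simp add: flat_fun_def)
    ultimately show ?thesis
      by (subst DERIV_cong_ev[OF refl _ refl]) 
  next
    case 2
    have "\<forall>\<^sub>F y in nhds x. y < 0"
      using 2 eventually_nhds_in_open[of "{..<0}" x] by simp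
    then have "\<forall>\<^sub>F y in nhds x. flat_fun p y = 0"
      by eventually_elim (simp add: flat_fun_def)
    with 2 show ?thesis
      by (subst DERIV_cong_ev[OF refl _ refl]) (auto simp: flat_fun_def)
  next
    case 3
    have "((\<lambda>h. poly (pCons 0 p) (1 / h) * exp (- (1 / h))) \<longlongrightarrow> 0) (at_right 0)"
      by (rule filterlim_compose[OF poly_times_exp_neg_tendsto_0])
        (simp add: filterlim_inverse_at_top_right flip: inverse_eq_divide)
    then have "((\<lambda>h. flat_fun p h / h) \<longlongrightarrow> 0) (at_right 0)"
    proof (rule Lim_transform_eventually)
      show "\<forall>\<^sub>F h in at_right 0. poly (pCons 0 p) (1 / h) * exp (- (1 / h)) = flat_fun p h / h"
        using eventually_at_right_less[of "0::real"]
        by eventually_elim (simp add: flat_fun_def)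
    qed
    moreover have "((\<lambda>h. flat_fun p h / h) \<longlongrightarrow> 0) (at_left 0)"
    proof (rule Lim_transform_eventually[OF tendsto_const])
      show "\<forall>\<^sub>F h in at_left 0. 0 = flat_fun p h / h"
        by (rule eventually_at_leftI[of "-1"]) (auto simp: flat_fun_def)
    qed
    ultimately have "((\<lambda>h. flat_fun p h / h) \<longlongrightarrow> 0) (at 0)"
      by (simp add: filterlim_at_split)
    with 3 show ?thesis
      by (simp add: DERIV_def flat_fun_def)
  qed
qed

lemma smooth_fun_flat: "smooth_fun (\<lambda>x. flat_fun p (a * x + b))"
proof (rule smooth_fun_coinduct[of "\<lambda>f. \<exists>c p. f = (\<lambda>x. c * flat_fun p (a * x + b))"])
  show "\<exists>c q. (\<lambda>x. flat_fun p (a * x + b)) = (\<lambda>x. c * flat_fun q (a * x + b))"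
    by (intro exI[of _ 1] exI[of _ p]) simp
  fix f assume "\<exists>c p. f = (\<lambda>x. c * flat_fun p (a * x + b))"
  then obtain c p where f: "f = (\<lambda>x. c * flat_fun p (a * x + b))" by blast
  have "(f has_real_derivative (c * a) * flat_fun ([:0, 0, 1:] * (p - pderiv p)) (a * x + b)) (at x)" for x
    unfolding f
    by (auto intro!: derivative_eq_intros DERIV_chain2[OF flat_fun_has_derivative])
  then show "\<exists>f'. (\<forall>x. (f has_real_derivative f' x) (at x)) \<and>
      (\<exists>c p. f' = (\<lambda>x. c * flat_fun p (a * x + b)))"
    by (intro exI[of _ "\<lambda>x. (c * a) * flat_fun ([:0, 0, 1:] * (p - pderiv p)) (a * x + b)"]) blast
qed

text \<open>
  The argument \<open>n * (x - c) - 1\<close> of the flat function moves the support strictly inside \<open>{c<..<d}\<close>, so that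
  the bump is a test function even when \<open>{c..d}\<close> is the whole interval; yet it tends to infinity with
  \<open>n\<close>, so that the bumps converge to the indicator of \<open>{c<..<d}\<close>.
\<close>

definition bump :: "real \<Rightarrow> real \<Rightarrow> nat \<Rightarrow> real \<Rightarrow> real" where
  "bump c d n x = flat_fun 1 (real (Suc n) * (x - c) - 1) * flat_fun 1 (real (Suc n) * (d - x) - 1)"

lemma smooth_fun_bump: "smooth_fun (bump c d n)"
proof -
  have "smooth_fun (\<lambda>x. flat_fun 1 (real (Suc n) * x + (- real (Suc n) * c - 1)) *
      flat_fun 1 ((- real (Suc n)) * x + (real (Suc n) * d - 1)))"
    by (intro smooth_fun_mult smooth_fun_flat)
  moreover have "bump c d n = (\<lambda>x. flat_fun 1 (real (Suc n) * x + (- real (Suc n) * c - 1)) *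
      flat_fun 1 ((- real (Suc n)) * x + (real (Suc n) * d - 1)))"
    unfolding bump_def by (intro ext) (simp add: algebra_simps)
  ultimately show ?thesis by simp
qed

lemma bump_eq_0:
  assumes "x \<notin> {c + inverse (real (Suc n))..d - inverse (real (Suc n))}"
  shows "bump c d n x = 0"
proof -
  have "real (Suc n) * (x - c) - 1 = real (Suc n) * (x - (c + inverse (real (Suc n))))"
    "real (Suc n) * (d - x) - 1 = real (Suc n) * ((d - inverse (real (Suc n))) - x)"
    by (simp_all add: right_diff_distrib distrib_left del: of_nat_Suc)
  moreover have "real (Suc n) > 0" by simp
  ultimately show ?thesis
    using assms unfolding bump_def flat_fun_def
    by (auto simp: zero_less_mult_iff simp del: of_nat_Suc)
qed

lemma bump_bounds: "0 \<le> bump c d n x" "bump c d n x \<le> 1"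
proof -
  have "0 \<le> flat_fun 1 y" "flat_fun 1 y \<le> 1" for y
    by (auto simp: flat_fun_def)
  then show "0 \<le> bump c d n x" "bump c d n x \<le> 1"
    unfolding bump_def by (auto intro: mult_le_one)
qed

lemma flat_fun_1_tendsto: "(flat_fun 1 \<longlongrightarrow> 1) at_top"
proof -
  have "((\<lambda>x::real. exp (- inverse x)) \<longlongrightarrow> exp (- 0)) at_top"
    by (intro tendsto_intros tendsto_inverse_0_at_top filterlim_ident)
  moreover have "\<forall>\<^sub>F x in at_top. exp (- inverse x) = flat_fun 1 x"
    using eventually_gt_at_top[of "0::real"]
    by eventually_elim (simp add: flat_fun_def inverse_eq_divide)
  ultimately show ?thesis
    by (simp add: filterlim_cong)
qed

lemma bump_tendsto_indicator: "(\<lambda>n. bump c d n x) \<longlonglongrightarrow> indicator {c<..<d} x"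
proof (cases "x \<in> {c<..<d}")
  case True
  have lim: "filterlim (\<lambda>n. real (Suc n) * e - 1) at_top sequentially" if "e > 0" for e
  proof -
    have "filterlim (\<lambda>n. -1 + real (Suc n) * e) at_top sequentially"
      by (intro filterlim_tendsto_add_at_top[OF tendsto_const]
          filterlim_at_top_mult_tendsto_pos[OF tendsto_const that]
          filterlim_compose[OF filterlim_real_sequentially filterlim_Suc])
    then show ?thesis by simp
  qed
  have "(\<lambda>n. bump c d n x) \<longlonglongrightarrow> 1 * 1"
    unfolding bump_def using True
    by (intro tendsto_mult filterlim_compose[OF flat_fun_1_tendsto] lim) auto
  with True show ?thesis by simp
next
  case False
  have "inverse (real (Suc n)) > 0" for n by simp
  then have "x \<notin> {c + inverse (real (Suc n))..d - inverse (real (Suc n))}" for n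
    using False by (smt (verit) atLeastAtMost_iff greaterThanLessThan_iff)
  with False show ?thesis by (simp add: bump_eq_0)
qed

lemma bump_test_fun:
  assumes "a \<le> c" "d \<le> b"
  shows "bump c d n \<in> test_funs a b"
proof -
  have "a < c + inverse (real (Suc n))" "d - inverse (real (Suc n)) < b"
    using assms by (smt (verit) inverse_positive_iff_positive of_nat_0_less_iff zero_less_Suc)+
  then show ?thesis
    using smooth_fun_bump[of c d n] bump_eq_0[of _ c n d]
    unfolding test_funs_def smooth_fun_def by blast
qed

section \<open>The fundamental lemma of the calculus of variations\<close>

lemma finite_measure_lebesgue_on_Ioo: "finite_measure (lebesgue_on {a<..<b::real})"
  by (rule finite_measure_lebesgue_on) simp

lemma borel_measurable_lebesgue_onI:
  "f \<in> borel_measurable borel \<Longrightarrow> f \<in> borel_measurable (lebesgue_on S)"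
  by (intro measurable_restrict_space1 measurable_completion) simp

lemma integrable_lebesgue_on_bounded:
  assumes "f \<in> borel_measurable (lebesgue_on {a<..<b})" "\<And>x. x \<in> {a<..<b} \<Longrightarrow> norm (f x) \<le> B"
  shows "integrable (lebesgue_on {a<..<b::real}) (f :: real \<Rightarrow> 'a :: {banach, second_countable_topology})"
proof -
  interpret finite_measure "lebesgue_on {a<..<b}" by (rule finite_measure_lebesgue_on_Ioo)
  show ?thesis
    using assms by (intro integrable_const_bound[of _ B]) auto
qed

lemma L2_integrable:
  assumes "f \<in> L2 a b"
  shows "integrable (lebesgue_on {a<..<b}) f"
proof -
  interpret finite_measure "lebesgue_on {a<..<b}" by (rule finite_measure_lebesgue_on_Ioo)
  have f: "f \<in> borel_measurable (lebesgue_on {a<..<b})"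
    "integrable (lebesgue_on {a<..<b}) (\<lambda>\<xi>. (cmod (f \<xi>))\<^sup>2)"
    using assms by (auto simp: L2_def)
  have "integrable (lebesgue_on {a<..<b}) (\<lambda>\<xi>. 1 + (cmod (f \<xi>))\<^sup>2)"
    using f(2) by simp
  then show ?thesis
  proof (rule Bochner_Integration.integrable_bound)
    have "x \<le> 1 + x\<^sup>2" for x :: real
      using zero_le_power2[of "x - 1/2"] by (simp add: power2_eq_square algebra_simps)
    then show "AE x in lebesgue_on {a<..<b}. cmod (f x) \<le> norm (1 + (cmod (f x))\<^sup>2)"
      by (intro AE_I2) simp
  qed (use f(1) in auto)
qed

lemma L2_bounded:
  assumes "f \<in> borel_measurable (lebesgue_on {a<..<b})" "\<And>x. x \<in> {a<..<b} \<Longrightarrow> cmod (f x) \<le> B"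
  shows "f \<in> L2 a b"
proof -
  have "(cmod (f x))\<^sup>2 \<le> B\<^sup>2" if "x \<in> {a<..<b}" for x
    using assms(2)[OF that] by (simp add: power_mono)
  then show ?thesis
    unfolding L2_def using assms(1)
    by (auto intro!: integrable_lebesgue_on_bounded[where B = "B\<^sup>2"])
qed

lemma continuous_measurable_Ioo:
  fixes f :: "real \<Rightarrow> 'a :: euclidean_space"
  assumes "continuous_on {a..b} f"
  shows "f \<in> borel_measurable (lebesgue_on {a<..<b})"
  by (rule continuous_imp_measurable_on_sets_lebesgue)
    (auto intro!: continuous_on_subset[OF assms])

lemma L2_continuous:
  assumes "continuous_on {a..b} f"
  shows "f \<in> L2 a b"
proof -
  have "bounded (f ` {a..b})"
    using assms by (intro compact_imp_bounded compact_continuous_image) auto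
  then obtain B where "\<And>x. x \<in> {a..b} \<Longrightarrow> cmod (f x) \<le> B"
    unfolding bounded_iff by blast
  then show ?thesis
    by (intro L2_bounded[where B = B] continuous_measurable_Ioo assms) auto
qed

text \<open>
  The substitute for the triangle inequality in everything that follows.
\<close>

lemma norm_sq_add_le: "(norm (x + y))\<^sup>2 \<le> 2 * (norm x)\<^sup>2 + 2 * (norm y)\<^sup>2"
  for x y :: "'a::real_normed_vector"
proof -
  have "(norm (x + y))\<^sup>2 \<le> (norm x + norm y)\<^sup>2"
    by (intro power_mono norm_triangle_ineq) auto
  also have "\<dots> \<le> 2 * (norm x)\<^sup>2 + 2 * (norm y)\<^sup>2"
    using zero_le_power2[of "norm x - norm y"] by (simp add: power2_eq_square algebra_simps)
  finally show ?thesis .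
qed

lemma L2_add:
  assumes "f \<in> L2 a b" "g \<in> L2 a b"
  shows "(\<lambda>x. f x + g x) \<in> L2 a b"
proof -
  have "integrable (lebesgue_on {a<..<b}) (\<lambda>x. 2 * (cmod (f x))\<^sup>2 + 2 * (cmod (g x))\<^sup>2)"
    using assms by (auto simp: L2_def)
  then have "integrable (lebesgue_on {a<..<b}) (\<lambda>x. (cmod (f x + g x))\<^sup>2)"
  proof (rule Bochner_Integration.integrable_bound)
    show "AE x in lebesgue_on {a<..<b}.
        norm ((cmod (f x + g x))\<^sup>2) \<le> norm (2 * (cmod (f x))\<^sup>2 + 2 * (cmod (g x))\<^sup>2)"
      using norm_sq_add_le[of "f _" "g _"] by (intro AE_I2) simp
  qed (use assms in \<open>auto simp: L2_def\<close>)
  then show ?thesis using assms by (auto simp: L2_def)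
qed

lemma L2_scale:
  assumes "f \<in> L2 a b"
  shows "(\<lambda>x. c * f x) \<in> L2 a b"
  using assms by (auto simp: L2_def norm_mult power_mult_distrib)

lemma test_fun_bounded:
  assumes "\<phi> \<in> test_funs a b"
  obtains B where "\<And>x. \<bar>\<phi> x\<bar> \<le> B"
proof -
  obtain c d where cd: "\<And>x. x \<notin> {c..d} \<Longrightarrow> \<phi> x = 0" and "smooth_fun \<phi>"
    using assms by (auto simp: test_funs_def smooth_fun_def)
  then have "continuous_on {c..d} \<phi>"
    by (meson DERIV_isCont continuous_at_imp_continuous_on smooth_fun_step(1))
  then have "bounded (\<phi> ` {c..d})"
    by (intro compact_imp_bounded compact_continuous_image) auto
  then obtain B where B: "\<And>x. x \<in> {c..d} \<Longrightarrow> \<bar>\<phi> x\<bar> \<le> B"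
    unfolding bounded_iff by force
  have "\<bar>\<phi> x\<bar> \<le> max B 0" for x
    using B[of x] cd[of x] by (cases "x \<in> {c..d}") auto
  then show ?thesis using that by blast
qed

lemma test_fun_measurable:
  assumes "\<phi> \<in> test_funs a b"
  shows "\<phi> \<in> borel_measurable borel"
proof -
  have "smooth_fun \<phi>"
    using assms by (auto simp: test_funs_def smooth_fun_def)
  then have "continuous_on UNIV \<phi>"
    by (meson DERIV_isCont continuous_at_imp_continuous_on smooth_fun_step(1))
  then show ?thesis by (rule borel_measurable_continuous_onI)
qed

lemma test_fun_integrable:
  assumes "\<phi> \<in> test_funs a b" "integrable (lebesgue_on {a<..<b}) g"
  shows "integrable (lebesgue_on {a<..<b}) (\<lambda>x. complex_of_real (\<phi> x) * g x)"
proof -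
  obtain B where B: "\<And>x. \<bar>\<phi> x\<bar> \<le> B" using test_fun_bounded[OF assms(1)] by blast
  have m: "\<phi> \<in> borel_measurable (lebesgue_on {a<..<b})"
    by (intro borel_measurable_lebesgue_onI test_fun_measurable[OF assms(1)])
  have "integrable (lebesgue_on {a<..<b}) (\<lambda>x. complex_of_real B * g x)"
    using assms(2) by simp
  then show ?thesis
  proof (rule Bochner_Integration.integrable_bound)
    show "(\<lambda>x. complex_of_real (\<phi> x) * g x) \<in> borel_measurable (lebesgue_on {a<..<b})"
      using m assms(2) by measurable
    show "AE x in lebesgue_on {a<..<b}. cmod (complex_of_real (\<phi> x) * g x) \<le> cmod (complex_of_real B * g x)"
    proof (rule AE_I2)
      fix x
      have "\<bar>\<phi> x\<bar> \<le> \<bar>B\<bar>" using B[of x] by linarith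
      then show "cmod (complex_of_real (\<phi> x) * g x) \<le> cmod (complex_of_real B * g x)"
        by (simp add: norm_mult mult_right_mono)
    qed
  qed
qed

lemma test_fun_deriv:
  assumes "\<phi> \<in> test_funs a b"
  shows "deriv \<phi> \<in> test_funs a b"
proof -
  obtain c d where cd: "a < c" "d < b" "\<And>x. x \<notin> {c..d} \<Longrightarrow> \<phi> x = 0" and sm: "smooth_fun \<phi>"
    using assms by (auto simp: test_funs_def smooth_fun_def)
  have "deriv \<phi> x = 0" if "x \<notin> {c..d}" for x
  proof -
    have "open (- {c..d})" by auto
    then have "\<forall>\<^sub>F y in nhds x. \<phi> y = 0"
      using eventually_nhds_in_open[of "- {c..d}" x] that cd(3) by (auto elim!: eventually_mono)
    then have "deriv \<phi> x = deriv (\<lambda>_. 0) x"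
      by (intro deriv_cong_ev) auto
    then show ?thesis by simp
  qed
  with cd smooth_fun_step(2)[OF sm] show ?thesis
    unfolding test_funs_def smooth_fun_def by blast
qed

text \<open>
  Bumps approximate the indicator of an interval boundedly and pointwise; the claim follows by dominated
  convergence.
\<close>

lemma integral_zero_of_test_funs:
  fixes g :: "real \<Rightarrow> complex"
  assumes g: "integrable (lebesgue_on {a<..<b}) g"
    and zero: "\<And>\<phi>. \<phi> \<in> test_funs a b \<Longrightarrow> (\<integral>x. complex_of_real (\<phi> x) * g x \<partial>lebesgue_on {a<..<b}) = 0"
  shows "(\<integral>x. indicator {c<..<d} x *\<^sub>R g x \<partial>lebesgue_on {a<..<b}) = 0"
proof -
  let ?M = "lebesgue_on {a<..<b}"
  let ?c = "max a c" let ?d = "min b d"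
  have mb[measurable]: "bump ?c ?d n \<in> borel_measurable ?M" for n
    by (intro borel_measurable_lebesgue_onI test_fun_measurable[of _ a b] bump_test_fun) auto
  have mi[measurable]: "(indicator {c<..<d} :: real \<Rightarrow> real) \<in> borel_measurable ?M" for c d
    by (rule borel_measurable_lebesgue_onI) simp
  have [measurable]: "g \<in> borel_measurable ?M" using g by auto
  have "(\<lambda>n. \<integral>x. bump ?c ?d n x *\<^sub>R g x \<partial>?M) \<longlonglongrightarrow> (\<integral>x. indicator {?c<..<?d} x *\<^sub>R g x \<partial>?M)"
  proof (rule integral_dominated_convergence[where w = "\<lambda>x. norm (g x)"])
    show "AE x in ?M. (\<lambda>n. bump ?c ?d n x *\<^sub>R g x) \<longlonglongrightarrow> indicat_real {?c<..<?d} x *\<^sub>R g x"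
      by (intro AE_I2 tendsto_intros bump_tendsto_indicator)
    show "AE x in ?M. norm (bump ?c ?d n x *\<^sub>R g x) \<le> norm (g x)" for n
    proof (rule AE_I2)
      fix x
      have "norm (bump ?c ?d n x *\<^sub>R g x) = bump ?c ?d n x * norm (g x)"
        using bump_bounds(1)[of ?c ?d n x] by simp
      also have "\<dots> \<le> norm (g x)"
        by (rule mult_left_le_one_le[OF norm_ge_zero bump_bounds])
      finally show "norm (bump ?c ?d n x *\<^sub>R g x) \<le> norm (g x)" .
    qed
  qed (use g in auto)
  moreover have "(\<integral>x. bump ?c ?d n x *\<^sub>R g x \<partial>?M) = 0" for n
    using zero[OF bump_test_fun[of a ?c ?d b n]] by (simp add: scaleR_conv_of_real)
  ultimately have "(\<integral>x. indicator {?c<..<?d} x *\<^sub>R g x \<partial>?M) = 0"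
    by (simp add: LIMSEQ_const_iff)
  also have "(\<integral>x. indicator {?c<..<?d} x *\<^sub>R g x \<partial>?M) = (\<integral>x. indicator {c<..<d} x *\<^sub>R g x \<partial>?M)"
    by (intro Bochner_Integration.integral_cong) (auto simp: indicator_def)
  finally show ?thesis .
qed

text \<open>
  The open intervals are a generator of the Borel sets that is stable under intersection, so all integrals
  over Borel sets vanish, and up to null sets every Lebesgue set is a Borel set.
\<close>

lemma AE_zero_of_interval_integrals:
  fixes g :: "real \<Rightarrow> complex"
  assumes g: "integrable (lebesgue_on {a<..<b}) g"
    and zero: "\<And>c d. (\<integral>x. indicator {c<..<d} x *\<^sub>R g x \<partial>lebesgue_on {a<..<b}) = 0"
  shows "AE x in lebesgue_on {a<..<b}. g x = 0"
proof -
  let ?M = "lebesgue_on {a<..<b}"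
  define I where "I A = (\<integral>x. indicator A x *\<^sub>R g x \<partial>?M)" for A
  have gm[measurable]: "g \<in> borel_measurable ?M" using g by auto
  have im: "(indicator A :: real \<Rightarrow> real) \<in> borel_measurable ?M" if "A \<in> sets borel" for A
    by (rule borel_measurable_lebesgue_onI) (use that in simp)
  have int: "integrable ?M (\<lambda>x. indicator A x *\<^sub>R g x)" if "A \<in> sets borel" for A
  proof (rule Bochner_Integration.integrable_bound[OF g])
    have [measurable]: "(indicator A :: real \<Rightarrow> real) \<in> borel_measurable ?M"
      by (rule im[OF that])
    show "(\<lambda>x. indicator A x *\<^sub>R g x) \<in> borel_measurable ?M"
      by measurable
    show "AE x in ?M. norm (indicator A x *\<^sub>R g x) \<le> norm (g x)"
      by (intro AE_I2) (simp add: indicator_def)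
  qed
  have I0: "I A = 0" if "A \<in> sets borel" for A
  proof -
    have gen: "sets borel = sigma_sets UNIV (range (\<lambda>(c, d). {c<..<d::real}))"
    proof -
      have "box = (\<lambda>c d. {c<..<d::real})"
        by (intro ext) (rule box_real)
      moreover have "sets borel = sigma_sets UNIV (range (\<lambda>(c, d). box c d :: real set))"
        unfolding borel_eq_box by (rule sets_measure_of) simp
      ultimately show ?thesis by (simp only:)
    qed
    have "Int_stable (range (\<lambda>(c, d). {c<..<d::real}))"
      by (auto simp: Int_stable_def Int_greaterThanLessThan)
    moreover have "range (\<lambda>(c, d). {c<..<d::real}) \<subseteq> Pow UNIV" by simp
    moreover have "A \<in> sigma_sets UNIV (range (\<lambda>(c, d). {c<..<d::real}))"
      using that gen by simp
    ultimately show ?thesis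
    proof (induction A rule: sigma_sets_induct_disjoint)
      case (basic A)
      then show ?case using zero by (auto simp: I_def)
    next
      case empty
      then show ?case by (simp add: I_def)
    next
      case (compl A)
      have A: "A \<in> sets borel"
        using compl(1) gen by simp
      have "(\<integral>x. indicator {a<..<b} x *\<^sub>R g x \<partial>?M) = (\<integral>x. g x \<partial>?M)"
        by (rule Bochner_Integration.integral_cong) auto
      then have "(\<integral>x. g x \<partial>?M) = 0" using zero[of a b] by simp
      moreover have "I (UNIV - A) = (\<integral>x. g x - indicator A x *\<^sub>R g x \<partial>?M)"
        unfolding I_def by (rule Bochner_Integration.integral_cong) (auto simp: indicator_def)
      moreover have "\<dots> = (\<integral>x. g x \<partial>?M) - I A"
        unfolding I_def by (rule Bochner_Integration.integral_diff[OF g int[OF A]])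
      ultimately show ?case using compl(2) by simp
    next
      case (union A)
      have A: "A i \<in> sets borel" for i
        using union(2) gen by auto
      have S: "set_lebesgue_integral ?M (A i \<inter> {a<..<b}) g = I (A i)" for i
        unfolding I_def set_lebesgue_integral_def
        by (rule Bochner_Integration.integral_cong) (auto simp: indicator_def)
      have "set_lebesgue_integral ?M (\<Union>i. A i \<inter> {a<..<b}) g = I (\<Union>i. A i)"
        unfolding I_def set_lebesgue_integral_def
        by (rule Bochner_Integration.integral_cong) (auto simp: indicator_def)
      moreover have "set_lebesgue_integral ?M (\<Union>i. A i \<inter> {a<..<b}) g
          = (\<Sum>i. set_lebesgue_integral ?M (A i \<inter> {a<..<b}) g)"
      proof (rule lebesgue_integral_countable_add)
        show "A i \<inter> {a<..<b} \<in> sets ?M" for i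
          using A[of i] by (auto simp: sets_restrict_space_iff)
        show "(A i \<inter> {a<..<b}) \<inter> (A j \<inter> {a<..<b}) = {}" if "i \<noteq> j" for i j
          using union(1) that by (auto simp: disjoint_family_on_def)
        have "set_integrable ?M (\<Union>i. A i) g"
          unfolding set_integrable_def using A by (intro int) auto
        then show "set_integrable ?M (\<Union>i. A i \<inter> {a<..<b}) g"
          unfolding set_integrable_def
          by (rule Bochner_Integration.integrable_cong[THEN iffD1, rotated 2]) (auto simp: indicator_def)
      qed
      ultimately show ?case using union(3) S by simp
    qed
  qed
  interpret finite_measure ?M by (rule finite_measure_lebesgue_on_Ioo)
  show ?thesis
  proof (rule density_zero[OF g])
    fix A assume "A \<in> sets ?M"
    then have "A \<in> sets lebesgue" "A \<subseteq> {a<..<b}"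
      by (auto simp: sets_restrict_space_iff)
    then obtain S N N' where A: "A = S \<union> N" "N \<subseteq> N'" "N' \<in> null_sets lborel" "S \<in> sets lborel"
      by (auto elim: sets_completionE)
    have "N' \<in> null_sets lebesgue"
      using A(3) by (rule null_sets_completionI)
    then have "AE x in ?M. x \<notin> N'"
      using AE_not_in[of N' lebesgue] by (simp add: AE_restrict_space_iff eventually_mono)
    then have ae: "AE x in ?M. indicator A x *\<^sub>R g x = indicator S x *\<^sub>R g x"
      by eventually_elim (use A(1,2) in \<open>auto simp: indicator_def\<close>)
    have "(indicator A :: real \<Rightarrow> real) \<in> borel_measurable ?M"
      using \<open>A \<in> sets ?M\<close> by simp
    then have "set_lebesgue_integral ?M A g = I S"
      unfolding I_def set_lebesgue_integral_def
      by (intro integral_cong_AE ae) (use im[of S] A(4) in auto)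
    then show "set_lebesgue_integral ?M A g = 0"
      using I0[of S] A(4) by simp
  qed
qed

section \<open>Weak derivatives and point values\<close>

lemma has_weak_deriv_unique:
  assumes "g1 \<in> L2 a b" "g2 \<in> L2 a b" "has_weak_deriv a b f g1" "has_weak_deriv a b f g2"
  shows "AE x in lebesgue_on {a<..<b}. g1 x = g2 x"
proof -
  let ?M = "lebesgue_on {a<..<b}"
  have i: "integrable ?M g1" "integrable ?M g2"
    using assms L2_integrable by auto
  have "AE x in ?M. g1 x - g2 x = 0"
  proof (rule AE_zero_of_interval_integrals, goal_cases)
    case 1
    then show ?case using i by simp
  next
    case (2 c d)
    then show ?case
    proof (rule integral_zero_of_test_funs)
      fix \<phi> assume \<phi>: "\<phi> \<in> test_funs a b"
      have "(\<integral>x. complex_of_real (\<phi> x) * (g1 x - g2 x) \<partial>?M)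
          = (\<integral>x. complex_of_real (\<phi> x) * g1 x - complex_of_real (\<phi> x) * g2 x \<partial>?M)"
        by (simp add: algebra_simps)
      also have "\<dots> = (\<integral>x. complex_of_real (\<phi> x) * g1 x \<partial>?M) - (\<integral>x. complex_of_real (\<phi> x) * g2 x \<partial>?M)"
        by (intro Bochner_Integration.integral_diff test_fun_integrable[OF \<phi>] i)
      also have "\<dots> = 0"
        using assms(3,4)[unfolded has_weak_deriv_def, rule_format, OF \<phi>] by simp
      finally show "(\<integral>x. complex_of_real (\<phi> x) * (g1 x - g2 x) \<partial>?M) = 0" .
    qed (use i in simp)
  qed
  then show ?thesis by eventually_elim simp
qed

lemma weak_deriv_props:
  assumes "g \<in> L2 a b" "has_weak_deriv a b f g"
  shows "weak_deriv a b f \<in> L2 a b" "has_weak_deriv a b f (weak_deriv a b f)"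
    "AE x in lebesgue_on {a<..<b}. weak_deriv a b f x = g x"
proof -
  have *: "weak_deriv a b f \<in> L2 a b \<and> has_weak_deriv a b f (weak_deriv a b f)"
    unfolding weak_deriv_def by (rule someI[of _ g]) (use assms in auto)
  then show "weak_deriv a b f \<in> L2 a b" "has_weak_deriv a b f (weak_deriv a b f)"
    by auto
  with assms show "AE x in lebesgue_on {a<..<b}. weak_deriv a b f x = g x"
    by (intro has_weak_deriv_unique) auto
qed

lemma H1_weak_deriv:
  assumes "f \<in> H1 a b"
  shows "weak_deriv a b f \<in> L2 a b" "has_weak_deriv a b f (weak_deriv a b f)" "f \<in> L2 a b"
  using assms weak_deriv_props by (auto simp: H1_def)

lemma has_weak_deriv_cong_AE:
  assumes "f \<in> L2 a b" "f' \<in> L2 a b" "g \<in> L2 a b" "g' \<in> L2 a b"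
    and "AE x in lebesgue_on {a<..<b}. f x = f' x" "AE x in lebesgue_on {a<..<b}. g x = g' x"
    and "has_weak_deriv a b f g"
  shows "has_weak_deriv a b f' g'"
  unfolding has_weak_deriv_def
proof
  fix \<phi> assume \<phi>: "\<phi> \<in> test_funs a b"
  let ?M = "lebesgue_on {a<..<b}"
  have i: "integrable ?M f" "integrable ?M g" "integrable ?M f'" "integrable ?M g'"
    using assms L2_integrable by auto
  have "(\<integral>\<xi>. complex_of_real (deriv \<phi> \<xi>) * f \<xi> \<partial>?M) = (\<integral>\<xi>. complex_of_real (deriv \<phi> \<xi>) * f' \<xi> \<partial>?M)"
    using assms(5) test_fun_integrable[OF test_fun_deriv[OF \<phi>]] i
    by (intro integral_cong_AE) (auto elim!: eventually_mono)
  moreover have "(\<integral>\<xi>. complex_of_real (\<phi> \<xi>) * g \<xi> \<partial>?M) = (\<integral>\<xi>. complex_of_real (\<phi> \<xi>) * g' \<xi> \<partial>?M)"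
    using assms(6) test_fun_integrable[OF \<phi>] i
    by (intro integral_cong_AE) (auto elim!: eventually_mono)
  ultimately show "(\<integral>\<xi>. complex_of_real (deriv \<phi> \<xi>) * f' \<xi> \<partial>?M) = - (\<integral>\<xi>. complex_of_real (\<phi> \<xi>) * g' \<xi> \<partial>?M)"
    using assms(7) \<phi> by (simp add: has_weak_deriv_def)
qed

lemma has_weak_deriv_lincomb:
  assumes "f1 \<in> L2 a b" "f2 \<in> L2 a b" "g1 \<in> L2 a b" "g2 \<in> L2 a b"
    and "has_weak_deriv a b f1 g1" "has_weak_deriv a b f2 g2"
  shows "has_weak_deriv a b (\<lambda>x. c * f1 x + f2 x) (\<lambda>x. c * g1 x + g2 x)"
  unfolding has_weak_deriv_def
proof
  fix \<phi> assume \<phi>: "\<phi> \<in> test_funs a b"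
  let ?M = "lebesgue_on {a<..<b}"
  have i: "integrable ?M f1" "integrable ?M f2" "integrable ?M g1" "integrable ?M g2"
    using assms L2_integrable by auto
  have lin: "(\<integral>x. complex_of_real (\<psi> x) * (c * h x + k x) \<partial>?M)
      = c * (\<integral>x. complex_of_real (\<psi> x) * h x \<partial>?M) + (\<integral>x. complex_of_real (\<psi> x) * k x \<partial>?M)"
    if "\<psi> \<in> test_funs a b" "integrable ?M h" "integrable ?M k" for \<psi> h k
  proof -
    have "(\<integral>x. complex_of_real (\<psi> x) * (c * h x + k x) \<partial>?M)
        = (\<integral>x. c * (complex_of_real (\<psi> x) * h x) + complex_of_real (\<psi> x) * k x \<partial>?M)"
      by (simp add: algebra_simps)
    also have "\<dots> = (\<integral>x. c * (complex_of_real (\<psi> x) * h x) \<partial>?M) + (\<integral>x. complex_of_real (\<psi> x) * k x \<partial>?M)"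
      by (intro Bochner_Integration.integral_add integrable_mult_right test_fun_integrable that)
    finally show ?thesis by simp
  qed
  show "(\<integral>x. complex_of_real (deriv \<phi> x) * (c * f1 x + f2 x) \<partial>?M)
      = - (\<integral>x. complex_of_real (\<phi> x) * (c * g1 x + g2 x) \<partial>?M)"
    using assms(5,6) \<phi> by (simp add: lin i test_fun_deriv has_weak_deriv_def)
qed

lemma integral_lebesgue_on_FTC:
  fixes f :: "real \<Rightarrow> 'a :: euclidean_space"
  assumes "a \<le> b"
    and F: "\<And>x. x \<in> {a..b} \<Longrightarrow> (F has_vector_derivative f x) (at x within {a..b})"
    and f: "continuous_on {a..b} f"
  shows "(\<integral>x. f x \<partial>lebesgue_on {a<..<b}) = F b - F a"
proof -
  have "(\<integral>x. f x \<partial>lebesgue_on {a<..<b}) = (\<integral>x. indicator {a<..<b} x *\<^sub>R f x \<partial>lebesgue)"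
    by (rule integral_restrict_space) auto
  also have "\<dots> = (\<integral>x. indicator {a<..<b} x *\<^sub>R f x \<partial>lborel)"
    by (rule integral_completion)
      (auto intro!: borel_measurable_continuous_on_indicator continuous_on_subset[OF f])
  also have "\<dots> = (\<integral>x. indicator {a..b} x *\<^sub>R f x \<partial>lborel)"
  proof (rule integral_cong_AE)
    have "AE x in lborel. x \<noteq> a" "AE x in lborel. x \<noteq> b"
      by (auto simp: AE_lborel_singleton)
    then show "AE x in lborel. indicator {a<..<b} x *\<^sub>R f x = indicator {a..b} x *\<^sub>R f x"
      by eventually_elim (auto simp: indicator_def)
  qed (auto intro!: borel_measurable_continuous_on_indicator continuous_on_subset[OF f])
  also have "\<dots> = F b - F a"
    by (rule integral_FTC_atLeastAtMost) (use assms in auto)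
  finally show ?thesis .
qed

lemma test_fun_has_derivative:
  assumes "\<phi> \<in> test_funs a b"
  shows "(\<phi> has_real_derivative deriv \<phi> x) (at x within S)"
  using assms smooth_fun_step(1)[of \<phi> x] DERIV_subset[of \<phi> _ x UNIV S]
  by (auto simp: test_funs_def smooth_fun_def)

lemma test_fun_continuous:
  assumes "\<phi> \<in> test_funs a b"
  shows "continuous_on S \<phi>"
  using test_fun_has_derivative[OF assms] by (meson DERIV_continuous_on)

text \<open>
  Integration by parts: the boundary terms vanish with the test function.
\<close>

lemma has_weak_deriv_classical:
  fixes f :: "real \<Rightarrow> complex"
  assumes "a \<le> b"
    and f: "\<And>x. x \<in> {a..b} \<Longrightarrow> (f has_vector_derivative f' x) (at x within {a..b})"
    and f': "continuous_on {a..b} f'"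
  shows "has_weak_deriv a b f f'"
  unfolding has_weak_deriv_def
proof
  fix \<phi> assume \<phi>: "\<phi> \<in> test_funs a b"
  let ?M = "lebesgue_on {a<..<b}"
  have cf: "continuous_on {a..b} f"
    using f by (rule continuous_on_vector_derivative)
  have cd: "continuous_on {a..b} (deriv \<phi>)"
    by (rule test_fun_continuous[OF test_fun_deriv[OF \<phi>]])
  have ends: "\<phi> a = 0" "\<phi> b = 0"
    using \<phi> by (auto simp: test_funs_def)
  have "(\<integral>x. complex_of_real (\<phi> x) * f' x + complex_of_real (deriv \<phi> x) * f x \<partial>?M)
      = complex_of_real (\<phi> b) * f b - complex_of_real (\<phi> a) * f a"
  proof (rule integral_lebesgue_on_FTC[OF \<open>a \<le> b\<close>])
    show "((\<lambda>x. complex_of_real (\<phi> x) * f x) has_vector_derivative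
        complex_of_real (\<phi> x) * f' x + complex_of_real (deriv \<phi> x) * f x) (at x within {a..b})"
      if "x \<in> {a..b}" for x
      by (intro has_vector_derivative_mult f that has_vector_derivative_of_real)
        (use test_fun_has_derivative[OF \<phi>] in \<open>simp add: has_real_derivative_iff_has_vector_derivative\<close>)
    show "continuous_on {a..b} (\<lambda>x. complex_of_real (\<phi> x) * f' x + complex_of_real (deriv \<phi> x) * f x)"
      by (intro continuous_intros f' cf cd test_fun_continuous[OF \<phi>])
  qed
  also have "\<dots> = 0" using ends by simp
  also have "(\<integral>x. complex_of_real (\<phi> x) * f' x + complex_of_real (deriv \<phi> x) * f x \<partial>?M)
      = (\<integral>x. complex_of_real (\<phi> x) * f' x \<partial>?M) + (\<integral>x. complex_of_real (deriv \<phi> x) * f x \<partial>?M)"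
    using \<phi> test_fun_deriv[OF \<phi>] cf f'
    by (intro Bochner_Integration.integral_add test_fun_integrable L2_integrable L2_continuous)
  finally show "(\<integral>x. complex_of_real (deriv \<phi> x) * f x \<partial>?M) = - (\<integral>x. complex_of_real (\<phi> x) * f' x \<partial>?M)"
    by (simp add: add_eq_0_iff)
qed

text \<open>
  Two continuous functions that agree almost everywhere agree on the closed interval, so the description in
  the definition of \<open>pt_val\<close> has exactly one solution.
\<close>

lemma pt_val_continuous:
  assumes "a < b" "continuous_on {a..b} g" "AE x in lebesgue_on {a<..<b}. f x = g x" "c \<in> {a..b}"
  shows "pt_val a b f c = g c"
  unfolding pt_val_def
proof (rule the_equality)
  show "\<exists>g'. continuous_on {a..b} g' \<and> (AE \<xi> in lebesgue_on {a<..<b}. f \<xi> = g' \<xi>) \<and> g' c = g c"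
    using assms by blast
next
  fix z
  assume "\<exists>g'. continuous_on {a..b} g' \<and> (AE \<xi> in lebesgue_on {a<..<b}. f \<xi> = g' \<xi>) \<and> g' c = z"
  then obtain g' where g': "continuous_on {a..b} g'" "AE \<xi> in lebesgue_on {a<..<b}. f \<xi> = g' \<xi>" "g' c = z"
    by blast
  have ae: "AE x in lebesgue_on {a<..<b}. g' x = g x"
    using assms(3) g'(2) by eventually_elim simp
  have cont: "continuous_on {a..b} (\<lambda>x. g' x - g x)"
    by (intro continuous_intros g' assms)
  define U where "U = {x \<in> {a<..<b}. g' x - g x \<noteq> 0}"
  have "open U"
    unfolding U_def
  proof -
    have "continuous_on {a<..<b} (\<lambda>x. g' x - g x)"
      by (rule continuous_on_subset[OF cont]) auto
    from continuous_open_preimage[OF this, of "- {0}"]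
    show "open {x \<in> {a<..<b}. g' x - g x \<noteq> 0}"
      by (simp add: vimage_def Int_def open_Compl)
  qed
  moreover have "AE x in lebesgue. x \<notin> U"
    using ae by (simp add: AE_restrict_space_iff U_def eventually_mono)
  then have "U \<in> null_sets lebesgue"
    using AE_iff_null_sets[of U lebesgue] \<open>open U\<close> by auto
  ultimately have "U = {}"
    using open_not_negligible negligible_iff_null_sets by blast
  then have "\<And>x. x \<in> {a<..<b} \<Longrightarrow> g' x - g x = 0" by (auto simp: U_def)
  moreover have "c \<in> closure {a<..<b}"
    using assms(1,4) by (simp add: closure_greaterThanLessThan)
  moreover have "continuous_on (closure {a<..<b}) (\<lambda>x. g' x - g x)"
    using cont assms(1) by (simp add: closure_greaterThanLessThan)
  ultimately have "g' c - g c = 0"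
    using continuous_constant_on_closure[of "{a<..<b}" "\<lambda>x. g' x - g x" 0 c] by simp
  then show "z = g c" using g'(3) by simp
qed

section \<open>Weak solutions of linear differential equations\<close>

lemma smooth_fun_antideriv_exists:
  assumes "smooth_fun f"
  shows "\<exists>F. \<forall>x. (F has_real_derivative f x) (at x)"
proof -
  have "\<exists>F. \<forall>x::real. - \<infinity> < ereal x \<longrightarrow> ereal x < \<infinity> \<longrightarrow> (F has_vector_derivative f x) (at x)"
    by (rule einterval_antiderivative) (use smooth_fun_step(1)[OF assms] DERIV_isCont in auto)
  then show ?thesis
    by (simp add: has_real_derivative_iff_has_vector_derivative)
qed

text \<open>
  An antiderivative is constant to the left and to the right of the support, and the vanishing integral makes
  the two constants equal.
\<close>

lemma test_fun_antideriv:
  assumes "a < b" and \<eta>: "\<eta> \<in> test_funs a b" and zero: "(\<integral>x. \<eta> x \<partial>lebesgue_on {a<..<b}) = 0"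
  obtains \<Phi> where "\<Phi> \<in> test_funs a b" "deriv \<Phi> = \<eta>"
proof -
  obtain c d where cd: "a < c" "d < b" "\<And>x. x \<notin> {c..d} \<Longrightarrow> \<eta> x = 0" and sm: "smooth_fun \<eta>"
    using \<eta> by (auto simp: test_funs_def smooth_fun_def)
  obtain F where F: "\<And>x. (F has_real_derivative \<eta> x) (at x)"
    using smooth_fun_antideriv_exists[OF sm] by blast
  define \<Phi> where "\<Phi> x = F x - F a" for x
  have \<Phi>: "(\<Phi> has_real_derivative \<eta> x) (at x)" for x
    unfolding \<Phi>_def using F by (auto intro!: derivative_eq_intros)
  have "F b - F a = (\<integral>x. \<eta> x \<partial>lebesgue_on {a<..<b})"
  proof (rule integral_lebesgue_on_FTC[symmetric])
    show "(F has_vector_derivative \<eta> x) (at x within {a..b})" for x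
      using F[of x] by (simp add: has_real_derivative_iff_has_vector_derivative has_vector_derivative_at_within)
  qed (use \<open>a < b\<close> test_fun_continuous[OF \<eta>] in auto)
  with zero have ab: "\<Phi> a = 0" "\<Phi> b = 0" by (simp_all add: \<Phi>_def)
  have "\<Phi> x = 0" if "x \<notin> {c..d}" for x
  proof (cases "x < c")
    case True
    have "\<Phi> constant_on {..<c}"
    proof (rule has_field_derivative_0_imp_constant_on)
      show "(\<Phi> has_field_derivative 0) (at x)" if "x \<in> {..<c}" for x
        using \<Phi>[of x] cd(3)[of x] that by simp
    qed auto
    then show ?thesis using ab True cd(1) by (auto simp: constant_on_def)
  next
    case False
    with that have "x > d" by auto
    have "\<Phi> constant_on {d<..}"
    proof (rule has_field_derivative_0_imp_constant_on)
      show "(\<Phi> has_field_derivative 0) (at x)" if "x \<in> {d<..}" for x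
        using \<Phi>[of x] cd(3)[of x] that by simp
    qed auto
    then show ?thesis using ab \<open>x > d\<close> cd(2) by (auto simp: constant_on_def)
  qed
  moreover have "smooth_fun \<Phi>"
    by (rule smooth_fun_antideriv[OF \<Phi> sm])
  ultimately have "\<Phi> \<in> test_funs a b"
    using cd(1,2) unfolding test_funs_def smooth_fun_def by blast
  moreover have "deriv \<Phi> = \<eta>"
    by (intro ext DERIV_imp_deriv \<Phi>)
  ultimately show ?thesis using that by blast
qed

lemma test_fun_mult:
  assumes "\<phi> \<in> test_funs a b" "smooth_fun f"
  shows "(\<lambda>x. \<phi> x * f x) \<in> test_funs a b"
proof -
  obtain c d where cd: "a < c" "d < b" "\<And>x. x \<notin> {c..d} \<Longrightarrow> \<phi> x = 0" and sm: "smooth_fun \<phi>"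
    using assms by (auto simp: test_funs_def smooth_fun_def)
  then have "\<And>x. x \<notin> {c..d} \<Longrightarrow> \<phi> x * f x = 0" by simp
  with cd(1,2) smooth_fun_mult[OF sm assms(2)] show ?thesis
    unfolding test_funs_def smooth_fun_def by blast
qed

lemma test_fun_add:
  assumes "\<phi> \<in> test_funs a b" "\<psi> \<in> test_funs a b"
  shows "(\<lambda>x. \<phi> x + \<psi> x) \<in> test_funs a b"
proof -
  obtain c d where cd: "a < c" "d < b" "\<And>x. x \<notin> {c..d} \<Longrightarrow> \<phi> x = 0" and sm: "smooth_fun \<phi>"
    using assms by (auto simp: test_funs_def smooth_fun_def)
  obtain c' d' where cd': "a < c'" "d' < b" "\<And>x. x \<notin> {c'..d'} \<Longrightarrow> \<psi> x = 0" and sm': "smooth_fun \<psi>"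
    using assms by (auto simp: test_funs_def smooth_fun_def)
  have "\<phi> x + \<psi> x = 0" if "x \<notin> {min c c'..max d d'}" for x
  proof -
    have "x \<notin> {c..d}" "x \<notin> {c'..d'}" using that by auto
    then show ?thesis using cd(3) cd'(3) by simp
  qed
  moreover have "a < min c c'" "max d d' < b" using cd cd' by auto
  ultimately show ?thesis
    using smooth_fun_add[OF sm sm'] unfolding test_funs_def smooth_fun_def by blast
qed

lemma test_fun_real_integrable:
  assumes "\<phi> \<in> test_funs a b"
  shows "integrable (lebesgue_on {a<..<b}) \<phi>"
proof -
  obtain B where "\<And>x. \<bar>\<phi> x\<bar> \<le> B" using test_fun_bounded[OF assms] by blast
  then show ?thesis
    by (intro integrable_lebesgue_on_bounded[where B = B] borel_measurable_lebesgue_onI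
        test_fun_measurable[OF assms]) simp
qed

lemma test_fun_nonzero_integral:
  assumes "a < b"
  obtains \<psi> where "\<psi> \<in> test_funs a b" "(\<integral>x. \<psi> x \<partial>lebesgue_on {a<..<b}) \<noteq> 0"
proof -
  let ?M = "lebesgue_on {a<..<b}"
  have "(\<integral>x. indicator {a<..<b} x *\<^sub>R (1::complex) \<partial>?M) \<noteq> 0"
  proof -
    have "(\<integral>x. indicator {a<..<b} x *\<^sub>R (1::complex) \<partial>?M) = (\<integral>x. 1 \<partial>?M)"
      by (rule Bochner_Integration.integral_cong) auto
    also have "\<dots> = complex_of_real b - complex_of_real a"
    proof (rule integral_lebesgue_on_FTC)
      show "(complex_of_real has_vector_derivative 1) (at x within {a..b})" for x
        using has_vector_derivative_of_real[OF DERIV_ident] by simp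
    qed (use assms in auto)
    finally show ?thesis using assms by simp
  qed
  moreover have "integrable ?M (\<lambda>_. 1 :: complex)"
    by (rule integrable_lebesgue_on_bounded[where B = 1]) auto
  ultimately obtain \<phi> where \<phi>: "\<phi> \<in> test_funs a b" "(\<integral>x. complex_of_real (\<phi> x) * 1 \<partial>?M) \<noteq> 0"
    using integral_zero_of_test_funs[of a b "\<lambda>_. 1" a b] by blast
  then show ?thesis
    using that[of \<phi>] by simp
qed

text \<open>
  A test function is a derivative of a test function iff its integral vanishes. Correcting an arbitrary test
  function by a multiple of a fixed one \<open>\<psi>0\<close> with nonzero integral reduces the claim to the fundamental
  lemma, applied to \<open>f - C\<close>.
\<close>

lemma du_Bois_Reymond:
  fixes f :: "real \<Rightarrow> complex"
  assumes "a < b" and f: "integrable (lebesgue_on {a<..<b}) f"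
    and zero: "\<And>\<phi>. \<phi> \<in> test_funs a b \<Longrightarrow>
      (\<integral>x. complex_of_real (deriv \<phi> x) * f x \<partial>lebesgue_on {a<..<b}) = 0"
  obtains C where "AE x in lebesgue_on {a<..<b}. f x = C"
proof -
  let ?M = "lebesgue_on {a<..<b}"
  interpret finite_measure ?M by (rule finite_measure_lebesgue_on_Ioo)
  obtain \<psi>0 where \<psi>0: "\<psi>0 \<in> test_funs a b" "(\<integral>x. \<psi>0 x \<partial>?M) \<noteq> 0"
    using test_fun_nonzero_integral[OF \<open>a < b\<close>] by blast
  define J where "J \<psi> = (\<integral>x. \<psi> x \<partial>?M)" for \<psi> :: "real \<Rightarrow> real"
  define L where "L \<psi> = (\<integral>x. complex_of_real (\<psi> x) * f x \<partial>?M)" for \<psi>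
  define C where "C = L \<psi>0 / complex_of_real (J \<psi>0)"
  have fC: "integrable ?M (\<lambda>x. f x - C)" using f by simp
  have eq: "(\<integral>x. complex_of_real (\<psi> x) * (f x - C) \<partial>?M) = 0" if \<psi>: "\<psi> \<in> test_funs a b" for \<psi>
  proof -
    define k where "k = J \<psi> / J \<psi>0"
    define \<eta> where "\<eta> x = \<psi> x + \<psi>0 x * (- k)" for x
    have \<eta>: "\<eta> \<in> test_funs a b"
      unfolding \<eta>_def by (intro test_fun_add test_fun_mult \<psi> \<psi>0 smooth_fun_const)
    have "(\<integral>x. \<eta> x \<partial>?M) = J \<psi> + J \<psi>0 * (- k)"
      unfolding \<eta>_def J_def using test_fun_real_integrable \<psi> \<psi>0 by simp
    also have "\<dots> = 0" using \<psi>0(2) by (simp add: k_def J_def)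
    finally obtain \<Phi> where "\<Phi> \<in> test_funs a b" "deriv \<Phi> = \<eta>"
      using test_fun_antideriv[OF \<open>a < b\<close> \<eta>] by blast
    then have "L \<eta> = 0" using zero[of \<Phi>] by (simp add: L_def)
    moreover have "L \<eta> = (\<integral>x. complex_of_real (\<psi> x) * f x + complex_of_real (\<psi>0 x) * f x * complex_of_real (- k) \<partial>?M)"
      unfolding L_def \<eta>_def by (simp add: algebra_simps)
    moreover have "\<dots> = L \<psi> + L \<psi>0 * complex_of_real (- k)"
      unfolding L_def using test_fun_integrable[OF \<psi> f] test_fun_integrable[OF \<psi>0(1) f] by simp
    ultimately have L: "L \<psi> = complex_of_real (J \<psi>) * C"
      by (simp add: C_def k_def)
    have "(\<integral>x. complex_of_real (\<psi> x) * (f x - C) \<partial>?M)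
        = (\<integral>x. complex_of_real (\<psi> x) * f x - complex_of_real (\<psi> x) * C \<partial>?M)"
      by (simp add: algebra_simps)
    also have "\<dots> = L \<psi> - complex_of_real (J \<psi>) * C"
      unfolding L_def J_def using test_fun_integrable[OF \<psi> f] test_fun_real_integrable[OF \<psi>] by simp
    finally show ?thesis using L by simp
  qed
  have "AE x in ?M. f x - C = 0"
    by (intro AE_zero_of_interval_integrals integral_zero_of_test_funs fC eq)
  then have "AE x in ?M. f x = C" by eventually_elim simp
  then show ?thesis by (rule that)
qed

text \<open>
  With the integrating factor \<open>E x = exp (- \<kappa> * x)\<close>, the product \<open>E * p\<close> has weak derivative zero. The product
  rule is read off by testing the equation against \<open>\<phi> * Re E\<close> and \<open>\<phi> * Im E\<close>.
\<close>

lemma weak_exponential_ode: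
  assumes "a < b" and p: "p \<in> L2 a b" and ode: "has_weak_deriv a b p (\<lambda>x. \<kappa> * p x)"
  obtains C where "AE x in lebesgue_on {a<..<b}. p x = C * exp (\<kappa> * complex_of_real x)"
proof -
  let ?M = "lebesgue_on {a<..<b}"
  define E where "E x = exp (- \<kappa> * complex_of_real x)" for x
  have cE: "continuous_on S E" for S unfolding E_def by (intro continuous_intros)
  have ip: "integrable ?M p" by (rule L2_integrable[OF p])
  obtain B where B: "\<And>x. x \<in> {a..b} \<Longrightarrow> cmod (E x) \<le> B"
    using compact_imp_bounded[OF compact_continuous_image[OF cE[of "{a..b}"]]]
    unfolding bounded_iff by force
  have iEp: "integrable ?M (\<lambda>x. E x * p x)"
  proof (rule Bochner_Integration.integrable_bound)
    show "integrable ?M (\<lambda>x. complex_of_real B * p x)" using ip by simp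
    have [measurable]: "E \<in> borel_measurable ?M"
      by (rule continuous_measurable_Ioo[OF cE])
    have [measurable]: "p \<in> borel_measurable ?M" using ip by auto
    show "(\<lambda>x. E x * p x) \<in> borel_measurable ?M" by measurable
    show "AE x in ?M. cmod (E x * p x) \<le> cmod (complex_of_real B * p x)"
    proof (rule AE_I2)
      fix x assume "x \<in> space ?M"
      then have "cmod (E x) \<le> \<bar>B\<bar>" using B[of x] by simp
      then show "cmod (E x * p x) \<le> cmod (complex_of_real B * p x)"
        by (simp add: norm_mult mult_right_mono)
    qed
  qed
  have "(\<integral>x. complex_of_real (deriv \<phi> x) * (E x * p x) \<partial>?M) = 0" if \<phi>: "\<phi> \<in> test_funs a b" for \<phi>
  proof -
    define \<alpha> \<beta> where "\<alpha> = - Re \<kappa>" and "\<beta> = - Im \<kappa>"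
    define \<phi>1 \<phi>2 where "\<phi>1 = (\<lambda>x. \<phi> x * (exp (\<alpha> * x) * cos (\<beta> * x)))"
      and "\<phi>2 = (\<lambda>x. \<phi> x * (exp (\<alpha> * x) * sin (\<beta> * x)))"
    have t: "\<phi>1 \<in> test_funs a b" "\<phi>2 \<in> test_funs a b"
      unfolding \<phi>1_def \<phi>2_def by (intro test_fun_mult \<phi> smooth_fun_exp_trig)+
    note td = t[THEN test_fun_deriv]
    have E: "E x = complex_of_real (exp (\<alpha> * x) * cos (\<beta> * x)) + \<i> * complex_of_real (exp (\<alpha> * x) * sin (\<beta> * x))" for x
      by (simp add: E_def complex_eq_iff Re_exp Im_exp \<alpha>_def \<beta>_def)
    have s: "complex_of_real (\<phi> x) * E x = complex_of_real (\<phi>1 x) + \<i> * complex_of_real (\<phi>2 x)" for x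
      by (simp add: E \<phi>1_def \<phi>2_def algebra_simps)
    have d: "complex_of_real (deriv \<phi> x) * E x = complex_of_real (deriv \<phi>1 x) + \<i> * complex_of_real (deriv \<phi>2 x)
        + \<kappa> * (complex_of_real (\<phi> x) * E x)" for x
    proof -
      have "((\<lambda>x. complex_of_real (\<phi>1 x) + \<i> * complex_of_real (\<phi>2 x)) has_vector_derivative
          complex_of_real (deriv \<phi>1 x) + \<i> * complex_of_real (deriv \<phi>2 x)) (at x)"
        by (intro has_vector_derivative_add has_vector_derivative_mult_right
            has_vector_derivative_of_real test_fun_has_derivative[OF t(1)] test_fun_has_derivative[OF t(2)])
      moreover have "(E has_vector_derivative - \<kappa> * E x) (at x)"
        unfolding E_def
        by (rule has_vector_derivative_real_field) (auto intro!: derivative_eq_intros)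
      then have "((\<lambda>x. complex_of_real (\<phi> x) * E x) has_vector_derivative
          complex_of_real (\<phi> x) * (- \<kappa> * E x) + complex_of_real (deriv \<phi> x) * E x) (at x)"
        by (intro has_vector_derivative_mult has_vector_derivative_of_real test_fun_has_derivative[OF \<phi>])
      ultimately have "complex_of_real (\<phi> x) * (- \<kappa> * E x) + complex_of_real (deriv \<phi> x) * E x
          = complex_of_real (deriv \<phi>1 x) + \<i> * complex_of_real (deriv \<phi>2 x)"
        unfolding s by (rule vector_derivative_unique_at[rotated])
      then show ?thesis by (simp add: algebra_simps)
    qed
    define I where "I \<psi> = (\<integral>x. complex_of_real (\<psi> x) * p x \<partial>?M)" for \<psi>
    have I: "I (deriv \<psi>) = - (\<kappa> * I \<psi>)" if "\<psi> \<in> test_funs a b" for \<psi>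
    proof -
      have "I (deriv \<psi>) = - (\<integral>x. complex_of_real (\<psi> x) * (\<kappa> * p x) \<partial>?M)"
        using ode that by (simp add: has_weak_deriv_def I_def)
      also have "\<dots> = - (\<integral>x. \<kappa> * (complex_of_real (\<psi> x) * p x) \<partial>?M)"
        by (simp add: algebra_simps)
      finally show ?thesis by (simp add: I_def)
    qed
    have "(\<integral>x. complex_of_real (deriv \<phi> x) * (E x * p x) \<partial>?M)
        = (\<integral>x. (complex_of_real (deriv \<phi>1 x) * p x + \<i> * (complex_of_real (deriv \<phi>2 x) * p x))
            + (\<kappa> * (complex_of_real (\<phi>1 x) * p x) + \<kappa> * \<i> * (complex_of_real (\<phi>2 x) * p x)) \<partial>?M)"
    proof (rule Bochner_Integration.integral_cong[OF refl])
      fix x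
      have "complex_of_real (deriv \<phi> x) * (E x * p x) = (complex_of_real (deriv \<phi> x) * E x) * p x"
        by simp
      then show "complex_of_real (deriv \<phi> x) * (E x * p x) = (complex_of_real (deriv \<phi>1 x) * p x + \<i> * (complex_of_real (deriv \<phi>2 x) * p x))
            + (\<kappa> * (complex_of_real (\<phi>1 x) * p x) + \<kappa> * \<i> * (complex_of_real (\<phi>2 x) * p x))"
        unfolding d s by (simp add: algebra_simps)
    qed
    also have "\<dots> = (I (deriv \<phi>1) + \<i> * I (deriv \<phi>2)) + (\<kappa> * I \<phi>1 + \<kappa> * \<i> * I \<phi>2)"
      unfolding I_def using test_fun_integrable[OF t(1) ip] test_fun_integrable[OF t(2) ip]
        test_fun_integrable[OF td(1) ip] test_fun_integrable[OF td(2) ip]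
      by simp
    also have "\<dots> = 0"
      by (simp add: I t algebra_simps)
    finally show ?thesis .
  qed
  from du_Bois_Reymond[OF \<open>a < b\<close> iEp this] obtain C where C: "AE x in ?M. E x * p x = C"
    by blast
  have "AE x in ?M. p x = C * exp (\<kappa> * complex_of_real x)"
    using C
  proof eventually_elim
    case (elim x)
    have "exp (\<kappa> * complex_of_real x) * E x = 1"
      by (simp add: E_def flip: exp_add)
    then show ?case using elim by (metis mult.assoc mult.commute mult_1)
  qed
  then show ?thesis by (rule that)
qed


text \<open>
  The operator \<open>f'' - \<kappa>\<^sup>2 * f\<close> factors: \<open>f' + \<kappa> * f\<close> and \<open>f' - \<kappa> * f\<close> solve first-order equations, and \<open>f\<close> and
  its derivative are linear combinations of the two. Thus weak solutions are classical.
\<close>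

lemma weak_second_order_ode:
  assumes "a < b" "\<kappa> \<noteq> 0" and f: "f \<in> H2 a b"
    and ode: "AE x in lebesgue_on {a<..<b}. weak_deriv a b (weak_deriv a b f) x = \<kappa>\<^sup>2 * f x"
  obtains C D where "AE x in lebesgue_on {a<..<b}.
      f x = C * exp (\<kappa> * complex_of_real x) + D * exp (- \<kappa> * complex_of_real x)"
    "AE x in lebesgue_on {a<..<b}. weak_deriv a b f x
      = \<kappa> * (C * exp (\<kappa> * complex_of_real x) - D * exp (- \<kappa> * complex_of_real x))"
proof -
  let ?M = "lebesgue_on {a<..<b}"
  define f1 where "f1 = weak_deriv a b f"
  have fH1: "f \<in> H1 a b" and f1H1: "f1 \<in> H1 a b" using f by (auto simp: H2_def f1_def)
  note F = H1_weak_deriv[OF fH1, folded f1_def] and F1 = H1_weak_deriv[OF f1H1]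
  have first_order: "\<exists>C. AE x in ?M. k * f x + f1 x = C * exp (k * complex_of_real x)" if k: "k\<^sup>2 = \<kappa>\<^sup>2" for k
  proof -
    have p: "(\<lambda>x. k * f x + f1 x) \<in> L2 a b"
      by (intro L2_add L2_scale F)
    have "has_weak_deriv a b (\<lambda>x. k * f x + f1 x) (\<lambda>x. k * f1 x + weak_deriv a b f1 x)"
      by (intro has_weak_deriv_lincomb F F1)
    then have "has_weak_deriv a b (\<lambda>x. k * f x + f1 x) (\<lambda>x. k * (k * f x + f1 x))"
    proof (rule has_weak_deriv_cong_AE[rotated -1])
      show "AE x in ?M. k * f1 x + weak_deriv a b f1 x = k * (k * f x + f1 x)"
        using ode unfolding f1_def[symmetric] k[symmetric]
        by eventually_elim (simp add: algebra_simps power2_eq_square)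
    qed (auto intro!: p L2_add L2_scale F F1)
    from weak_exponential_ode[OF \<open>a < b\<close> p this] show ?thesis by blast
  qed
  obtain P where P: "AE x in ?M. \<kappa> * f x + f1 x = P * exp (\<kappa> * complex_of_real x)"
    using first_order[of \<kappa>] by blast
  obtain Q where Q: "AE x in ?M. (- \<kappa>) * f x + f1 x = Q * exp (- \<kappa> * complex_of_real x)"
    using first_order[of "- \<kappa>"] by auto
  show ?thesis
  proof (rule that[of "P / (2 * \<kappa>)" "- Q / (2 * \<kappa>)"])
    show "AE x in ?M. f x = P / (2 * \<kappa>) * exp (\<kappa> * complex_of_real x) + - Q / (2 * \<kappa>) * exp (- \<kappa> * complex_of_real x)"
      using P Q
    proof eventually_elim
      case (elim x)
      have "2 * \<kappa> * f x = (\<kappa> * f x + f1 x) - ((- \<kappa>) * f x + f1 x)" by simp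
      also have "\<dots> = P * exp (\<kappa> * complex_of_real x) - Q * exp (- \<kappa> * complex_of_real x)"
        unfolding elim ..
      finally show ?case using \<open>\<kappa> \<noteq> 0\<close> by (simp add: field_simps)
    qed
    show "AE x in ?M. weak_deriv a b f x
        = \<kappa> * (P / (2 * \<kappa>) * exp (\<kappa> * complex_of_real x) - - Q / (2 * \<kappa>) * exp (- \<kappa> * complex_of_real x))"
      using P Q unfolding f1_def[symmetric]
    proof eventually_elim
      case (elim x)
      have "2 * f1 x = (\<kappa> * f x + f1 x) + ((- \<kappa>) * f x + f1 x)" by simp
      also have "\<dots> = P * exp (\<kappa> * complex_of_real x) + Q * exp (- \<kappa> * complex_of_real x)"
        unfolding elim ..
      finally show ?case using \<open>\<kappa> \<noteq> 0\<close> by (simp add: field_simps)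
    qed
  qed
qed

section \<open>Semigroups on quasi-normed spaces and their simple eigenvectors\<close>

text \<open>
  Elements of the space are represented by vectors in \<open>X\<close>, identified when \<open>N (x - y) = 0\<close>. The additivity
  assumption is weaker than the triangle inequality by a constant, but it still makes this identification a
  congruence.
\<close>

locale quasi_normed = module scl
  for scl :: "complex \<Rightarrow> 'x::ab_group_add \<Rightarrow> 'x" +
  fixes X :: "'x set" and N :: "'x \<Rightarrow> real"
  assumes zero_mem: "0 \<in> X"
    and lincomb_mem: "x \<in> X \<Longrightarrow> y \<in> X \<Longrightarrow> scl c x + y \<in> X"
    and N_nonneg: "N x \<ge> 0"
    and N_scale: "x \<in> X \<Longrightarrow> N (scl c x) = cmod c * N x"
    and N_add: "x \<in> X \<Longrightarrow> y \<in> X \<Longrightarrow> (N (x + y))\<^sup>2 \<le> 2 * (N x)\<^sup>2 + 2 * (N y)\<^sup>2"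
begin

lemma scale_mem: "x \<in> X \<Longrightarrow> scl c x \<in> X"
  using lincomb_mem[OF _ zero_mem, of x c] by simp

lemma add_mem: "x \<in> X \<Longrightarrow> y \<in> X \<Longrightarrow> x + y \<in> X"
  using lincomb_mem[of x y 1] by simp

lemma diff_mem: "x \<in> X \<Longrightarrow> y \<in> X \<Longrightarrow> x - y \<in> X"
  using lincomb_mem[of y x "-1"] by simp

lemma N_zero: "N 0 = 0"
  using N_scale[OF zero_mem, of 0] by simp

lemma N_minus_commute: "x \<in> X \<Longrightarrow> y \<in> X \<Longrightarrow> N (x - y) = N (y - x)"
  using N_scale[OF diff_mem, of x y "-1"] by simp

definition eqv :: "'x \<Rightarrow> 'x \<Rightarrow> bool" where
  "eqv x y \<longleftrightarrow> x \<in> X \<and> y \<in> X \<and> N (x - y) = 0"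

lemma eqv_mem: "eqv x y \<Longrightarrow> x \<in> X" "eqv x y \<Longrightarrow> y \<in> X"
  by (auto simp: eqv_def)

lemma eqv_refl: "x \<in> X \<Longrightarrow> eqv x x"
  by (simp add: eqv_def N_zero)

lemma eqv_sym: "eqv x y \<Longrightarrow> eqv y x"
  by (auto simp: eqv_def N_minus_commute)

lemma N_zero_add:
  assumes "x \<in> X" "y \<in> X" "N x = 0" "N y = 0"
  shows "N (x + y) = 0"
  using N_add[OF assms(1,2)] assms(3,4) by simp

lemma eqv_trans [trans]:
  assumes "eqv x y" "eqv y z"
  shows "eqv x z"
proof -
  have "N ((x - y) + (y - z)) = 0"
    using assms by (intro N_zero_add diff_mem) (auto simp: eqv_def)
  with assms show ?thesis by (simp add: eqv_def)
qed

lemma eqv_add: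
  assumes "eqv x y" "eqv x' y'"
  shows "eqv (x + x') (y + y')"
proof -
  have "N ((x - y) + (x' - y')) = 0"
    using assms by (intro N_zero_add diff_mem) (auto simp: eqv_def)
  with assms show ?thesis by (simp add: eqv_def add_mem algebra_simps)
qed

lemma eqv_scale:
  assumes "eqv x y"
  shows "eqv (scl c x) (scl c y)"
proof -
  have "N (scl c (x - y)) = 0"
    using assms by (subst N_scale) (auto simp: eqv_def diff_mem)
  with assms show ?thesis by (simp add: eqv_def scale_mem scale_right_diff_distrib)
qed

lemma eqv_diff:
  assumes "eqv x y" "eqv x' y'"
  shows "eqv (x - x') (y - y')"
  using eqv_add[OF assms(1) eqv_scale[OF assms(2), of "-1"]] by simp

lemma N_eqv_le:
  assumes "eqv x y"
  shows "N x \<le> 2 * N y"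
proof -
  have "(N ((x - y) + y))\<^sup>2 \<le> 2 * (N (x - y))\<^sup>2 + 2 * (N y)\<^sup>2"
    using assms by (intro N_add diff_mem) (auto simp: eqv_def)
  also have "\<dots> = 2 * (N y)\<^sup>2" using assms by (simp add: eqv_def)
  also have "\<dots> \<le> (2 * N y)\<^sup>2" by (simp add: power_mult_distrib)
  finally have "(N x)\<^sup>2 \<le> (2 * N y)\<^sup>2" by simp
  then show ?thesis
    by (rule power2_le_imp_le) (simp add: N_nonneg)
qed

lemma eqv_scale_imp_eq:
  assumes "eqv (scl a x) (scl b x)" "x \<in> X" "N x \<noteq> 0"
  shows "a = b"
proof -
  have "N (scl (a - b) x) = 0"
    using assms(1) by (simp add: eqv_def scale_left_diff_distrib)
  then show ?thesis using N_scale[OF assms(2), of "a - b"] assms(3) by simp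
qed

end

text \<open>
  Used with \<open>w\<close> within \<open>o (1/n)\<close> of 1, so that \<open>w ^ n\<close> tends to 1.
\<close>

lemma norm_power_minus_one_le: "cmod (w ^ n - 1) \<le> (1 + cmod (w - 1)) ^ n - 1"
proof (induction n)
  case (Suc n)
  have "cmod w \<le> 1 + cmod (w - 1)"
    using norm_triangle_ineq[of 1 "w - 1"] by simp
  then have "cmod (w * (w ^ n - 1)) \<le> (1 + cmod (w - 1)) * ((1 + cmod (w - 1)) ^ n - 1)"
    unfolding norm_mult by (intro mult_mono Suc.IH) auto
  moreover have "w ^ Suc n - 1 = w * (w ^ n - 1) + (w - 1)"
    by (simp add: algebra_simps)
  then have "cmod (w ^ Suc n - 1) \<le> cmod (w * (w ^ n - 1)) + cmod (w - 1)"
    by (metis norm_triangle_ineq)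
  ultimately show ?case by (simp add: algebra_simps)
qed simp

text \<open>
  Regularity away from 0 comes from the functional equation. Dividing by the exponential gives a multiplicative \<open>d\<close> with right
  derivative 0 at 0, and \<open>d t = d (t / n) ^ n\<close>, where \<open>d (t / n) - 1\<close> is \<open>o (1/n)\<close>.
\<close>

lemma multiplicative_eq_exp:
  fixes c :: "real \<Rightarrow> complex"
  assumes mult: "\<And>s t. s \<ge> 0 \<Longrightarrow> t \<ge> 0 \<Longrightarrow> c (s + t) = c s * c t"
    and c0: "c 0 = 1"
    and deriv: "((\<lambda>h. (c h - 1) / complex_of_real h) \<longlongrightarrow> \<Lambda>) (at_right 0)"
    and "t \<ge> 0"
  shows "c t = exp (\<Lambda> * complex_of_real t)"
proof (cases "t = 0")
  case True
  then show ?thesis using c0 by simp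
next
  case False
  with \<open>t \<ge> 0\<close> have t: "t > 0" by simp
  define d where "d h = c h * exp (- \<Lambda> * complex_of_real h)" for h
  have dpow: "d (real n * h) = d h ^ n" if "h \<ge> 0" for n h
  proof (induction n)
    case (Suc n)
    have "d (real (Suc n) * h) = d (h + real n * h)" by (simp add: algebra_simps)
    also have "\<dots> = d h * d (real n * h)"
    proof -
      have "exp (- \<Lambda> * complex_of_real (h + real n * h))
          = exp (- \<Lambda> * complex_of_real h) * exp (- \<Lambda> * complex_of_real (real n * h))"
        by (simp add: algebra_simps flip: exp_add)
      moreover have "c (h + real n * h) = c h * c (real n * h)"
        using that by (intro mult) auto
      ultimately show ?thesis by (simp add: d_def)
    qed
    finally show ?case using Suc by simp
  qed (simp add: d_def c0)
  have "((\<lambda>z. exp (- \<Lambda> * z)) has_field_derivative - \<Lambda>) (at 0)"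
    by (auto intro!: derivative_eq_intros)
  then have "((\<lambda>z. (exp (- \<Lambda> * z) - 1) / z) \<longlongrightarrow> - \<Lambda>) (at 0)"
    by (simp add: DERIV_def)
  moreover have "filterlim complex_of_real (at 0) (at_right 0)"
  proof -
    have "(complex_of_real \<longlongrightarrow> complex_of_real 0) (at_right 0)"
      by (intro tendsto_intros)
    then show ?thesis
      using eventually_at_right_less[of "0::real"]
      by (simp add: filterlim_at eventually_mono)
  qed
  ultimately have e: "((\<lambda>h. (exp (- \<Lambda> * complex_of_real h) - 1) / complex_of_real h) \<longlongrightarrow> - \<Lambda>) (at_right 0)"
    by (rule filterlim_compose)
  have "((\<lambda>h. (c h - 1) / complex_of_real h * exp (- \<Lambda> * complex_of_real h)
      + (exp (- \<Lambda> * complex_of_real h) - 1) / complex_of_real h) \<longlongrightarrow> \<Lambda> * exp (- \<Lambda> * complex_of_real 0) + - \<Lambda>) (at_right 0)"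
    by (intro tendsto_intros deriv e)
  moreover have "(c h - 1) / complex_of_real h * exp (- \<Lambda> * complex_of_real h)
      + (exp (- \<Lambda> * complex_of_real h) - 1) / complex_of_real h = (d h - 1) / complex_of_real h" for h
    by (simp add: d_def diff_divide_distrib algebra_simps)
  ultimately have dd: "((\<lambda>h. (d h - 1) / complex_of_real h) \<longlongrightarrow> 0) (at_right 0)"
    by simp
  have lim: "filterlim (\<lambda>n. t / real (Suc n)) (at_right 0) sequentially"
  proof -
    have "(\<lambda>n. t * inverse (real (Suc n))) \<longlonglongrightarrow> t * 0"
      by (intro tendsto_intros LIMSEQ_inverse_real_of_nat)
    then show ?thesis using t
      by (auto simp: filterlim_at divide_inverse simp del: of_nat_Suc)
  qed
  have "(\<lambda>n. t * cmod ((d (t / real (Suc n)) - 1) / complex_of_real (t / real (Suc n)))) \<longlonglongrightarrow> t * cmod 0"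
    by (intro tendsto_intros filterlim_compose[OF dd lim])
  moreover have "t * cmod ((d (t / real (Suc n)) - 1) / complex_of_real (t / real (Suc n)))
      = real (Suc n) * cmod (d (t / real (Suc n)) - 1)" for n
    using t by (simp add: norm_divide norm_mult mult.commute del: of_nat_Suc)
  ultimately have "(\<lambda>n. real (Suc n) * cmod (d (t / real (Suc n)) - 1)) \<longlonglongrightarrow> 0"
    by simp
  then have "(\<lambda>n. exp (real (Suc n) * cmod (d (t / real (Suc n)) - 1)) - 1) \<longlonglongrightarrow> exp 0 - 1"
    by (intro tendsto_intros)
  moreover have "cmod (d t - 1) \<le> exp (real (Suc n) * cmod (d (t / real (Suc n)) - 1)) - 1" for n
  proof -
    have "d t = d (t / real (Suc n)) ^ Suc n"
      using dpow[of "t / real (Suc n)" "Suc n"] t by simp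
    then have "cmod (d t - 1) \<le> (1 + cmod (d (t / real (Suc n)) - 1)) ^ Suc n - 1"
      using norm_power_minus_one_le by metis
    also have "(1 + cmod (d (t / real (Suc n)) - 1)) ^ Suc n \<le> exp (cmod (d (t / real (Suc n)) - 1)) ^ Suc n"
      by (intro power_mono exp_ge_add_one_self) auto
    also have "\<dots> = exp (real (Suc n) * cmod (d (t / real (Suc n)) - 1))"
      by (rule exp_of_nat_mult[symmetric])
    finally show ?thesis by simp
  qed
  ultimately have "cmod (d t - 1) \<le> exp 0 - 1"
    by (intro LIMSEQ_le_const) auto
  then have "d t = 1" by simp
  then show ?thesis
    by (simp add: d_def exp_minus field_simps)
qed

locale quasi_normed_semigroup = quasi_normed +
  fixes T :: "real \<Rightarrow> 'a \<Rightarrow> 'a"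
  assumes semigroup: "C0_semigroup X scl N T"
begin

lemma T_mem: "t \<ge> 0 \<Longrightarrow> x \<in> X \<Longrightarrow> T t x \<in> X"
  using semigroup by (simp add: C0_semigroup_def)

lemma T_lincomb:
  "t \<ge> 0 \<Longrightarrow> x \<in> X \<Longrightarrow> y \<in> X \<Longrightarrow> eqv (T t (scl c x + y)) (scl c (T t x) + T t y)"
  using semigroup by (simp add: C0_semigroup_def eqv_def T_mem lincomb_mem)

lemma T_bounded:
  assumes "t \<ge> 0"
  obtains M where "M \<ge> 0" "\<And>x. x \<in> X \<Longrightarrow> N (T t x) \<le> M * N x"
proof -
  have "\<forall>t\<ge>0. \<exists>M. \<forall>x\<in>X. N (T t x) \<le> M * N x"
    using semigroup unfolding C0_semigroup_def by (elim conjE)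
  with assms obtain M where M: "\<And>x. x \<in> X \<Longrightarrow> N (T t x) \<le> M * N x"
    by blast
  have "N (T t x) \<le> max M 0 * N x" if "x \<in> X" for x
  proof -
    have "M * N x \<le> max M 0 * N x"
      by (rule mult_right_mono) (auto simp: N_nonneg)
    with M[OF that] show ?thesis by linarith
  qed
  then show ?thesis using that[of "max M 0"] by simp
qed

lemma T_zero_eqv: "x \<in> X \<Longrightarrow> eqv (T 0 x) x"
  using semigroup by (simp add: C0_semigroup_def eqv_def)

lemma T_plus_eqv: "s \<ge> 0 \<Longrightarrow> t \<ge> 0 \<Longrightarrow> x \<in> X \<Longrightarrow> eqv (T (s + t) x) (T s (T t x))"
  using semigroup by (simp add: C0_semigroup_def eqv_def)

lemma T_diff: "t \<ge> 0 \<Longrightarrow> x \<in> X \<Longrightarrow> y \<in> X \<Longrightarrow> eqv (T t (x - y)) (T t x - T t y)"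
  using T_lincomb[of t y x "-1"] by simp

lemma T_null:
  assumes "t \<ge> 0" "x \<in> X" "N x = 0"
  shows "N (T t x) = 0"
proof -
  obtain M where "\<And>x. x \<in> X \<Longrightarrow> N (T t x) \<le> M * N x"
    using T_bounded[OF assms(1)] by blast
  from this[OF assms(2)] assms(3) N_nonneg[of "T t x"] show ?thesis by simp
qed

lemma T_eqv:
  assumes "t \<ge> 0" "eqv x y"
  shows "eqv (T t x) (T t y)"
proof -
  note m = eqv_mem[OF assms(2)]
  have "N (T t (x - y)) = 0"
    using assms by (intro T_null diff_mem) (auto simp: eqv_def)
  then have "eqv (T t (x - y)) 0"
    using m assms(1) by (simp add: eqv_def T_mem diff_mem zero_mem)
  with T_diff[OF assms(1) m] have "eqv (T t x - T t y) 0"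
    using eqv_sym eqv_trans by blast
  then show ?thesis using m assms(1) by (simp add: eqv_def T_mem)
qed

lemma T_scale:
  assumes "t \<ge> 0" "x \<in> X"
  shows "eqv (T t (scl c x)) (scl c (T t x))"
proof -
  have "eqv (T t 0) 0"
    using assms T_null[OF assms(1) zero_mem N_zero] by (simp add: eqv_def T_mem zero_mem)
  with T_lincomb[OF assms zero_mem, of c] show ?thesis
    using eqv_add[OF eqv_refl, of "scl c (T t x)" "T t 0" 0] assms
    by (metis T_mem add.right_neutral eqv_trans scale_mem)
qed

text \<open>
  Each \<open>T s\<close> is bounded, so the difference quotients of the orbit of \<open>T s x\<close> are images of those of the orbit of
  \<open>x\<close>; hence \<open>T s x\<close> is an eigenvector for the same eigenvalue, and by simplicity a multiple \<open>c s\<close> of \<open>x\<close>. The semigroup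
  law makes \<open>c\<close> multiplicative.
\<close>

lemma T_simple_eigenvector:
  assumes gen: "is_generator X scl N D A T"
    and x: "x \<in> X" "x \<in> D" "N (A x - scl \<Lambda> x) = 0" "N x \<noteq> 0"
    and simple: "\<And>y. y \<in> X \<Longrightarrow> y \<in> D \<Longrightarrow> N (A y - scl \<Lambda> y) = 0 \<Longrightarrow> \<exists>c. eqv y (scl c x)"
    and t: "t \<ge> 0"
  shows "eqv (T t x) (scl (exp (\<Lambda> * complex_of_real t)) x)"
proof -
  define q where "q h y = scl (complex_of_real (1 / h)) (T h y - y) - scl \<Lambda> y" for h y
  have genq: "((\<lambda>h. N (q h y)) \<longlongrightarrow> 0) (at_right 0) \<longleftrightarrow> y \<in> D \<and> N (A y - scl \<Lambda> y) = 0" if "y \<in> X" for y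
    using gen that scale_mem[OF that, of \<Lambda>] unfolding is_generator_def q_def by blast
  have qx: "((\<lambda>h. N (q h x)) \<longlongrightarrow> 0) (at_right 0)"
    using genq[OF x(1)] x by blast
  have pos: "\<forall>\<^sub>F h in at_right 0. h > (0::real)"
    by (rule eventually_at_right_less)
  have qmem: "q h y \<in> X" if "h > 0" "y \<in> X" for h y
    using that unfolding q_def by (intro diff_mem scale_mem T_mem) auto
  have "\<exists>c. eqv (T s x) (scl c x)" if s: "s \<ge> 0" for s
  proof (rule simple)
    show Ts: "T s x \<in> X" using s x by (simp add: T_mem)
    obtain M where M: "M \<ge> 0" "\<And>x. x \<in> X \<Longrightarrow> N (T s x) \<le> M * N x"
      using T_bounded[OF s] by blast
    have le: "N (q h (T s x)) \<le> 2 * (M * N (q h x))" if "h > 0" for h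
    proof -
      have h: "h \<ge> 0" using that by simp
      note Th = T_mem[OF h x(1)]
      have "eqv (T h (T s x)) (T s (T h x))"
        using eqv_sym[OF T_plus_eqv[OF h s x(1)]] T_plus_eqv[OF s h x(1)] eqv_trans
        by (metis add.commute)
      then have "eqv (T h (T s x) - T s x) (T s (T h x - x))"
        using eqv_diff eqv_refl[OF Ts] T_diff[OF s Th x(1)] eqv_sym eqv_trans by blast
      then have "eqv (scl (complex_of_real (1 / h)) (T h (T s x) - T s x))
          (T s (scl (complex_of_real (1 / h)) (T h x - x)))"
        using eqv_scale T_scale[OF s diff_mem[OF Th x(1)]] eqv_sym eqv_trans by blast
      moreover have "eqv (scl \<Lambda> (T s x)) (T s (scl \<Lambda> x))"
        using T_scale[OF s x(1)] eqv_sym by blast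
      ultimately have "eqv (q h (T s x)) (T s (q h x))"
        unfolding q_def
        using eqv_diff T_diff[OF s scale_mem[OF diff_mem[OF Th x(1)]] scale_mem[OF x(1)]]
          eqv_sym eqv_trans by blast
      then have "N (q h (T s x)) \<le> 2 * N (T s (q h x))" by (rule N_eqv_le)
      also have "\<dots> \<le> 2 * (M * N (q h x))"
        using M(2)[OF qmem[OF that x(1)]] by simp
      finally show ?thesis .
    qed
    have "((\<lambda>h. N (q h (T s x))) \<longlongrightarrow> 0) (at_right 0)"
    proof (rule tendsto_sandwich[where f = "\<lambda>_. 0"])
      show "((\<lambda>h. 2 * (M * N (q h x))) \<longlongrightarrow> 0) (at_right 0)"
        using tendsto_mult_right_zero[OF tendsto_mult_right_zero[OF qx]] by simp
      show "\<forall>\<^sub>F h in at_right 0. N (q h (T s x)) \<le> 2 * (M * N (q h x))"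
        using pos by eventually_elim (rule le)
    qed (auto simp: N_nonneg)
    then show "T s x \<in> D" "N (A (T s x) - scl \<Lambda> (T s x)) = 0"
      using genq[OF Ts] by auto
  qed
  then obtain c where c: "\<And>s. s \<ge> 0 \<Longrightarrow> eqv (T s x) (scl (c s) x)"
    by metis
  have uniq: "a = b" if "eqv (scl a x) (scl b x)" for a b
    using eqv_scale_imp_eq[OF that x(1,4)] .
  have c0: "c 0 = 1"
  proof (rule uniq)
    have "eqv (scl (c 0) x) x"
      by (rule eqv_trans[OF eqv_sym[OF c] T_zero_eqv[OF x(1)]]) simp
    then show "eqv (scl (c 0) x) (scl 1 x)" by simp
  qed
  have cmult: "c (s + r) = c s * c r" if "s \<ge> 0" "r \<ge> 0" for s r
  proof (rule uniq)
    have "eqv (scl (c (s + r)) x) (T (s + r) x)"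
      by (rule eqv_sym[OF c]) (use that in simp)
    also have "eqv (T (s + r) x) (T s (T r x))"
      by (rule T_plus_eqv[OF that x(1)])
    also have "eqv (T s (T r x)) (T s (scl (c r) x))"
      by (rule T_eqv[OF that(1) c[OF that(2)]])
    also have "eqv (T s (scl (c r) x)) (scl (c r) (T s x))"
      by (rule T_scale[OF that(1) x(1)])
    also have "eqv (scl (c r) (T s x)) (scl (c r) (scl (c s) x))"
      by (rule eqv_scale[OF c[OF that(1)]])
    also have "scl (c r) (scl (c s) x) = scl (c s * c r) x"
      unfolding scale_scale by (simp only: mult.commute)
    finally show "eqv (scl (c (s + r)) x) (scl (c s * c r) x)" .
  qed
  have cderiv: "((\<lambda>h. (c h - 1) / complex_of_real h) \<longlongrightarrow> \<Lambda>) (at_right 0)"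
  proof -
    have "\<forall>\<^sub>F h in at_right 0. cmod ((c h - 1) / complex_of_real h - \<Lambda>) \<le> 2 * N (q h x) / N x"
      using pos
    proof eventually_elim
      case (elim h)
      have "eqv (q h x) (scl (complex_of_real (1 / h)) (scl (c h) x - x) - scl \<Lambda> x)"
        unfolding q_def using elim x
        by (intro eqv_diff eqv_scale eqv_refl c scale_mem) auto
      moreover have "scl (complex_of_real (1 / h)) (scl (c h) x - x) - scl \<Lambda> x
          = scl ((c h - 1) / complex_of_real h - \<Lambda>) x"
        by (simp add: scale_right_diff_distrib scale_left_diff_distrib diff_divide_distrib)
      ultimately have "eqv (scl ((c h - 1) / complex_of_real h - \<Lambda>) x) (q h x)"
        using eqv_sym by metis
      then have "cmod ((c h - 1) / complex_of_real h - \<Lambda>) * N x \<le> 2 * N (q h x)"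
        using N_eqv_le N_scale[OF x(1)] by metis
      then show ?case using x(4) N_nonneg[of x] by (simp add: pos_le_divide_eq)
    qed
    moreover have "((\<lambda>h. 2 * N (q h x) / N x) \<longlongrightarrow> 2 * 0 / N x) (at_right 0)"
      by (intro tendsto_intros qx x)
    ultimately have bnds: "\<forall>\<^sub>F h in at_right 0. cmod ((c h - 1) / complex_of_real h - \<Lambda>) \<le> 2 * N (q h x) / N x"
      "((\<lambda>h. 2 * N (q h x) / N x) \<longlongrightarrow> 0) (at_right 0)"
      by simp_all
    have "((\<lambda>h. cmod ((c h - 1) / complex_of_real h - \<Lambda>)) \<longlongrightarrow> 0) (at_right 0)"
      by (rule tendsto_sandwich[where h = "\<lambda>h. 2 * N (q h x) / N x" and f = "\<lambda>_. 0", OF _ bnds(1) tendsto_const bnds(2)]) simp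
    then show ?thesis
      by (rule LIM_zero_cancel[OF tendsto_norm_zero_cancel])
  qed
  have "c t = exp (\<Lambda> * complex_of_real t)"
    by (rule multiplicative_eq_exp[of c, OF cmult c0 cderiv t])
  with c[OF t] show ?thesis by simp
qed

end

section \<open>A gliding hump\<close>

context quasi_normed_semigroup
begin

lemma sum_mem: "(\<And>j. j \<in> J \<Longrightarrow> f j \<in> X) \<Longrightarrow> (\<Sum>j\<in>J. f j) \<in> X"
  by (induction J rule: infinite_finite_induct) (auto simp: zero_mem add_mem)

text \<open>
  Eigenvectors of energy at least \<open>\<kappa>\<close> whose frequencies \<open>s n\<close> tend to infinity, with decay rates of order
  \<open>1 / sqrt (s n)\<close>, exclude every rate \<open>r t = o (1 / t ^ 4)\<close> that holds on all of the domain. The assumption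
  \<open>series\<close> says that the weighted series of any selection of eigenvectors converges in the domain, with a
  remainder after the \<open>k\<close>-th term that is as small as the later values of \<open>1 / s\<close>.
\<close>

lemma gliding_hump:
  fixes En :: "'a \<Rightarrow> real" and e :: "nat \<Rightarrow> 'a" and \<Lambda> :: "nat \<Rightarrow> complex" and s :: "nat \<Rightarrow> real"
  assumes En_add: "\<And>x y. x \<in> X \<Longrightarrow> y \<in> X \<Longrightarrow> En (x + y) \<le> 2 * En x + 2 * En y"
    and En_scale: "\<And>x c. x \<in> X \<Longrightarrow> En (scl c x) = (cmod c)\<^sup>2 * En x"
    and En_nonneg: "\<And>x. En x \<ge> 0"
    and En_le: "\<And>x. x \<in> X \<Longrightarrow> En x \<le> (N x)\<^sup>2"
    and D: "D \<subseteq> X" and e_dom: "\<And>n. e n \<in> D"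
    and flow: "\<And>n t. t \<ge> 0 \<Longrightarrow> eqv (T t (e n)) (scl (exp (\<Lambda> n * complex_of_real t)) (e n))"
    and s_pos: "\<And>n. s n > 0" and s_lim: "filterlim s at_top sequentially"
    and decay: "\<And>n. \<bar>Re (\<Lambda> n)\<bar> * sqrt (s n) \<le> C"
    and \<kappa>: "\<kappa> > 0" "\<And>n. En (e n) \<ge> \<kappa>"
    and r_pos: "\<And>t. t > 0 \<Longrightarrow> r t > 0" and r_lim: "((\<lambda>t. r t * t ^ 4) \<longlongrightarrow> 0) at_top"
    and B: "B > 0"
    and series: "\<And>\<nu>. \<exists>x\<in>D. \<forall>k A. (\<forall>j>k. 1 / s (\<nu> j) \<le> A) \<longrightarrow>
        N (x - (\<Sum>j\<le>k. scl (complex_of_real ((1/2) ^ j / s (\<nu> j))) (e (\<nu> j)))) \<le> B * A"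
  shows "\<exists>x\<in>D. \<not> ((\<lambda>t. En (T t x) / r t) \<longlongrightarrow> 0) at_top"
proof (rule ccontr)
  assume "\<not> ?thesis"
  then have conv: "((\<lambda>t. En (T t x) / r t) \<longlongrightarrow> 0) at_top" if "x \<in> D" for x
    using that by blast
  have eX: "e n \<in> X" for n using e_dom D by blast
  have pos: "\<forall>\<^sub>F t in at_top. (t::real) > 0"
    by (rule eventually_gt_at_top)

  have En_null: "En x = 0" if "x \<in> X" "N x = 0" for x
    using En_le[OF that(1)] that(2) En_nonneg[of x] by simp
  have En_eqv: "En x \<le> 2 * En y" if "eqv x y" for x y
  proof -
    have "En (y + (x - y)) \<le> 2 * En y + 2 * En (x - y)"
      using that by (intro En_add diff_mem) (auto simp: eqv_def)
    moreover have "En (x - y) = 0"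
      using that by (intro En_null diff_mem) (auto simp: eqv_def)
    ultimately show ?thesis by simp
  qed

  have conv_lincomb: "((\<lambda>t. En (T t (scl c x + y)) / r t) \<longlongrightarrow> 0) at_top"
    if "x \<in> X" "y \<in> X" "((\<lambda>t. En (T t x) / r t) \<longlongrightarrow> 0) at_top" "((\<lambda>t. En (T t y) / r t) \<longlongrightarrow> 0) at_top"
    for x y c
  proof -
    have lim: "((\<lambda>t. 4 * (cmod c)\<^sup>2 * (En (T t x) / r t) + 4 * (En (T t y) / r t)) \<longlongrightarrow> 0) at_top"
      using tendsto_add[OF tendsto_mult_right_zero[OF that(3)] tendsto_mult_right_zero[OF that(4)]]
      by simp
    have bound: "\<forall>\<^sub>F t in at_top. En (T t (scl c x + y)) / r t
        \<le> 4 * (cmod c)\<^sup>2 * (En (T t x) / r t) + 4 * (En (T t y) / r t)"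
      using pos
    proof eventually_elim
      case (elim t)
      then have t: "t \<ge> 0" by simp
      have "En (T t (scl c x + y)) \<le> 2 * En (scl c (T t x) + T t y)"
        by (rule En_eqv[OF T_lincomb[OF t that(1,2)]])
      also have "\<dots> \<le> 2 * (2 * En (scl c (T t x)) + 2 * En (T t y))"
        using En_add[OF scale_mem[OF T_mem[OF t that(1)], of c] T_mem[OF t that(2)]] by simp
      also have "\<dots> = 4 * (cmod c)\<^sup>2 * En (T t x) + 4 * En (T t y)"
        by (simp add: En_scale[OF T_mem[OF t that(1)]])
      finally have "En (T t (scl c x + y)) / r t \<le> (4 * (cmod c)\<^sup>2 * En (T t x) + 4 * En (T t y)) / r t"
        using r_pos[OF elim] by (intro divide_right_mono) auto
      then show ?case by (simp add: add_divide_distrib)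
    qed
    have nonneg: "\<forall>\<^sub>F t in at_top. 0 \<le> En (T t (scl c x + y)) / r t"
      using pos by eventually_elim (simp add: En_nonneg r_pos less_imp_le)
    show ?thesis
      by (rule tendsto_sandwich[OF nonneg bound tendsto_const lim])
  qed
  have conv_0: "((\<lambda>t. En (T t 0) / r t) \<longlongrightarrow> 0) at_top"
  proof -
    have "\<forall>\<^sub>F t in at_top. 0 = En (T t 0) / r t"
      using pos
    proof eventually_elim
      case (elim t)
      then have "En (T t 0) = 0"
        by (intro En_null T_mem T_null zero_mem N_zero) auto
      then show ?case by simp
    qed
    then show ?thesis by (rule Lim_transform_eventually[OF tendsto_const])
  qed
  have conv_sum: "((\<lambda>t. En (T t (\<Sum>j<k. scl (c j) (e (\<nu> j)))) / r t) \<longlongrightarrow> 0) at_top" for k :: nat and c \<nu>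
  proof (induction k)
    case 0
    show ?case using conv_0 by simp
  next
    case (Suc k)
    have "((\<lambda>t. En (T t (scl (c k) (e (\<nu> k)) + (\<Sum>j<k. scl (c j) (e (\<nu> j))))) / r t) \<longlongrightarrow> 0) at_top"
      by (intro conv_lincomb eX sum_mem scale_mem conv e_dom Suc.IH)
    then show ?case by (simp add: add.commute)
  qed

  obtain M where M: "\<And>t. t \<ge> 0 \<Longrightarrow> M t > 0" "\<And>t x. t \<ge> 0 \<Longrightarrow> x \<in> X \<Longrightarrow> N (T t x) \<le> M t * N x"
  proof -
    have "\<exists>M>0. \<forall>x\<in>X. N (T t x) \<le> M * N x" if "t \<ge> 0" for t
    proof -
      obtain M where M: "M \<ge> 0" "\<And>x. x \<in> X \<Longrightarrow> N (T t x) \<le> M * N x"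
        using T_bounded[OF \<open>t \<ge> 0\<close>] by blast
      have "N (T t x) \<le> (M + 1) * N x" if "x \<in> X" for x
        using M(2)[OF that] N_nonneg[of x] by (simp add: distrib_right)
      with M(1) show ?thesis by (intro exI[of _ "M + 1"]) auto
    qed
    then show ?thesis using that by metis
  qed

  \<comment> \<open>A lower bound for the energy of \<open>exp (\<Lambda> n * t) * e n\<close> at the time \<open>t = sqrt (s n)\<close>.\<close>
  define \<kappa>' where "\<kappa>' = exp (- 2 * C) * \<kappa>"
  have \<kappa>': "\<kappa>' > 0" using \<kappa> by (simp add: \<kappa>'_def)
  define \<epsilon> where "\<epsilon> = sqrt (\<kappa>' / 16)"
  have \<epsilon>: "\<epsilon> > 0" "\<epsilon>\<^sup>2 = \<kappa>' / 16" using \<kappa>' by (auto simp: \<epsilon>_def)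
  define \<tau> where "\<tau> m = sqrt (s m)" for m
  have \<tau>: "\<tau> m > 0" "\<tau> m ^ 4 = (s m)\<^sup>2" for m
  proof -
    show "\<tau> m > 0" using s_pos by (simp add: \<tau>_def)
    have "\<tau> m ^ 4 = ((\<tau> m)\<^sup>2)\<^sup>2" by simp
    also have "(\<tau> m)\<^sup>2 = s m" using s_pos[of m] by (simp add: \<tau>_def)
    finally show "\<tau> m ^ 4 = (s m)\<^sup>2" .
  qed
  have \<tau>_lim: "filterlim \<tau> at_top sequentially"
    unfolding \<tau>_def by (rule filterlim_compose[OF sqrt_at_top s_lim])
  define \<alpha> where "\<alpha> j m = (1/2) ^ j / s m" for j m
  have \<alpha>_pos: "\<alpha> j m > 0" for j m using s_pos by (simp add: \<alpha>_def)
  \<comment> \<open>The four requirements on the \<open>k\<close>-th index \<open>m\<close>: the time is late, the earlier terms are small at this time,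
    \<open>r\<close> is small at this time, and the new term is small at all earlier times.\<close>
  define P where "P \<nu> k m \<longleftrightarrow> real k \<le> \<tau> m
      \<and> En (T (\<tau> m) (\<Sum>j<k. scl (complex_of_real (\<alpha> j (\<nu> j))) (e (\<nu> j)))) / r (\<tau> m) < 1
      \<and> r (\<tau> m) * \<tau> m ^ 4 < \<kappa>' / 24 * (1/4) ^ k
      \<and> (\<forall>j<k. 1 / s m \<le> \<epsilon> * \<alpha> j (\<nu> j) / (M (\<tau> (\<nu> j)) * B))" for \<nu> k m
  have "\<exists>\<nu>. \<forall>k. P \<nu> k (\<nu> k)"
  proof (rule dependent_wellorder_choice)
    fix m and f g :: "nat \<Rightarrow> nat" and k
    assume fg: "\<And>j. j < k \<Longrightarrow> f j = g j"
    have "(\<Sum>j<k. scl (complex_of_real (\<alpha> j (f j))) (e (f j)))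
        = (\<Sum>j<k. scl (complex_of_real (\<alpha> j (g j))) (e (g j)))"
      by (rule sum.cong) (auto simp: fg)
    then show "P f k m = P g k m"
      unfolding P_def using fg by auto
  next
    fix k and \<nu> :: "nat \<Rightarrow> nat"
    have "\<forall>\<^sub>F m in sequentially. real k \<le> \<tau> m"
      using \<tau>_lim by (simp add: filterlim_at_top)
    moreover have "\<forall>\<^sub>F m in sequentially.
        En (T (\<tau> m) (\<Sum>j<k. scl (complex_of_real (\<alpha> j (\<nu> j))) (e (\<nu> j)))) / r (\<tau> m) < 1"
      by (rule order_tendstoD(2)[OF filterlim_compose[OF conv_sum \<tau>_lim]]) simp
    moreover have "\<forall>\<^sub>F m in sequentially. r (\<tau> m) * \<tau> m ^ 4 < \<kappa>' / 24 * (1/4) ^ k"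
      by (rule order_tendstoD(2)[OF filterlim_compose[OF r_lim \<tau>_lim]]) (simp add: \<kappa>')
    moreover have "\<forall>\<^sub>F m in sequentially. \<forall>j\<in>{..<k}. 1 / s m \<le> \<epsilon> * \<alpha> j (\<nu> j) / (M (\<tau> (\<nu> j)) * B)"
    proof (rule eventually_ball_finite)
      show "\<forall>j\<in>{..<k}. \<forall>\<^sub>F m in sequentially. 1 / s m \<le> \<epsilon> * \<alpha> j (\<nu> j) / (M (\<tau> (\<nu> j)) * B)"
      proof
        fix j
        have "((\<lambda>m. inverse (s m)) \<longlongrightarrow> 0) sequentially"
          by (rule tendsto_inverse_0_at_top[OF s_lim])
        moreover have "0 < \<epsilon> * \<alpha> j (\<nu> j) / (M (\<tau> (\<nu> j)) * B)"
          using \<epsilon>(1) \<alpha>_pos B M(1)[OF less_imp_le[OF \<tau>(1)]] by simp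
        ultimately have "\<forall>\<^sub>F m in sequentially. inverse (s m) < \<epsilon> * \<alpha> j (\<nu> j) / (M (\<tau> (\<nu> j)) * B)"
          by (rule order_tendstoD(2))
        then show "\<forall>\<^sub>F m in sequentially. 1 / s m \<le> \<epsilon> * \<alpha> j (\<nu> j) / (M (\<tau> (\<nu> j)) * B)"
          by eventually_elim (simp add: inverse_eq_divide)
      qed
    qed simp
    ultimately have "\<forall>\<^sub>F m in sequentially. P \<nu> k m"
      unfolding P_def by eventually_elim simp
    then show "\<exists>m. P \<nu> k m"
      by (auto simp: eventually_sequentially)
  qed
  then obtain \<nu> where \<nu>: "\<And>k. P \<nu> k (\<nu> k)" by blast
  define t where "t k = \<tau> (\<nu> k)" for k
  define a where "a k = \<alpha> k (\<nu> k)" for k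
  have t_pos: "t k > 0" and t_ge: "t k \<ge> real k" for k
    using \<tau>(1) \<nu>[of k] by (auto simp: t_def P_def)
  have a_pos: "a k > 0" for k using \<alpha>_pos by (simp add: a_def)
  obtain x where x: "x \<in> D" and tail: "\<And>k A. (\<forall>j>k. 1 / s (\<nu> j) \<le> A) \<Longrightarrow>
      N (x - (\<Sum>j\<le>k. scl (complex_of_real (a j)) (e (\<nu> j)))) \<le> B * A"
    using series[of \<nu>] unfolding a_def \<alpha>_def by blast
  have xX: "x \<in> X" using x D by blast
  \<comment> \<open>The \<open>k\<close>-th term is the orbit minus the contributions of \<open>S\<close> and \<open>R\<close>, so its energy \<open>\<kappa>' * (a k)\<^sup>2 \<ge> 24 * r\<close> is at most
    \<open>8\<close> times the energy of the orbit plus \<open>8 * r\<close> and \<open>(1/4) * \<kappa>' * (a k)\<^sup>2\<close>.\<close>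
  have big: "En (T (t k) x) / r (t k) \<ge> 1" for k
  proof -
    have tk: "t k \<ge> 0" using t_pos[of k] by simp
    define S where "S = (\<Sum>j<k. scl (complex_of_real (a j)) (e (\<nu> j)))"
    define h where "h = scl (complex_of_real (a k)) (e (\<nu> k))"
    define R where "R = x - (S + h)"
    have mem: "S \<in> X" "h \<in> X" "R \<in> X"
      unfolding S_def h_def R_def by (intro sum_mem scale_mem eX diff_mem add_mem xX)+
    have Tmem: "T (t k) S \<in> X" "T (t k) h \<in> X" "T (t k) R \<in> X" "T (t k) x \<in> X"
      using T_mem[OF tk] mem xX by auto
    have EnS: "En (T (t k) S) \<le> r (t k)"
      using \<nu>[of k] r_pos[OF t_pos[of k]] unfolding P_def S_def a_def t_def by simp
    have EnR: "En (T (t k) R) \<le> \<kappa>' / 16 * (a k)\<^sup>2"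
    proof -
      define A where "A = \<epsilon> * a k / (M (t k) * B)"
      have Mk: "M (t k) > 0" by (rule M(1)[OF tk])
      have "\<forall>j>k. 1 / s (\<nu> j) \<le> A"
        using \<nu> unfolding P_def A_def a_def t_def by blast
      then have "N (x - (\<Sum>j\<le>k. scl (complex_of_real (a j)) (e (\<nu> j)))) \<le> B * A"
        by (rule tail)
      moreover have "(\<Sum>j\<le>k. scl (complex_of_real (a j)) (e (\<nu> j))) = S + h"
        by (simp add: S_def h_def lessThan_Suc_atMost[symmetric])
      ultimately have "N R \<le> B * A" by (simp add: R_def)
      then have "N (T (t k) R) \<le> M (t k) * (B * A)"
        using M(2)[OF tk mem(3)] Mk mult_left_mono[of "N R" "B * A" "M (t k)"] by linarith
      also have "\<dots> = \<epsilon> * a k" using Mk B by (simp add: A_def)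
      finally have "(N (T (t k) R))\<^sup>2 \<le> (\<epsilon> * a k)\<^sup>2"
        by (intro power_mono N_nonneg)
      then show ?thesis
        using En_le[OF Tmem(3)] \<epsilon>(2) by (simp add: power_mult_distrib)
    qed
    have Enh: "\<kappa>' * (a k)\<^sup>2 \<le> En (scl (exp (\<Lambda> (\<nu> k) * complex_of_real (t k))) h)"
    proof -
      have "- C \<le> Re (\<Lambda> (\<nu> k)) * t k"
        using decay[of "\<nu> k"] abs_le_iff[of "Re (\<Lambda> (\<nu> k)) * t k" C] t_pos[of k]
        by (simp add: t_def \<tau>_def abs_mult)
      then have "- 2 * C \<le> 2 * (Re (\<Lambda> (\<nu> k)) * t k)" by linarith
      then have "exp (- 2 * C) \<le> exp (2 * (Re (\<Lambda> (\<nu> k)) * t k))" by (rule exp_mono)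
      also have "\<dots> = (cmod (exp (\<Lambda> (\<nu> k) * complex_of_real (t k))))\<^sup>2"
        by (simp add: norm_exp_eq_Re exp_double)
      finally have "exp (- 2 * C) * \<kappa> \<le> (cmod (exp (\<Lambda> (\<nu> k) * complex_of_real (t k))))\<^sup>2 * En (e (\<nu> k))"
        using \<kappa> by (intro mult_mono) (auto simp: less_imp_le)
      then have "\<kappa>' * (a k)\<^sup>2
          \<le> (cmod (exp (\<Lambda> (\<nu> k) * complex_of_real (t k))))\<^sup>2 * En (e (\<nu> k)) * (a k)\<^sup>2"
        unfolding \<kappa>'_def by (rule mult_right_mono) simp
      also have "\<dots> = En (scl (exp (\<Lambda> (\<nu> k) * complex_of_real (t k))) h)"
        unfolding h_def by (subst En_scale, intro scale_mem eX, subst En_scale, rule eX) simp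
      finally show ?thesis .
    qed
    have "eqv (scl (exp (\<Lambda> (\<nu> k) * complex_of_real (t k))) h) (T (t k) h)"
    proof -
      have "eqv (T (t k) h) (scl (complex_of_real (a k)) (T (t k) (e (\<nu> k))))"
        unfolding h_def by (rule T_scale[OF tk eX])
      also have "eqv (scl (complex_of_real (a k)) (T (t k) (e (\<nu> k))))
          (scl (complex_of_real (a k)) (scl (exp (\<Lambda> (\<nu> k) * complex_of_real (t k))) (e (\<nu> k))))"
        by (rule eqv_scale[OF flow[OF tk]])
      also have "scl (complex_of_real (a k)) (scl (exp (\<Lambda> (\<nu> k) * complex_of_real (t k))) (e (\<nu> k)))
          = scl (exp (\<Lambda> (\<nu> k) * complex_of_real (t k))) h"
        unfolding h_def scale_scale by (simp only: mult.commute)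
      finally show ?thesis by (rule eqv_sym)
    qed
    also have "eqv (T (t k) h) (T (t k) x - T (t k) S - T (t k) R)"
    proof -
      have "h = (x - S) - R" by (simp add: R_def)
      then have "eqv (T (t k) h) (T (t k) (x - S) - T (t k) R)"
        using T_diff[OF tk diff_mem[OF xX mem(1)] mem(3)] by simp
      also have "eqv (T (t k) (x - S) - T (t k) R) (T (t k) x - T (t k) S - T (t k) R)"
        by (intro eqv_diff T_diff[OF tk xX mem(1)] eqv_refl Tmem)
      finally show ?thesis .
    qed
    finally have "\<kappa>' * (a k)\<^sup>2 \<le> 2 * En (T (t k) x - T (t k) S - T (t k) R)"
      using Enh En_eqv by fastforce
    moreover have En_diff: "En (y - z) \<le> 2 * En y + 2 * En z" if "y \<in> X" "z \<in> X" for y z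
      using En_add[OF that(1) scale_mem[OF that(2), of "-1"]] En_scale[OF that(2), of "-1"] by simp
    have "En (T (t k) x - T (t k) S - T (t k) R) \<le> 2 * (2 * En (T (t k) x) + 2 * En (T (t k) S)) + 2 * En (T (t k) R)"
      by (rule order_trans[OF En_diff[OF diff_mem[OF Tmem(4,1)] Tmem(3)]
            add_right_mono[OF mult_left_mono[OF En_diff[OF Tmem(4,1)]]]]) simp
    moreover have "p \<le> 2 * q \<Longrightarrow> q \<le> 2 * (2 * x + 2 * y) + 2 * z \<Longrightarrow> p \<le> 8 * x + 8 * y + 4 * z"
      for p q x y z :: real
      by argo
    ultimately have low: "\<kappa>' * (a k)\<^sup>2 \<le> 8 * En (T (t k) x) + 8 * En (T (t k) S) + 4 * En (T (t k) R)"
      by blast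
    have "r (t k) * t k ^ 4 < \<kappa>' / 24 * (1/4) ^ k"
      using \<nu>[of k] by (simp add: P_def t_def)
    then have "r (t k) < \<kappa>' / 24 * (1/4) ^ k / t k ^ 4"
      using t_pos[of k] by (simp add: pos_less_divide_eq)
    also have "\<dots> = \<kappa>' / 24 * (a k)\<^sup>2"
      unfolding a_def \<alpha>_def t_def \<tau>(2) by (simp add: power_divide power2_eq_square power_mult_distrib[symmetric])
    finally have "24 * r (t k) \<le> \<kappa>' * (a k)\<^sup>2" by simp
    with low EnS EnR r_pos[OF t_pos[of k]] have "r (t k) \<le> En (T (t k) x)"
      by argo
    then show ?thesis using r_pos[OF t_pos[of k]] by simp
  qed
  have "filterlim t at_top sequentially"
    by (rule filterlim_at_top_mono[OF filterlim_real_sequentially]) (simp add: t_ge)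
  then have "(\<lambda>k. En (T (t k) x) / r (t k)) \<longlonglongrightarrow> 0"
    by (rule filterlim_compose[OF conv[OF x]])
  then have "1 \<le> (0::real)"
    by (rule LIMSEQ_le_const) (use big in auto)
  then show False by simp
qed

end

section \<open>The state space of the wave-heat system\<close>

definition L2_sq :: "real \<Rightarrow> real \<Rightarrow> (real \<Rightarrow> complex) \<Rightarrow> real" where
  "L2_sq a b f = (\<integral>\<xi>. (cmod (f \<xi>))\<^sup>2 \<partial>lebesgue_on {a<..<b})"

lemma L2_sq_nonneg: "0 \<le> L2_sq a b f"
  unfolding L2_sq_def by (rule Bochner_Integration.integral_nonneg) simp

lemma L2_nrm_sq: "(L2_nrm a b f)\<^sup>2 = L2_sq a b f"
  using L2_sq_nonneg[of a b f] by (simp add: L2_nrm_def L2_sq_def)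

lemma L2_sq_scale: "L2_sq a b (\<lambda>x. c * f x) = (cmod c)\<^sup>2 * L2_sq a b f"
  unfolding L2_sq_def by (simp add: norm_mult power_mult_distrib)

lemma L2_sq_add:
  assumes "f \<in> L2 a b" "g \<in> L2 a b"
  shows "L2_sq a b (\<lambda>x. f x + g x) \<le> 2 * L2_sq a b f + 2 * L2_sq a b g"
proof -
  have i: "integrable (lebesgue_on {a<..<b}) (\<lambda>x. (cmod (f x))\<^sup>2)"
    "integrable (lebesgue_on {a<..<b}) (\<lambda>x. (cmod (g x))\<^sup>2)"
    "integrable (lebesgue_on {a<..<b}) (\<lambda>x. (cmod (f x + g x))\<^sup>2)"
    using assms L2_add[OF assms] by (auto simp: L2_def)
  have "L2_sq a b (\<lambda>x. f x + g x)
      \<le> (\<integral>x. 2 * (cmod (f x))\<^sup>2 + 2 * (cmod (g x))\<^sup>2 \<partial>lebesgue_on {a<..<b})"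
    unfolding L2_sq_def using i by (intro integral_mono norm_sq_add_le) auto
  also have "\<dots> = 2 * L2_sq a b f + 2 * L2_sq a b g"
    unfolding L2_sq_def using i by simp
  finally show ?thesis .
qed

lemma L2_sq_cong_AE:
  assumes "f \<in> L2 a b" "g \<in> L2 a b" "AE x in lebesgue_on {a<..<b}. f x = g x"
  shows "L2_sq a b f = L2_sq a b g"
  unfolding L2_sq_def
proof (rule integral_cong_AE)
  show "AE x in lebesgue_on {a<..<b}. (cmod (f x))\<^sup>2 = (cmod (g x))\<^sup>2"
    using assms(3) by eventually_elim simp
qed (use assms in \<open>auto simp: L2_def\<close>)

lemma L2_sq_eq_0_iff:
  assumes "f \<in> L2 a b"
  shows "L2_sq a b f = 0 \<longleftrightarrow> (AE x in lebesgue_on {a<..<b}. f x = 0)"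
  using assms unfolding L2_sq_def L2_def
  by (subst integral_nonneg_eq_0_iff_AE) auto

lemma L2_sq_bound:
  assumes "f \<in> L2 a b" "a \<le> b" "\<And>x. x \<in> {a<..<b} \<Longrightarrow> cmod (f x) \<le> K"
  shows "L2_sq a b f \<le> K\<^sup>2 * (b - a)"
proof -
  have "L2_sq a b f \<le> (\<integral>x. K\<^sup>2 \<partial>lebesgue_on {a<..<b})"
    unfolding L2_sq_def
  proof (rule integral_mono)
    show "integrable (lebesgue_on {a<..<b}) (\<lambda>x. K\<^sup>2)"
      by (rule integrable_lebesgue_on_bounded[where B = "norm (K\<^sup>2)"]) auto
  qed (use assms in \<open>auto simp: L2_def intro!: power_mono\<close>)
  also have "\<dots> = K\<^sup>2 * b - K\<^sup>2 * a"
    by (rule integral_lebesgue_on_FTC[OF \<open>a \<le> b\<close>])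
      (auto intro!: derivative_eq_intros simp flip: has_real_derivative_iff_has_vector_derivative)
  finally show ?thesis by (simp add: algebra_simps)
qed

lemma H1_lincomb:
  assumes "f \<in> H1 a b" "g \<in> H1 a b"
  shows "(\<lambda>x. c * f x + g x) \<in> H1 a b"
    "AE x in lebesgue_on {a<..<b}. weak_deriv a b (\<lambda>x. c * f x + g x) x = c * weak_deriv a b f x + weak_deriv a b g x"
proof -
  note f = H1_weak_deriv[OF assms(1)] and g = H1_weak_deriv[OF assms(2)]
  have wd: "has_weak_deriv a b (\<lambda>x. c * f x + g x) (\<lambda>x. c * weak_deriv a b f x + weak_deriv a b g x)"
    by (rule has_weak_deriv_lincomb) (use f g in auto)
  have L: "(\<lambda>x. c * weak_deriv a b f x + weak_deriv a b g x) \<in> L2 a b"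
    by (intro L2_add L2_scale f g)
  then show "(\<lambda>x. c * f x + g x) \<in> H1 a b"
    unfolding H1_def using wd L2_add[OF L2_scale[OF f(3)] g(3)] by blast
  show "AE x in lebesgue_on {a<..<b}. weak_deriv a b (\<lambda>x. c * f x + g x) x = c * weak_deriv a b f x + weak_deriv a b g x"
    by (rule weak_deriv_props(3)[OF L wd])
qed

lemma H1_zero: "(\<lambda>_. 0) \<in> H1 a b"
proof -
  have "(\<lambda>_. 0) \<in> L2 a b" by (rule L2_continuous) simp
  moreover have "has_weak_deriv a b (\<lambda>_. 0) (\<lambda>_. 0)" by (simp add: has_weak_deriv_def)
  ultimately show ?thesis unfolding H1_def by blast
qed

lemma L2_sq_lincomb:
  assumes "f \<in> L2 a b" "g \<in> L2 a b"
  shows "L2_sq a b (\<lambda>x. c * f x + g x) \<le> 2 * (cmod c)\<^sup>2 * L2_sq a b f + 2 * L2_sq a b g"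
  using L2_sq_add[OF L2_scale[OF assms(1), of c] assms(2)] by (simp add: L2_sq_scale)

lemma L2_sq_weak_deriv_lincomb:
  assumes "f \<in> H1 a b" "g \<in> H1 a b"
  shows "L2_sq a b (weak_deriv a b (\<lambda>x. c * f x + g x))
    \<le> 2 * (cmod c)\<^sup>2 * L2_sq a b (weak_deriv a b f) + 2 * L2_sq a b (weak_deriv a b g)"
proof -
  note f = H1_weak_deriv[OF assms(1)] and g = H1_weak_deriv[OF assms(2)]
  have "L2_sq a b (weak_deriv a b (\<lambda>x. c * f x + g x))
      = L2_sq a b (\<lambda>x. c * weak_deriv a b f x + weak_deriv a b g x)"
    by (intro L2_sq_cong_AE H1_lincomb assms H1_weak_deriv(1) L2_add L2_scale f g)
  also have "\<dots> \<le> 2 * (cmod c)\<^sup>2 * L2_sq a b (weak_deriv a b f) + 2 * L2_sq a b (weak_deriv a b g)"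
    by (rule L2_sq_lincomb[OF f(1) g(1)])
  finally show ?thesis .
qed

lemma L2_sq_weak_deriv_scale:
  assumes "f \<in> H1 a b"
  shows "(\<lambda>x. c * f x) \<in> H1 a b"
    "L2_sq a b (weak_deriv a b (\<lambda>x. c * f x)) = (cmod c)\<^sup>2 * L2_sq a b (weak_deriv a b f)"
proof -
  note f = H1_weak_deriv[OF assms]
  have wd: "has_weak_deriv a b (\<lambda>x. c * f x) (\<lambda>x. c * weak_deriv a b f x)"
  proof -
    have "has_weak_deriv a b (\<lambda>x. c * f x + 0) (\<lambda>x. c * weak_deriv a b f x + 0)"
      by (rule has_weak_deriv_lincomb) (use f L2_continuous[of a b "\<lambda>_. 0"] in \<open>auto simp: has_weak_deriv_def\<close>)
    then show ?thesis by simp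
  qed
  show H: "(\<lambda>x. c * f x) \<in> H1 a b"
    using wd L2_scale[OF f(1)] L2_scale[OF f(3)] unfolding H1_def by blast
  have "L2_sq a b (weak_deriv a b (\<lambda>x. c * f x)) = L2_sq a b (\<lambda>x. c * weak_deriv a b f x)"
    by (intro L2_sq_cong_AE H1_weak_deriv(1)[OF H] L2_scale f weak_deriv_props(3) wd)
  then show "L2_sq a b (weak_deriv a b (\<lambda>x. c * f x)) = (cmod c)\<^sup>2 * L2_sq a b (weak_deriv a b f)"
    by (simp add: L2_sq_scale)
qed

lemma wh_norm_nonneg: "wh_norm x \<ge> 0"
  by (cases x) (simp add: wh_norm_def)

lemma wh_norm_sq:
  "(wh_norm (u, v, w))\<^sup>2 = L2_sq (-1) 0 u + L2_sq (-1) 0 (weak_deriv (-1) 0 u) + L2_sq (-1) 0 v + L2_sq 0 1 w"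
proof -
  have "(wh_norm (u, v, w))\<^sup>2 = (H1_nrm (-1) 0 u)\<^sup>2 + (L2_nrm (-1) 0 v)\<^sup>2 + (L2_nrm 0 1 w)\<^sup>2"
    unfolding wh_norm_def by simp
  also have "(H1_nrm (-1) 0 u)\<^sup>2 = (L2_nrm (-1) 0 u)\<^sup>2 + (L2_nrm (-1) 0 (weak_deriv (-1) 0 u))\<^sup>2"
    unfolding H1_nrm_def by simp
  finally show ?thesis by (simp add: L2_nrm_sq)
qed

lemma energy_eq:
  assumes "u \<in> H1 (-1) 0" "v \<in> L2 (-1) 0"
  shows "energy (u, v, w) = (L2_sq (-1) 0 (weak_deriv (-1) 0 u) + L2_sq (-1) 0 v + L2_sq 0 1 w) / 2"
proof -
  have "integrable (lebesgue_on {-1<..<0}) (\<lambda>\<xi>. (cmod (weak_deriv (-1) 0 u \<xi>))\<^sup>2)"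
    "integrable (lebesgue_on {-1<..<0}) (\<lambda>\<xi>. (cmod (v \<xi>))\<^sup>2)"
    using H1_weak_deriv(1)[OF assms(1)] assms(2) by (auto simp: L2_def)
  then show ?thesis
    by (simp add: energy_def L2_sq_def)
qed

lemma state_scale_simp: "state_scale c (u, v, w) = (\<lambda>x. c * u x, \<lambda>x. c * v x, \<lambda>x. c * w x)"
  by (simp add: state_scale_def)

lemma state_plus: "(u, v, w) + (u', v', w') = (\<lambda>x. u x + u' x, \<lambda>x. v x + v' x, \<lambda>x. w x + (w' x :: complex))"
  for u v u' v' :: "real \<Rightarrow> complex" and w w' :: "real \<Rightarrow> complex"
  by (simp add: plus_fun_def)

lemma wh_space_simp: "(u, v, w) \<in> wh_space \<longleftrightarrow> u \<in> H1 (-1) 0 \<and> v \<in> L2 (-1) 0 \<and> w \<in> L2 0 1"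
  by (simp add: wh_space_def)

lemma wh_norm_sq_scale:
  assumes "x \<in> wh_space"
  shows "(wh_norm (state_scale c x))\<^sup>2 = (cmod c)\<^sup>2 * (wh_norm x)\<^sup>2"
    "energy (state_scale c x) = (cmod c)\<^sup>2 * energy x"
proof -
  obtain u v w where x: "x = (u, v, w)" by (cases x)
  have m: "u \<in> H1 (-1) 0" "v \<in> L2 (-1) 0" using assms by (auto simp: x wh_space_simp)
  show "(wh_norm (state_scale c x))\<^sup>2 = (cmod c)\<^sup>2 * (wh_norm x)\<^sup>2"
    unfolding x state_scale_simp wh_norm_sq
    by (simp add: L2_sq_scale L2_sq_weak_deriv_scale m distrib_left)
  show "energy (state_scale c x) = (cmod c)\<^sup>2 * energy x"
    unfolding x state_scale_simp
    by (simp add: energy_eq m L2_scale L2_sq_scale L2_sq_weak_deriv_scale algebra_simps)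
qed

lemma energy_nonneg: "energy x \<ge> 0"
  unfolding energy_def by (cases x) (auto intro!: add_nonneg_nonneg Bochner_Integration.integral_nonneg)

lemma energy_le_norm:
  assumes "x \<in> wh_space"
  shows "energy x \<le> (wh_norm x)\<^sup>2"
proof -
  obtain u v w where x: "x = (u, v, w)" by (cases x)
  have m: "u \<in> H1 (-1) 0" "v \<in> L2 (-1) 0" using assms by (auto simp: x wh_space_simp)
  show ?thesis
    unfolding x wh_norm_sq energy_eq[OF m]
    using L2_sq_nonneg[of "-1" 0 u] L2_sq_nonneg[of "-1" 0 v] L2_sq_nonneg[of 0 1 w]
      L2_sq_nonneg[of "-1" 0 "weak_deriv (-1) 0 u"] by simp
qed

lemma wh_norm_energy_add:
  assumes "x \<in> wh_space" "y \<in> wh_space"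
  shows "(wh_norm (x + y))\<^sup>2 \<le> 2 * (wh_norm x)\<^sup>2 + 2 * (wh_norm y)\<^sup>2"
    "energy (x + y) \<le> 2 * energy x + 2 * energy y"
proof -
  obtain u v w where x: "x = (u, v, w)" by (cases x)
  obtain u' v' w' where y: "y = (u', v', w')" by (cases y)
  have m: "u \<in> H1 (-1) 0" "v \<in> L2 (-1) 0" "w \<in> L2 0 1" "u' \<in> H1 (-1) 0" "v' \<in> L2 (-1) 0" "w' \<in> L2 0 1"
    using assms by (auto simp: x y wh_space_simp)
  have b: "L2_sq (-1) 0 (\<lambda>x. u x + u' x) \<le> 2 * L2_sq (-1) 0 u + 2 * L2_sq (-1) 0 u'"
    "L2_sq (-1) 0 (\<lambda>x. v x + v' x) \<le> 2 * L2_sq (-1) 0 v + 2 * L2_sq (-1) 0 v'"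
    "L2_sq 0 1 (\<lambda>x. w x + w' x) \<le> 2 * L2_sq 0 1 w + 2 * L2_sq 0 1 w'"
    "L2_sq (-1) 0 (weak_deriv (-1) 0 (\<lambda>x. u x + u' x))
      \<le> 2 * L2_sq (-1) 0 (weak_deriv (-1) 0 u) + 2 * L2_sq (-1) 0 (weak_deriv (-1) 0 u')"
    using L2_sq_add[OF H1_weak_deriv(3)[OF m(1)] H1_weak_deriv(3)[OF m(4)]]
      L2_sq_add[OF m(2,5)] L2_sq_add[OF m(3,6)] L2_sq_weak_deriv_lincomb[OF m(1,4), of 1] by auto
  show "(wh_norm (x + y))\<^sup>2 \<le> 2 * (wh_norm x)\<^sup>2 + 2 * (wh_norm y)\<^sup>2"
    unfolding x y state_plus wh_norm_sq using b by argo
  have "(\<lambda>x. u x + u' x) \<in> H1 (-1) 0"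
    using H1_lincomb(1)[OF m(1,4), of 1] by simp
  then show "energy (x + y) \<le> 2 * energy x + 2 * energy y"
    unfolding x y state_plus using b by (simp add: energy_eq m L2_add) argo
qed

interpretation wh: quasi_normed state_scale wh_space wh_norm
proof
  fix a b :: complex and x y :: state
  show "state_scale a (x + y) = state_scale a x + state_scale a y"
    "state_scale (a + b) x = state_scale a x + state_scale b x"
    "state_scale a (state_scale b x) = state_scale (a * b) x"
    "state_scale 1 x = x"
    by (cases x; cases y; simp add: state_scale_simp plus_fun_def algebra_simps)+
  have "(\<lambda>_. 0) \<in> L2 a b" for a b by (rule L2_continuous) simp
  then show "0 \<in> wh_space"
    using H1_zero by (simp add: wh_space_def zero_prod_def zero_fun_def)
  show "wh_norm x \<ge> 0" by (rule wh_norm_nonneg)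
  assume x: "x \<in> wh_space"
  have "(wh_norm (state_scale a x))\<^sup>2 = (cmod a * wh_norm x)\<^sup>2"
    by (simp add: wh_norm_sq_scale x power_mult_distrib)
  then show "wh_norm (state_scale a x) = cmod a * wh_norm x"
    using wh_norm_nonneg by (simp add: power2_eq_iff_nonneg)
  assume y: "y \<in> wh_space"
  show "state_scale a x + y \<in> wh_space"
    using x y by (cases x; cases y)
      (simp add: state_scale_simp state_plus wh_space_simp H1_lincomb L2_add L2_scale del: plus_prod_def add_Pair)
  show "(wh_norm (x + y))\<^sup>2 \<le> 2 * (wh_norm x)\<^sup>2 + 2 * (wh_norm y)\<^sup>2"
    by (rule wh_norm_energy_add[OF x y])
qed

lemma H1_classical:
  assumes "a \<le> b"
    and f: "\<And>x. x \<in> {a..b} \<Longrightarrow> (f has_vector_derivative f1 x) (at x within {a..b})"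
    and f1: "continuous_on {a..b} f1"
  shows "f \<in> H1 a b" "AE x in lebesgue_on {a<..<b}. weak_deriv a b f x = f1 x"
proof -
  have L: "f \<in> L2 a b" "f1 \<in> L2 a b"
    using f1 continuous_on_vector_derivative[OF f] by (auto intro: L2_continuous)
  have wd: "has_weak_deriv a b f f1"
    by (rule has_weak_deriv_classical[OF assms])
  show "f \<in> H1 a b" unfolding H1_def using L wd by blast
  show "AE x in lebesgue_on {a<..<b}. weak_deriv a b f x = f1 x"
    by (rule weak_deriv_props(3)[OF L(2) wd])
qed

lemma H2_classical:
  assumes "a \<le> b"
    and f: "\<And>x. x \<in> {a..b} \<Longrightarrow> (f has_vector_derivative f1 x) (at x within {a..b})"
    and f1: "\<And>x. x \<in> {a..b} \<Longrightarrow> (f1 has_vector_derivative f2 x) (at x within {a..b})"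
    and f2: "continuous_on {a..b} f2"
  shows "f \<in> H2 a b" "AE x in lebesgue_on {a<..<b}. weak_deriv a b f x = f1 x"
    "AE x in lebesgue_on {a<..<b}. weak_deriv a b (weak_deriv a b f) x = f2 x"
proof -
  have cf1: "continuous_on {a..b} f1"
    by (rule continuous_on_vector_derivative[OF f1])
  note f_H1 = H1_classical[OF assms(1) f cf1]
  then show ae: "AE x in lebesgue_on {a<..<b}. weak_deriv a b f x = f1 x" by blast
  have L: "weak_deriv a b f \<in> L2 a b" "f1 \<in> L2 a b" "f2 \<in> L2 a b"
    using H1_weak_deriv[OF f_H1(1)] L2_continuous cf1 f2 by auto
  have wd: "has_weak_deriv a b (weak_deriv a b f) f2"
  proof (rule has_weak_deriv_cong_AE)
    show "AE x in lebesgue_on {a<..<b}. f1 x = weak_deriv a b f x"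
      using ae by eventually_elim simp
    show "has_weak_deriv a b f1 f2"
      by (rule has_weak_deriv_classical[OF assms(1) f1 f2])
  qed (use L in auto)
  then have "weak_deriv a b f \<in> H1 a b" unfolding H1_def using L by blast
  then show "f \<in> H2 a b" using f_H1(1) by (simp add: H2_def)
  show "AE x in lebesgue_on {a<..<b}. weak_deriv a b (weak_deriv a b f) x = f2 x"
    by (rule weak_deriv_props(3)[OF L(3) wd])
qed

lemma wh_dom_subset: "wh_dom \<subseteq> wh_space"
  by (auto simp: wh_dom_def wh_space_def H2_def dest: H1_weak_deriv)

text \<open>
  Functions that solve the transmission conditions classically lie in the domain. It applies to single
  eigenvectors as well as to series of them.
\<close>

lemma wh_dom_classical:
  fixes u u1 u2 v v1 w w1 w2 :: "real \<Rightarrow> complex"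
  assumes u: "\<And>x. x \<in> {-1..0} \<Longrightarrow> (u has_vector_derivative u1 x) (at x within {-1..0})"
      "\<And>x. x \<in> {-1..0} \<Longrightarrow> (u1 has_vector_derivative u2 x) (at x within {-1..0})" "continuous_on {-1..0} u2"
    and v: "\<And>x. x \<in> {-1..0} \<Longrightarrow> (v has_vector_derivative v1 x) (at x within {-1..0})" "continuous_on {-1..0} v1"
    and w: "\<And>x. x \<in> {0..1} \<Longrightarrow> (w has_vector_derivative w1 x) (at x within {0..1})"
      "\<And>x. x \<in> {0..1} \<Longrightarrow> (w1 has_vector_derivative w2 x) (at x within {0..1})" "continuous_on {0..1} w2"
    and bc: "u1 (-1) = 0" "w 1 = 0" "v 0 = w 0" "u1 0 = w1 0"
  shows "(u, v, w) \<in> wh_dom"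
proof -
  have c: "continuous_on {-1..0} u1" "continuous_on {-1..0} v" "continuous_on {0..1} w" "continuous_on {0..1} w1"
    using continuous_on_vector_derivative[OF u(2)] continuous_on_vector_derivative[OF v(1)]
      continuous_on_vector_derivative[OF w(1)] continuous_on_vector_derivative[OF w(2)] by auto
  note U = H2_classical[of "-1" 0 u u1 u2, OF _ u] and W = H2_classical[of 0 1 w w1 w2, OF _ w]
    and V = H1_classical[of "-1" 0 v v1, OF _ v]
  have "pt_val (-1) 0 (weak_deriv (-1) 0 u) x = u1 x" if "x \<in> {-1..0}" for x
    using pt_val_continuous[OF _ c(1) U(2) that] by simp
  moreover have "pt_val (-1) 0 v x = v x" if "x \<in> {-1..0}" for x
    using pt_val_continuous[OF _ c(2) _ that] by simp
  moreover have "pt_val 0 1 w x = w x" if "x \<in> {0..1}" for x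
    using pt_val_continuous[OF _ c(3) _ that] by simp
  moreover have "pt_val 0 1 (weak_deriv 0 1 w) x = w1 x" if "x \<in> {0..1}" for x
    using pt_val_continuous[OF _ c(4) W(2) that] by simp
  ultimately show ?thesis
    unfolding wh_dom_def using U(1) W(1) V(1) bc by simp
qed

lemma wh_norm_classical_bound:
  fixes u u1 v w :: "real \<Rightarrow> complex"
  assumes u: "\<And>x. x \<in> {-1..0} \<Longrightarrow> (u has_vector_derivative u1 x) (at x within {-1..0})"
      "continuous_on {-1..0} u1" and v: "continuous_on {-1..0} v" and w: "continuous_on {0..1} w"
    and K: "\<And>x. x \<in> {-1..0} \<Longrightarrow> cmod (u x) \<le> K \<and> cmod (u1 x) \<le> K \<and> cmod (v x) \<le> K"
      "\<And>x. x \<in> {0..1} \<Longrightarrow> cmod (w x) \<le> K"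
  shows "wh_norm (u, v, w) \<le> 2 * K"
proof -
  have K0: "K \<ge> 0" using K(2)[of 0] norm_ge_zero[of "w 0"] by (simp del: norm_ge_zero)
  note U = H1_classical[of "-1" 0 u u1, OF _ u]
  have L: "u \<in> L2 (-1) 0" "u1 \<in> L2 (-1) 0" "v \<in> L2 (-1) 0" "w \<in> L2 0 1" "weak_deriv (-1) 0 u \<in> L2 (-1) 0"
    using H1_weak_deriv[OF U(1)] u v w by (auto intro: L2_continuous)
  have "L2_sq (-1) 0 (weak_deriv (-1) 0 u) = L2_sq (-1) 0 u1"
    by (rule L2_sq_cong_AE) (use L U(2) in auto)
  moreover have "L2_sq (-1) 0 u \<le> K\<^sup>2 * (0 - (-1))" "L2_sq (-1) 0 u1 \<le> K\<^sup>2 * (0 - (-1))"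
    "L2_sq (-1) 0 v \<le> K\<^sup>2 * (0 - (-1))" "L2_sq 0 1 w \<le> K\<^sup>2 * (1 - 0)"
    using K by (intro L2_sq_bound L; force)+
  ultimately have "(wh_norm (u, v, w))\<^sup>2 \<le> (2 * K)\<^sup>2"
    unfolding wh_norm_sq by (simp add: power_mult_distrib)
  then show ?thesis by (rule power2_le_imp_le) (use K0 in simp)
qed

section \<open>Eigenvectors\<close>

text \<open>
  The eigenvectors are normalised so that the wave components \<open>u'\<close> and \<open>v\<close> are of order one. The primed functions are
  the derivatives in the space variable.
\<close>

definition eig_u :: "complex \<Rightarrow> real \<Rightarrow> complex" where
  "eig_u \<Lambda> x = cosh (\<Lambda> * of_real (x + 1)) / \<Lambda>"
definition eig_v :: "complex \<Rightarrow> real \<Rightarrow> complex" where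
  "eig_v \<Lambda> x = cosh (\<Lambda> * of_real (x + 1))"
definition eig_u' :: "complex \<Rightarrow> real \<Rightarrow> complex" where
  "eig_u' \<Lambda> x = sinh (\<Lambda> * of_real (x + 1))"
definition eig_w :: "complex \<Rightarrow> complex \<Rightarrow> real \<Rightarrow> complex" where
  "eig_w \<Lambda> \<mu> x = cosh \<Lambda> / sinh \<mu> * sinh (\<mu> * of_real (1 - x))"
definition eig_w' :: "complex \<Rightarrow> complex \<Rightarrow> real \<Rightarrow> complex" where
  "eig_w' \<Lambda> \<mu> x = - (\<mu> * (cosh \<Lambda> / sinh \<mu> * cosh (\<mu> * of_real (1 - x))))"

definition eigvec :: "complex \<Rightarrow> complex \<Rightarrow> state" where
  "eigvec \<Lambda> \<mu> = (eig_u \<Lambda>, eig_v \<Lambda>, eig_w \<Lambda> \<mu>)"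

lemma eig_derivs:
  assumes "\<Lambda> \<noteq> 0"
  shows "(eig_u \<Lambda> has_vector_derivative eig_u' \<Lambda> x) (at x within S)"
    "(eig_u' \<Lambda> has_vector_derivative \<Lambda> * eig_v \<Lambda> x) (at x within S)"
    "(eig_v \<Lambda> has_vector_derivative \<Lambda> * eig_u' \<Lambda> x) (at x within S)"
    "(eig_w \<Lambda> \<mu> has_vector_derivative eig_w' \<Lambda> \<mu> x) (at x within S)"
    "(eig_w' \<Lambda> \<mu> has_vector_derivative \<mu>\<^sup>2 * eig_w \<Lambda> \<mu> x) (at x within S)"
proof -
  have 1: "((\<lambda>x. \<Lambda> * of_real (x + 1)) has_vector_derivative \<Lambda>) (at x within S)"
  proof -
    have "((\<lambda>x. x + 1) has_real_derivative 1) (at x within S)"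
      by (auto intro!: derivative_eq_intros)
    from has_vector_derivative_mult_right[OF has_vector_derivative_of_real[OF this], of \<Lambda>]
    show ?thesis by simp
  qed
  have 2: "((\<lambda>x. \<mu> * of_real (1 - x)) has_vector_derivative - \<mu>) (at x within S)"
  proof -
    have "((\<lambda>x. 1 - x) has_real_derivative - 1) (at x within S)"
      by (auto intro!: derivative_eq_intros)
    from has_vector_derivative_mult_right[OF has_vector_derivative_of_real[OF this], of \<mu>]
    show ?thesis by simp
  qed
  have ch: "((\<lambda>x. f (h x)) has_vector_derivative f' (h x) * h') (at x within S)"
    if "(h has_vector_derivative h') (at x within S)" "\<And>z. (f has_field_derivative f' z) (at z)"
    for f f' :: "complex \<Rightarrow> complex" and h h'
    using field_vector_diff_chain_within[OF that(1) has_field_derivative_at_within[OF that(2)]]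
    by (simp add: o_def mult.commute)
  show "(eig_u \<Lambda> has_vector_derivative eig_u' \<Lambda> x) (at x within S)"
    unfolding eig_u_def[abs_def] eig_u'_def using assms
    by (rule_tac ch[OF 1, where f = "\<lambda>z. cosh z / \<Lambda>" and f' = "\<lambda>z. sinh z / \<Lambda>", THEN has_vector_derivative_eq_rhs])
      (auto intro!: derivative_eq_intros)
  show "(eig_u' \<Lambda> has_vector_derivative \<Lambda> * eig_v \<Lambda> x) (at x within S)"
    unfolding eig_u'_def[abs_def] eig_v_def
    by (rule ch[OF 1, where f = sinh and f' = cosh, THEN has_vector_derivative_eq_rhs])
      (auto intro!: derivative_eq_intros)
  show "(eig_v \<Lambda> has_vector_derivative \<Lambda> * eig_u' \<Lambda> x) (at x within S)"
    unfolding eig_u'_def eig_v_def[abs_def]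
    by (rule ch[OF 1, where f = cosh and f' = sinh, THEN has_vector_derivative_eq_rhs])
      (auto intro!: derivative_eq_intros)
  have dsinh: "(sinh has_field_derivative cosh z) (at z)" and dcosh: "(cosh has_field_derivative sinh z) (at z)"
    for z :: complex
    by (auto intro!: derivative_eq_intros)
  show "(eig_w \<Lambda> \<mu> has_vector_derivative eig_w' \<Lambda> \<mu> x) (at x within S)"
    unfolding eig_w_def[abs_def] eig_w'_def
    by (rule ch[OF 2, where f = "\<lambda>z. cosh \<Lambda> / sinh \<mu> * sinh z" and f' = "\<lambda>z. cosh \<Lambda> / sinh \<mu> * cosh z", THEN has_vector_derivative_eq_rhs])
      ((rule DERIV_cmult dsinh)+, simp)
  show "(eig_w' \<Lambda> \<mu> has_vector_derivative \<mu>\<^sup>2 * eig_w \<Lambda> \<mu> x) (at x within S)"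
    unfolding eig_w_def eig_w'_def[abs_def]
    by (rule ch[OF 2, where f = "\<lambda>z. - (\<mu> * (cosh \<Lambda> / sinh \<mu> * cosh z))" and f' = "\<lambda>z. - (\<mu> * (cosh \<Lambda> / sinh \<mu> * sinh z))", THEN has_vector_derivative_eq_rhs])
      ((rule DERIV_minus DERIV_cmult dcosh)+, simp add: power2_eq_square mult_ac)
qed

lemma eig_continuous:
  assumes "\<Lambda> \<noteq> 0"
  shows "continuous_on S (eig_u \<Lambda>)" "continuous_on S (eig_u' \<Lambda>)" "continuous_on S (eig_v \<Lambda>)"
    "continuous_on S (eig_w \<Lambda> \<mu>)" "continuous_on S (eig_w' \<Lambda> \<mu>)"
  by (rule continuous_on_vector_derivative, rule eig_derivs, rule assms)+

text \<open>
  The equation is the characteristic equation: given \<open>\<mu>\<^sup>2 = \<Lambda>\<close>, it expresses continuity of the flux,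
  \<open>u' 0 = w' 0\<close>, the other boundary and transmission conditions being built into the eigenfunctions. The
  bound on \<open>Re \<mu>\<close> keeps \<open>sinh \<mu>\<close> away from zero and makes the heat component a boundary layer.
\<close>

definition eigenpair :: "complex \<Rightarrow> complex \<Rightarrow> bool" where
  "eigenpair \<Lambda> \<mu> \<longleftrightarrow> \<mu>\<^sup>2 = \<Lambda> \<and> Re \<mu> \<ge> 1 \<and> sinh \<Lambda> * sinh \<mu> + \<mu> * cosh \<Lambda> * cosh \<mu> = 0"

lemma cmod_sinh_cosh_le: "cmod (sinh z) \<le> cosh (Re z)" "cmod (cosh z) \<le> cosh (Re z)"
proof -
  have "cmod (exp z - exp (- z)) \<le> exp (Re z) + exp (- Re z)"
    using norm_triangle_ineq4[of "exp z" "exp (- z)"] by simp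
  then show "cmod (sinh z) \<le> cosh (Re z)"
    by (simp add: sinh_def cosh_def)
  have "cmod (exp z + exp (- z)) \<le> exp (Re z) + exp (- Re z)"
    using norm_triangle_ineq[of "exp z" "exp (- z)"] by simp
  then show "cmod (cosh z) \<le> cosh (Re z)"
    by (simp add: cosh_def)
qed

lemma cmod_sinh_cosh_ge: "sinh (Re z) \<le> cmod (sinh z)" "sinh (Re z) \<le> cmod (cosh z)"
proof -
  have "exp (Re z) - exp (- Re z) \<le> cmod (exp z - exp (- z))"
    using norm_triangle_ineq2[of "exp z" "exp (- z)"] by simp
  then show "sinh (Re z) \<le> cmod (sinh z)"
    by (simp add: sinh_def)
  have "exp (Re z) - exp (- Re z) \<le> cmod (exp z + exp (- z))"
    using norm_triangle_ineq2[of "exp z" "- exp (- z)"] by simp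
  then show "sinh (Re z) \<le> cmod (cosh z)"
    by (simp add: sinh_def cosh_def)
qed

lemma cosh_le_2_sinh:
  assumes "1 \<le> (m::real)"
  shows "cosh m \<le> 2 * sinh m" "0 < sinh m"
proof -
  have "3 \<le> exp (2::real)" using exp_ge_add_one_self[of 2] by simp
  also have "exp (2::real) \<le> exp (m + m)" using assms by simp
  finally have "3 \<le> exp m * exp m" unfolding exp_add .
  then have "3 * exp (- m) \<le> exp m * exp m * exp (- m)"
    by (intro mult_right_mono) auto
  also have "\<dots> = exp m" by (simp add: exp_minus)
  finally have "3 * exp (- m) \<le> exp m" .
  then show "cosh m \<le> 2 * sinh m" by (simp add: cosh_def sinh_def)
  show "0 < sinh m" using assms by simp
qed

lemma eigenpair_nonzero:
  assumes "eigenpair \<Lambda> \<mu>"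
  shows "\<mu> \<noteq> 0" "\<Lambda> \<noteq> 0" "sinh \<mu> \<noteq> 0"
proof -
  have R: "Re \<mu> \<ge> 1" and sq: "\<mu>\<^sup>2 = \<Lambda>" using assms by (auto simp: eigenpair_def)
  show "\<mu> \<noteq> 0" using R by auto
  then show "\<Lambda> \<noteq> 0" using sq by auto
  show "sinh \<mu> \<noteq> 0"
    using cmod_sinh_cosh_ge(1)[of \<mu>] cosh_le_2_sinh(2)[OF R] by auto
qed

lemma eig_boundary:
  assumes "eigenpair \<Lambda> \<mu>"
  shows "eig_u' \<Lambda> (-1) = 0" "eig_w \<Lambda> \<mu> 1 = 0" "eig_v \<Lambda> 0 = eig_w \<Lambda> \<mu> 0" "eig_u' \<Lambda> 0 = eig_w' \<Lambda> \<mu> 0"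
  using assms eigenpair_nonzero[OF assms]
  by (simp_all add: eigenpair_def eig_u'_def eig_v_def eig_w_def eig_w'_def field_simps add_eq_0_iff)

lemma eigvec_dom:
  assumes "eigenpair \<Lambda> \<mu>"
  shows "eigvec \<Lambda> \<mu> \<in> wh_dom"
  unfolding eigvec_def
  by (rule wh_dom_classical[OF eig_derivs(1,2) _ eig_derivs(3) _ eig_derivs(4,5)])
    (auto simp: eigenpair_nonzero[OF assms] eig_boundary[OF assms] intro!: continuous_intros eig_continuous)

lemma eigvec_eigen:
  assumes "eigenpair \<Lambda> \<mu>"
  shows "wh_norm (wh_op (eigvec \<Lambda> \<mu>) - state_scale \<Lambda> (eigvec \<Lambda> \<mu>)) = 0"
proof -
  note nz = eigenpair_nonzero[OF assms]
  note U = H2_classical[of "-1" 0 "eig_u \<Lambda>", OF _ eig_derivs(1,2)]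
    and W = H2_classical[of 0 1 "eig_w \<Lambda> \<mu>", OF _ eig_derivs(4,5)]
  define f g h where "f = (\<lambda>x. eig_v \<Lambda> x - \<Lambda> * eig_u \<Lambda> x)"
    and "g = (\<lambda>x. weak_deriv (-1) 0 (weak_deriv (-1) 0 (eig_u \<Lambda>)) x - \<Lambda> * eig_v \<Lambda> x)"
    and "h = (\<lambda>x. weak_deriv 0 1 (weak_deriv 0 1 (eig_w \<Lambda> \<mu>)) x - \<Lambda> * eig_w \<Lambda> \<mu> x)"
  have eq: "wh_op (eigvec \<Lambda> \<mu>) - state_scale \<Lambda> (eigvec \<Lambda> \<mu>) = (f, g, h)"
    by (simp add: wh_op_def eigvec_def state_scale_def f_def g_def h_def fun_diff_def)
  have f0: "f = (\<lambda>_. 0)" using nz by (simp add: f_def eig_u_def eig_v_def)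
  have cu: "continuous_on {-1..0} (\<lambda>x. \<Lambda> * eig_v \<Lambda> x)" "continuous_on {0..1} (\<lambda>x. \<mu>\<^sup>2 * eig_w \<Lambda> \<mu> x)"
    by (intro continuous_intros eig_continuous nz)+
  have diff: "(\<lambda>x. p x - q x) \<in> L2 a b" if "p \<in> L2 a b" "q \<in> L2 a b" for p q a b
    using L2_add[OF that(1) L2_scale[OF that(2), of "-1"]] by simp
  have "L2_sq (-1) 0 g = 0"
  proof (subst L2_sq_eq_0_iff)
    have "weak_deriv (-1) 0 (eig_u \<Lambda>) \<in> H1 (-1) 0"
      using U(1) cu nz by (simp add: H2_def)
    then show "g \<in> L2 (-1) 0"
      unfolding g_def using cu by (intro diff H1_weak_deriv L2_continuous) auto
    show "AE x in lebesgue_on {-1<..<0}. g x = 0"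
      using U(3)[OF _ nz(2) nz(2) cu(1)] unfolding g_def by (auto elim!: eventually_mono)
  qed
  moreover have "L2_sq 0 1 h = 0"
  proof (subst L2_sq_eq_0_iff)
    have sq: "\<mu>\<^sup>2 = \<Lambda>" using assms by (simp add: eigenpair_def)
    have "weak_deriv 0 1 (eig_w \<Lambda> \<mu>) \<in> H1 0 1"
      using W(1) cu nz by (simp add: H2_def)
    then show "h \<in> L2 0 1"
      unfolding h_def using cu sq by (intro diff H1_weak_deriv L2_continuous) auto
    show "AE x in lebesgue_on {0<..<1}. h x = 0"
      using W(3)[OF _ nz(2) nz(2) cu(2)] sq unfolding h_def by (auto elim!: eventually_mono)
  qed
  moreover have "L2_sq (-1) 0 f = 0" "L2_sq (-1) 0 (weak_deriv (-1) 0 f) = 0"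
    using L2_sq_scale[of "-1" 0 0 "\<lambda>_. 0"] L2_sq_weak_deriv_scale(2)[OF H1_zero, of "-1" 0 0] unfolding f0 by auto
  ultimately have "(wh_norm (f, g, h))\<^sup>2 = 0"
    unfolding wh_norm_sq by simp
  then show ?thesis unfolding eq by simp
qed

text \<open>
  The wave part alone suffices: \<open>\<bar>sinh\<bar>\<^sup>2 + \<bar>cosh\<bar>\<^sup>2\<close> is at least \<open>\<bar>cosh\<^sup>2 - sinh\<^sup>2\<bar> = 1\<close>.
\<close>

lemma eigvec_energy:
  assumes "eigenpair \<Lambda> \<mu>"
  shows "energy (eigvec \<Lambda> \<mu>) \<ge> 1 / 2"
proof -
  note nz = eigenpair_nonzero[OF assms]
  have "eig_u \<Lambda> \<in> H1 (-1) 0" "AE x in lebesgue_on {-1<..<0}. weak_deriv (-1) 0 (eig_u \<Lambda>) x = eig_u' \<Lambda> x"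
    by (rule H1_classical[OF _ eig_derivs(1) eig_continuous(2)]; simp add: nz)+
  note U = this
  have L: "eig_u' \<Lambda> \<in> L2 (-1) 0" "eig_v \<Lambda> \<in> L2 (-1) 0"
    by (intro L2_continuous eig_continuous nz)+
  have eq: "L2_sq (-1) 0 (weak_deriv (-1) 0 (eig_u \<Lambda>)) = L2_sq (-1) 0 (eig_u' \<Lambda>)"
    by (intro L2_sq_cong_AE H1_weak_deriv U L)
  have "1 \<le> (cmod (eig_u' \<Lambda> x))\<^sup>2 + (cmod (eig_v \<Lambda> x))\<^sup>2" for x
  proof -
    have "(eig_v \<Lambda> x)\<^sup>2 - (eig_u' \<Lambda> x)\<^sup>2 = 1"
      unfolding eig_v_def eig_u'_def by (rule hyperbolic_pythagoras)
    then have "1 = cmod ((eig_v \<Lambda> x)\<^sup>2 - (eig_u' \<Lambda> x)\<^sup>2)" by simp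
    also have "\<dots> \<le> cmod ((eig_v \<Lambda> x)\<^sup>2) + cmod ((eig_u' \<Lambda> x)\<^sup>2)"
      by (rule norm_triangle_ineq4)
    finally show ?thesis by (simp add: norm_power)
  qed
  then have "(\<integral>x. 1 \<partial>lebesgue_on {-1<..<0::real}) \<le>
      (\<integral>x. (cmod (eig_u' \<Lambda> x))\<^sup>2 + (cmod (eig_v \<Lambda> x))\<^sup>2 \<partial>lebesgue_on {-1<..<0})"
    using L integrable_lebesgue_on_bounded[of "\<lambda>_. 1::real" "-1" 0 1]
    by (intro integral_mono) (auto simp: L2_def)
  moreover have "(\<integral>x. (1::real) \<partial>lebesgue_on {-1<..<0::real}) = 0 - (-1)"
    by (rule integral_lebesgue_on_FTC)
      (auto intro!: derivative_eq_intros simp flip: has_real_derivative_iff_has_vector_derivative)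
  moreover have "(\<integral>x. (cmod (eig_u' \<Lambda> x))\<^sup>2 + (cmod (eig_v \<Lambda> x))\<^sup>2 \<partial>lebesgue_on {-1<..<0})
      = L2_sq (-1) 0 (eig_u' \<Lambda>) + L2_sq (-1) 0 (eig_v \<Lambda>)"
    using L unfolding L2_sq_def by (intro Bochner_Integration.integral_add) (auto simp: L2_def)
  ultimately show ?thesis
    unfolding eigvec_def energy_eq[OF U(1) L(2)] eq using L2_sq_nonneg[of 0 1 "eig_w \<Lambda> \<mu>"] by simp
qed

section \<open>Eigenvalues near the imaginary axis\<close>

text \<open>
  Write \<open>\<Lambda> = \<i> * s + z\<close>. As \<open>cos s = 0\<close>, the characteristic equation becomes \<open>tanh z = - q z\<close> with
  \<open>q z = tanh \<mu> / \<mu>\<close>, that is, \<open>exp (2 * z) = (1 - q z) / (1 + q z)\<close>. Since \<open>tanh \<mu>\<close> is bounded and \<open>\<mu>\<close> is of order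
  \<open>sqrt s\<close>, half the logarithm of the right-hand side maps a disc of radius \<open>5 / sqrt s\<close> into itself, and Brouwer's theorem
  gives a fixed point.
\<close>

lemma eigenpair_exists:
  assumes s: "s \<ge> 200" "cos s = 0"
  obtains \<Lambda> \<mu> where "eigenpair \<Lambda> \<mu>" "cmod (\<Lambda> - \<i> * complex_of_real s) \<le> 5 / sqrt s"
proof -
  define \<rho> where "\<rho> = 5 / sqrt s"
  have sqrt_s: "sqrt s \<ge> 14"
    using s by (intro real_le_rsqrt) simp
  have \<rho>: "0 < \<rho>" "\<rho> \<le> 1"
    using sqrt_s s by (auto simp: \<rho>_def pos_divide_le_eq)
  define \<mu> where "\<mu> z = csqrt (\<i> * complex_of_real s + z)" for z
  define q where "q z = sinh (\<mu> z) / (\<mu> z * cosh (\<mu> z))" for z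
  define F where "F z = Ln (1 + (- 2 * q z / (1 + q z))) / 2" for z

  have base: "Im (\<i> * complex_of_real s + z) > 0" "Re (\<mu> z) \<ge> 1" "cosh (\<mu> z) \<noteq> 0"
    "cmod (q z) \<le> 2 / sqrt (s - 1)" if z: "cmod z \<le> 1" for z
  proof -
    let ?\<Lambda> = "\<i> * complex_of_real s + z"
    have ReIm: "\<bar>Re z\<bar> \<le> 1" "\<bar>Im z\<bar> \<le> 1"
      using abs_Re_le_cmod[of z] abs_Im_le_cmod[of z] z by auto
    then show "Im ?\<Lambda> > 0" using s by simp
    have "cmod (\<i> * complex_of_real s) - cmod z \<le> cmod ?\<Lambda>"
      by (rule norm_diff_ineq)
    then have cm: "cmod ?\<Lambda> \<ge> s - 1" using s z by (simp add: norm_mult)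
    have "Re (\<mu> z) = sqrt ((cmod ?\<Lambda> + Re ?\<Lambda>) / 2)"
      by (simp add: \<mu>_def)
    moreover have "(cmod ?\<Lambda> + Re ?\<Lambda>) / 2 \<ge> 1"
      using cm ReIm s by simp
    ultimately show R: "Re (\<mu> z) \<ge> 1" by simp
    have sh: "cosh (Re (\<mu> z)) \<le> 2 * sinh (Re (\<mu> z))" "0 < sinh (Re (\<mu> z))"
      using cosh_le_2_sinh[OF R] by auto
    have ch: "sinh (Re (\<mu> z)) \<le> cmod (cosh (\<mu> z))"
      by (rule cmod_sinh_cosh_ge)
    with sh show "cosh (\<mu> z) \<noteq> 0" by auto
    have "(cmod (\<mu> z))\<^sup>2 = cmod ?\<Lambda>"
      by (simp add: \<mu>_def flip: norm_power)
    then have "sqrt (s - 1) \<le> cmod (\<mu> z)"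
      using cm by (intro real_le_lsqrt) auto
    moreover have "sqrt (s - 1) > 0" using s by simp
    moreover have "cmod (sinh (\<mu> z)) \<le> 2 * cmod (cosh (\<mu> z))"
      using cmod_sinh_cosh_le(1)[of "\<mu> z"] sh ch by linarith
    then have "cmod (sinh (\<mu> z)) / cmod (cosh (\<mu> z)) \<le> 2"
      using ch sh by (simp add: divide_le_eq)
    ultimately have "cmod (sinh (\<mu> z)) / cmod (cosh (\<mu> z)) / cmod (\<mu> z) \<le> 2 / sqrt (s - 1)"
      by (intro frac_le) auto
    then show "cmod (q z) \<le> 2 / sqrt (s - 1)"
      by (simp add: q_def norm_divide norm_mult mult.commute)
  qed
  have root: "sqrt (s - 1) \<ge> 14" "sqrt (s - 1) \<ge> 14 / 15 * sqrt s"
  proof -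
    show "sqrt (s - 1) \<ge> 14"
      using s by (intro real_le_rsqrt) simp
    show "sqrt (s - 1) \<ge> 14 / 15 * sqrt s"
      using s by (intro real_le_rsqrt) (simp add: power_mult_distrib power_divide)
  qed
  have small: "cmod (q z) \<le> 1 / 7" "1 + q z \<noteq> 0" "cmod (2 * q z / (1 + q z)) \<le> 7 / 3 * cmod (q z)"
    if z: "cmod z \<le> 1" for z
  proof -
    have "2 / sqrt (s - 1) \<le> 2 / 14"
      using root(1) s by (intro divide_left_mono) auto
    then show q: "cmod (q z) \<le> 1 / 7"
      using base(4)[OF z] by simp
    have "cmod 1 - cmod (q z) \<le> cmod (1 + q z)"
      by (rule norm_diff_ineq)
    then have ge: "cmod (1 + q z) \<ge> 6 / 7" using q by simp
    then show "1 + q z \<noteq> 0" by auto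
    have "2 * cmod (q z) / cmod (1 + q z) \<le> 2 * cmod (q z) / (6 / 7)"
      using ge by (intro divide_left_mono) (auto intro!: mult_pos_pos elim: less_le_trans[rotated])
    then show "cmod (2 * q z / (1 + q z)) \<le> 7 / 3 * cmod (q z)"
      by (simp add: norm_divide norm_mult)
  qed
  have Fbound: "cmod (F z) \<le> \<rho>" if z: "cmod z \<le> 1" for z
  proof -
    let ?w = "- 2 * q z / (1 + q z)"
    have w: "cmod ?w \<le> 7 / 3 * cmod (q z)"
      using small(3)[OF z] by (simp add: norm_divide norm_mult)
    then have "cmod ?w < 1 / 2" using small(1)[OF z] by simp
    then have "cmod (Ln (1 + ?w)) \<le> 2 * cmod ?w" by (rule norm_Ln_le)
    then have "cmod (F z) \<le> 7 / 3 * cmod (q z)"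
      using w by (simp add: F_def norm_divide)
    also have "\<dots> \<le> 7 / 3 * (2 / sqrt (s - 1))"
      using base(4)[OF z] by simp
    also have "\<dots> \<le> 7 / 3 * (2 / (14 / 15 * sqrt s))"
      using root(2) sqrt_s s by (intro mult_left_mono divide_left_mono) auto
    also have "\<dots> = \<rho>" by (simp add: \<rho>_def)
    finally show ?thesis .
  qed
  have le1: "cmod z \<le> 1" if "z \<in> cball 0 \<rho>" for z :: complex
    using that \<rho> by simp
  have "continuous_on (cball 0 \<rho>) F"
  proof -
    have c\<mu>: "continuous_on (cball 0 \<rho>) \<mu>"
      unfolding \<mu>_def
    proof (rule continuous_on_compose2[OF continuous_on_csqrt])
      show "(\<lambda>z. \<i> * complex_of_real s + z) ` cball 0 \<rho> \<subseteq> - \<real>\<^sub>\<le>\<^sub>0"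
        using base(1)[OF le1] by (force simp: complex_nonpos_Reals_iff)
    qed (intro continuous_intros)
    have cq: "continuous_on (cball 0 \<rho>) q"
      unfolding q_def
      by (intro continuous_intros continuous_on_sinh continuous_on_cosh c\<mu>) 
        (use base(2,3) le1 in force)
    have nz: "\<forall>z\<in>cball 0 \<rho>. 1 + q z \<noteq> 0"
      using small(2) le1 by blast
    have slit: "1 + - 2 * q z / (1 + q z) \<notin> \<real>\<^sub>\<le>\<^sub>0" if "z \<in> cball 0 \<rho>" for z
    proof -
      have z: "cmod z \<le> 1" by (rule le1[OF that])
      have "cmod (- 2 * q z / (1 + q z)) \<le> 1 / 3"
        using small(1,3)[OF z] by (simp add: norm_divide norm_mult)
      then have "\<bar>Re (- 2 * q z / (1 + q z))\<bar> \<le> 1 / 3"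
        using abs_Re_le_cmod order_trans by blast
      then have "Re (1 + - 2 * q z / (1 + q z)) > 0" by simp
      then show ?thesis
        by (auto simp: complex_nonpos_Reals_iff)
    qed
    show ?thesis
      unfolding F_def by (intro continuous_intros cq nz slit) auto
  qed
  moreover have "F \<in> cball 0 \<rho> \<rightarrow> cball 0 \<rho>"
    using Fbound le1 by simp
  ultimately obtain z where z: "z \<in> cball 0 \<rho>" "F z = z"
    using brouwer[of "cball 0 \<rho>" F] \<rho>(1) by auto
  have z1: "cmod z \<le> 1" by (rule le1[OF z(1)])
  have "exp (2 * z) = 1 + (- 2 * q z / (1 + q z))"
  proof -
    have "cmod (- 2 * q z / (1 + q z)) \<le> 1 / 3"
      using small(1,3)[OF z1] by (simp add: norm_divide norm_mult)
    then have "1 + (- 2 * q z / (1 + q z)) \<noteq> 0"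
      by (metis add_eq_0_iff norm_minus_cancel norm_one one_le_numeral not_less order.trans
          divide_less_eq_1_pos zero_less_numeral one_less_numeral_iff semiring_norm(77))
    then have "exp (2 * F z) = 1 + (- 2 * q z / (1 + q z))"
      by (simp add: F_def)
    then show ?thesis by (simp add: z(2))
  qed
  also have "\<dots> = (1 - q z) / (1 + q z)"
    using small(2)[OF z1] by (simp add: field_simps)
  finally have "exp (2 * z) * (1 + q z) = 1 - q z"
    using small(2)[OF z1] by simp
  moreover have "exp (- z) * exp (2 * z) = exp z"
    by (simp flip: exp_add)
  ultimately have "exp z * (1 + q z) = exp (- z) * (1 - q z)"
    by (metis mult.assoc)
  then have "sinh z = - q z * cosh z"
    by (simp add: sinh_def cosh_def scaleR_conv_of_real algebra_simps)
  then have *: "\<mu> z * cosh (\<mu> z) * sinh z = - sinh (\<mu> z) * cosh z"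
    using base(2,3)[OF z1] by (auto simp: q_def)
  let ?\<Lambda> = "\<i> * complex_of_real s + z"
  have sinh_is: "sinh (\<i> * complex_of_real s) = \<i> * sin (complex_of_real s)" "cosh (\<i> * complex_of_real s) = 0"
    using s(2) by (simp_all add: sinh_def cosh_def sin_exp_eq scaleR_conv_of_real complex_eq_iff Re_exp Im_exp)
  have "eigenpair ?\<Lambda> (\<mu> z)"
    unfolding eigenpair_def
  proof (intro conjI)
    show "(\<mu> z)\<^sup>2 = ?\<Lambda>" by (simp add: \<mu>_def)
    show "Re (\<mu> z) \<ge> 1" by (rule base(2)[OF z1])
    have "sinh ?\<Lambda> * sinh (\<mu> z) + \<mu> z * cosh ?\<Lambda> * cosh (\<mu> z)
        = \<i> * sin (complex_of_real s) * (cosh z * sinh (\<mu> z) + \<mu> z * cosh (\<mu> z) * sinh z)"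
      unfolding sinh_add cosh_add sinh_is by (simp add: algebra_simps)
    then show "sinh ?\<Lambda> * sinh (\<mu> z) + \<mu> z * cosh ?\<Lambda> * cosh (\<mu> z) = 0"
      unfolding * by simp
  qed
  moreover have "cmod (?\<Lambda> - \<i> * complex_of_real s) \<le> 5 / sqrt s"
    using z(1) by (simp add: \<rho>_def)
  ultimately show ?thesis by (rule that)
qed

text \<open>
  The shift by 200 makes the asymptotic estimates hold for every index.
\<close>

definition freq :: "nat \<Rightarrow> real" where
  "freq n = (real (n + 200) + 1 / 2) * pi"

lemma freq_ge: "freq n \<ge> 200" "freq n \<ge> real n"
proof -
  have "(real (n + 200) + 1 / 2) * 1 \<le> freq n"
    unfolding freq_def using pi_ge_two by (intro mult_left_mono) auto
  then show "freq n \<ge> 200" "freq n \<ge> real n" by auto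
qed

lemma cos_freq: "cos (freq n) = 0"
proof -
  have "freq n = real (n + 200) * pi + pi / 2" by (simp add: freq_def algebra_simps)
  then show ?thesis by (simp only: cos_add cos_pi_half sin_npi)
qed

section \<open>The eigenspaces are one-dimensional\<close>

text \<open>
  On either side a weak solution of the eigenvalue equation is a combination of two exponentials. The outer
  boundary conditions leave \<open>cosh (\<Lambda> * (\<xi> + 1))\<close> and \<open>sinh (\<mu> * (1 - \<xi>))\<close>, and continuity \<open>v 0 = w 0\<close> couples the two
  coefficients, because \<open>sinh \<mu> \<noteq> 0\<close>.
\<close>

lemma eigenspace_simple:
  assumes ep: "eigenpair \<Lambda> \<mu>" and y: "y \<in> wh_dom"
    and eig: "wh_norm (wh_op y - state_scale \<Lambda> y) = 0"
  shows "\<exists>c. wh.eqv y (state_scale c (eigvec \<Lambda> \<mu>))"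
proof -
  note nz = eigenpair_nonzero[OF ep]
  have sq: "\<mu>\<^sup>2 = \<Lambda>" using ep by (simp add: eigenpair_def)
  obtain u v w where y_def: "y = (u, v, w)" by (cases y)
  define u1 u2 w1 w2 where "u1 = weak_deriv (-1) 0 u" and "u2 = weak_deriv (-1) 0 u1"
    and "w1 = weak_deriv 0 1 w" and "w2 = weak_deriv 0 1 w1"
  have dom: "u \<in> H2 (-1) 0" "v \<in> H1 (-1) 0" "w \<in> H2 0 1" "pt_val (-1) 0 u1 (-1) = 0" "pt_val 0 1 w 1 = 0"
    "pt_val (-1) 0 v 0 = pt_val 0 1 w 0"
    using y unfolding y_def wh_dom_def u1_def by auto
  have H: "u \<in> H1 (-1) 0" "u1 \<in> H1 (-1) 0" "w \<in> H1 0 1" "w1 \<in> H1 0 1"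
    using dom by (auto simp: H2_def u1_def w1_def)
  have L: "u \<in> L2 (-1) 0" "u1 \<in> L2 (-1) 0" "u2 \<in> L2 (-1) 0" "v \<in> L2 (-1) 0" "w \<in> L2 0 1" "w2 \<in> L2 0 1"
    using H dom(2) by (auto simp: u2_def w2_def intro: H1_weak_deriv)
  have diff: "(\<lambda>x. p x - q x) \<in> L2 a b" if "p \<in> L2 a b" "q \<in> L2 a b" for p q a b
    using L2_add[OF that(1) L2_scale[OF that(2), of "-1"]] by simp
  define f g h where "f = (\<lambda>x. v x - \<Lambda> * u x)" and "g = (\<lambda>x. u2 x - \<Lambda> * v x)" and "h = (\<lambda>x. w2 x - \<Lambda> * w x)"
  have "wh_op y - state_scale \<Lambda> y = (f, g, h)"
    by (simp add: y_def wh_op_def state_scale_def f_def g_def h_def fun_diff_def u1_def u2_def w1_def w2_def)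
  then have "(wh_norm (f, g, h))\<^sup>2 = 0" using eig by simp
  then have "L2_sq (-1) 0 f = 0" "L2_sq (-1) 0 g = 0" "L2_sq 0 1 h = 0"
    unfolding wh_norm_sq
    using L2_sq_nonneg[of "-1" 0 f] L2_sq_nonneg[of "-1" 0 g] L2_sq_nonneg[of 0 1 h]
      L2_sq_nonneg[of "-1" 0 "weak_deriv (-1) 0 f"] by linarith+
  moreover have "f \<in> L2 (-1) 0" "g \<in> L2 (-1) 0" "h \<in> L2 0 1"
    unfolding f_def g_def h_def by (intro diff L2_scale L)+
  ultimately have "AE x in lebesgue_on {-1<..<0}. f x = 0" "AE x in lebesgue_on {-1<..<0}. g x = 0"
    "AE x in lebesgue_on {0<..<1}. h x = 0"
    using L2_sq_eq_0_iff by blast+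
  then have v_eq: "AE x in lebesgue_on {-1<..<0}. v x = \<Lambda> * u x"
    and u2_eq: "AE x in lebesgue_on {-1<..<0}. u2 x = \<Lambda> * v x"
    and w2_eq: "AE x in lebesgue_on {0<..<1}. w2 x = \<mu>\<^sup>2 * w x"
    unfolding f_def g_def h_def sq by (auto elim!: eventually_mono)
  have u2_eq': "AE x in lebesgue_on {-1<..<0}. u2 x = \<Lambda>\<^sup>2 * u x"
    using v_eq u2_eq by eventually_elim (simp add: power2_eq_square)
  obtain C D where CD: "AE x in lebesgue_on {-1<..<0}. u x = C * exp (\<Lambda> * complex_of_real x) + D * exp (- \<Lambda> * complex_of_real x)"
    "AE x in lebesgue_on {-1<..<0}. u1 x = \<Lambda> * (C * exp (\<Lambda> * complex_of_real x) - D * exp (- \<Lambda> * complex_of_real x))"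
    using weak_second_order_ode[OF _ nz(2) dom(1) u2_eq'[unfolded u2_def u1_def]] unfolding u1_def by auto
  obtain P Q where PQ: "AE x in lebesgue_on {0<..<1}. w x = P * exp (\<mu> * complex_of_real x) + Q * exp (- \<mu> * complex_of_real x)"
    by (rule weak_second_order_ode[OF zero_less_one nz(1) dom(3) w2_eq[unfolded w2_def w1_def]])
  have "pt_val (-1) 0 u1 (-1) = \<Lambda> * (C * exp (\<Lambda> * complex_of_real (-1)) - D * exp (- \<Lambda> * complex_of_real (-1)))"
    by (rule pt_val_continuous[OF _ _ CD(2)]) (auto intro!: continuous_intros)
  then have CD0: "C * exp (- \<Lambda>) = D * exp \<Lambda>"
    using dom(4) nz by simp
  define \<alpha> where "\<alpha> = 2 * \<Lambda> * (C * exp (- \<Lambda>))"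
  have u_eq: "AE x in lebesgue_on {-1<..<0}. u x = \<alpha> * eig_u \<Lambda> x"
    using CD(1)
  proof eventually_elim
    case (elim x)
    have "C = C * exp (- \<Lambda>) * exp \<Lambda>" "D = D * exp \<Lambda> * exp (- \<Lambda>)"
      by (simp_all add: mult.assoc flip: exp_add)
    then have "C = C * exp (- \<Lambda>) * exp \<Lambda>" "D = C * exp (- \<Lambda>) * exp (- \<Lambda>)"
      unfolding CD0[symmetric] by auto
    then have "u x = (C * exp (- \<Lambda>)) * (exp \<Lambda> * exp (\<Lambda> * complex_of_real x) + exp (- \<Lambda>) * exp (- \<Lambda> * complex_of_real x))"
      using elim by (simp add: distrib_left mult.assoc)
    also have "exp \<Lambda> * exp (\<Lambda> * complex_of_real x) + exp (- \<Lambda>) * exp (- \<Lambda> * complex_of_real x)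
        = 2 * cosh (\<Lambda> * complex_of_real (x + 1))"
      by (simp add: cosh_def scaleR_conv_of_real algebra_simps flip: exp_add)
    finally show ?case
      using nz by (simp add: \<alpha>_def eig_u_def)
  qed
  have v_eq': "AE x in lebesgue_on {-1<..<0}. v x = \<alpha> * eig_v \<Lambda> x"
    using u_eq v_eq by eventually_elim (use nz in \<open>simp add: eig_u_def eig_v_def\<close>)
  have "pt_val (-1) 0 v 0 = \<alpha> * eig_v \<Lambda> 0"
    by (rule pt_val_continuous[OF _ _ v_eq']) (auto intro!: continuous_intros eig_continuous nz)
  moreover have "pt_val 0 1 w x = P * exp (\<mu> * complex_of_real x) + Q * exp (- \<mu> * complex_of_real x)"
    if "x \<in> {0..1}" for x
    by (rule pt_val_continuous[OF _ _ PQ that]) (auto intro!: continuous_intros)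
  ultimately have PQ1: "P * exp \<mu> + Q * exp (- \<mu>) = 0" and PQ0: "P + Q = \<alpha> * cosh \<Lambda>"
    using dom(5,6) by (auto simp: eig_v_def)
  define \<beta> where "\<beta> = Q * exp (- \<mu>)"
  have P: "P = - \<beta> * exp (- \<mu>)" and Q: "Q = \<beta> * exp \<mu>"
  proof -
    have "P * exp \<mu> = - \<beta>" using PQ1 by (simp add: \<beta>_def add_eq_0_iff2)
    then have "P * exp \<mu> * exp (- \<mu>) = - \<beta> * exp (- \<mu>)" by simp
    then show "P = - \<beta> * exp (- \<mu>)" by (simp add: mult.assoc flip: exp_add)
    show "Q = \<beta> * exp \<mu>" by (simp add: \<beta>_def mult.assoc flip: exp_add)
  qed
  have "2 * \<beta> * sinh \<mu> = \<alpha> * cosh \<Lambda>"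
    unfolding PQ0[symmetric] P Q by (simp add: sinh_def scaleR_conv_of_real algebra_simps)
  then have \<beta>: "2 * \<beta> = \<alpha> * (cosh \<Lambda> / sinh \<mu>)"
    using nz by (simp add: field_simps)
  have w_eq: "AE x in lebesgue_on {0<..<1}. w x = \<alpha> * eig_w \<Lambda> \<mu> x"
    using PQ
  proof eventually_elim
    case (elim x)
    have "w x = \<beta> * (exp \<mu> * exp (- \<mu> * complex_of_real x) - exp (- \<mu>) * exp (\<mu> * complex_of_real x))"
      unfolding elim P Q by (simp add: algebra_simps)
    also have "exp \<mu> * exp (- \<mu> * complex_of_real x) - exp (- \<mu>) * exp (\<mu> * complex_of_real x)
        = 2 * sinh (\<mu> * complex_of_real (1 - x))"
      by (simp add: sinh_def scaleR_conv_of_real algebra_simps flip: exp_add)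
    also have "\<beta> * (2 * sinh (\<mu> * complex_of_real (1 - x))) = (2 * \<beta>) * sinh (\<mu> * complex_of_real (1 - x))"
      by simp
    finally show ?case unfolding \<beta> by (simp add: eig_w_def)
  qed
  have ev: "eigvec \<Lambda> \<mu> \<in> wh_space" "y \<in> wh_space"
    using eigvec_dom[OF ep] y wh_dom_subset by auto
  have EH: "eig_u \<Lambda> \<in> H1 (-1) 0"
    using ev by (simp add: eigvec_def wh_space_simp)
  define U V W where "U = (\<lambda>x. (- \<alpha>) * eig_u \<Lambda> x + u x)" and "V = (\<lambda>x. v x - \<alpha> * eig_v \<Lambda> x)"
    and "W = (\<lambda>x. w x - \<alpha> * eig_w \<Lambda> \<mu> x)"
  have eq: "y - state_scale \<alpha> (eigvec \<Lambda> \<mu>) = (U, V, W)"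
    by (simp add: y_def eigvec_def state_scale_def U_def V_def W_def fun_diff_def)
  have mem: "(U, V, W) \<in> wh_space"
    unfolding eq[symmetric] by (intro wh.diff_mem wh.scale_mem ev)
  then have UVW: "U \<in> H1 (-1) 0" "V \<in> L2 (-1) 0" "W \<in> L2 0 1"
    by (auto simp: wh_space_simp)
  have U0: "AE x in lebesgue_on {-1<..<0}. U x = 0"
    using u_eq unfolding U_def by eventually_elim simp
  have "has_weak_deriv (-1) 0 U (\<lambda>_. 0)"
  proof (rule has_weak_deriv_cong_AE)
    show "AE x in lebesgue_on {-1<..<0}. 0 = U x"
      using U0 by eventually_elim simp
    show "has_weak_deriv (-1) 0 (\<lambda>_. 0) (\<lambda>_. 0)" by (simp add: has_weak_deriv_def)
  qed (use H1_weak_deriv(3)[OF UVW(1)] in \<open>auto intro: L2_continuous\<close>)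
  then have "AE x in lebesgue_on {-1<..<0}. weak_deriv (-1) 0 U x = 0"
    by (rule weak_deriv_props(3)[rotated]) (auto intro: L2_continuous)
  then have "L2_sq (-1) 0 (weak_deriv (-1) 0 U) = 0"
    using L2_sq_eq_0_iff[OF H1_weak_deriv(1)[OF UVW(1)]] by blast
  moreover have "L2_sq (-1) 0 U = 0"
    using L2_sq_eq_0_iff[OF H1_weak_deriv(3)[OF UVW(1)]] U0 by blast
  moreover have "L2_sq (-1) 0 V = 0"
    unfolding L2_sq_eq_0_iff[OF UVW(2)] using v_eq' unfolding V_def by eventually_elim simp
  moreover have "L2_sq 0 1 W = 0"
    unfolding L2_sq_eq_0_iff[OF UVW(3)] using w_eq unfolding W_def by eventually_elim simp
  ultimately have "(wh_norm (U, V, W))\<^sup>2 = 0"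
    unfolding wh_norm_sq by simp
  then have "wh_norm (y - state_scale \<alpha> (eigvec \<Lambda> \<mu>)) = 0"
    unfolding eq by simp
  then show ?thesis
    unfolding wh.eqv_def using ev wh.scale_mem by blast
qed

section \<open>Series of eigenvectors\<close>

lemma suminf_has_vector_derivative:
  fixes f :: "nat \<Rightarrow> real \<Rightarrow> complex"
  assumes f: "\<And>n x. x \<in> {a..b} \<Longrightarrow> (f n has_vector_derivative f' n x) (at x within {a..b})"
    and bound: "\<And>n x. x \<in> {a..b} \<Longrightarrow> cmod (f n x) \<le> c n" "\<And>n x. x \<in> {a..b} \<Longrightarrow> cmod (f' n x) \<le> c n"
    and c: "summable c" and x: "x \<in> {a..b}"
  shows "((\<lambda>x. \<Sum>n. f n x) has_vector_derivative (\<Sum>n. f' n x)) (at x within {a..b})"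
proof -
  have ul: "uniform_limit {a..b} (\<lambda>n x. \<Sum>i<n. f' i x) (\<lambda>x. \<Sum>n. f' n x) sequentially"
    by (rule Weierstrass_m_test[OF bound(2) c])
  have "\<exists>g. \<forall>y\<in>{a..b}. (\<lambda>n. f n y) sums g y \<and>
      (g has_derivative (\<lambda>h. h *\<^sub>R (\<Sum>n. f' n y))) (at y within {a..b})"
  proof (rule has_derivative_series)
    show "(f n has_derivative (\<lambda>h. h *\<^sub>R f' n y)) (at y within {a..b})" if "y \<in> {a..b}" for n y
      using f[OF that] by (simp add: has_vector_derivative_def)
    show "\<forall>\<^sub>F n in sequentially. \<forall>y\<in>{a..b}. \<forall>h.
        cmod ((\<Sum>i<n. h *\<^sub>R f' i y) - h *\<^sub>R (\<Sum>n. f' n y)) \<le> e * norm h" if "e > 0" for e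
      using uniform_limitD[OF ul that]
    proof eventually_elim
      case (elim n)
      show ?case
      proof (intro ballI allI)
        fix y h assume "y \<in> {a..b}"
        then have "cmod ((\<Sum>i<n. f' i y) - (\<Sum>n. f' n y)) \<le> e"
          using elim by (force simp: dist_norm)
        then have "\<bar>h\<bar> * cmod ((\<Sum>i<n. f' i y) - (\<Sum>n. f' n y)) \<le> \<bar>h\<bar> * e"
          by (rule mult_left_mono) simp
        then show "cmod ((\<Sum>i<n. h *\<^sub>R f' i y) - h *\<^sub>R (\<Sum>n. f' n y)) \<le> e * norm h"
          by (simp add: mult.commute flip: scaleR_sum_right scaleR_right_diff_distrib)
      qed
    qed
    show "x \<in> {a..b}" by (rule x)
    have "summable (\<lambda>n. f n x)"
      by (rule summable_comparison_test'[OF c, of 0]) (use bound(1)[OF x] in auto)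
    then show "(\<lambda>n. f n x) sums (\<Sum>n. f n x)" by (rule summable_sums)
  qed simp
  then obtain g where g: "\<And>y. y \<in> {a..b} \<Longrightarrow> (\<lambda>n. f n y) sums g y"
    "\<And>y. y \<in> {a..b} \<Longrightarrow> (g has_vector_derivative (\<Sum>n. f' n y)) (at y within {a..b})"
    unfolding has_vector_derivative_def by blast
  show ?thesis
    by (rule has_vector_derivative_transform[OF x _ g(2)[OF x]]) (rule sums_unique[OF g(1), symmetric])
qed

lemma suminf_continuous_on:
  fixes f :: "nat \<Rightarrow> real \<Rightarrow> complex"
  assumes "\<And>n. continuous_on S (f n)" "\<And>n x. x \<in> S \<Longrightarrow> cmod (f n x) \<le> c n" "summable c"
  shows "continuous_on S (\<lambda>x. \<Sum>n. f n x)"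
  by (rule uniform_limit_theorem[OF _ Weierstrass_m_test[OF assms(2,3)]])
    (auto intro!: always_eventually continuous_on_sum assms(1))

lemma suminf_tail_le:
  fixes f :: "nat \<Rightarrow> complex"
  assumes "\<And>n. n > k \<Longrightarrow> cmod (f n) \<le> K * (1/2) ^ n" "K \<ge> 0"
  shows "cmod ((\<Sum>n. f n) - (\<Sum>n\<le>k. f n)) \<le> K"
proof -
  have geo: "(\<lambda>n. K * (1/2) ^ Suc n) sums (K * 1)"
    by (intro sums_mult power_half_series)
  have "summable (\<lambda>n. K * (1/2) ^ n)" by (intro summable_mult summable_geometric) simp
  then have "summable f"
    by (rule summable_comparison_test'[of _ "Suc k"]) (use assms(1) in auto)
  then have "(\<Sum>n. f n) - (\<Sum>n\<le>k. f n) = (\<Sum>n. f (n + Suc k))"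
    by (simp only: suminf_minus_initial_segment lessThan_Suc_atMost)
  also have "cmod \<dots> \<le> (\<Sum>n. K * (1/2) ^ Suc n)"
  proof (rule norm_suminf_le)
    fix n
    have "cmod (f (n + Suc k)) \<le> K * (1/2) ^ (n + Suc k)" by (rule assms(1)) simp
    also have "\<dots> \<le> K * (1/2) ^ Suc n"
      using assms(2) by (intro mult_left_mono power_decreasing) auto
    finally show "cmod (f (n + Suc k)) \<le> K * (1/2) ^ Suc n" .
  qed (rule sums_summable[OF geo])
  also have "\<dots> = K" using sums_unique[OF geo] by simp
  finally show ?thesis .
qed

lemma cosh_real_le_3:
  assumes "\<bar>m\<bar> \<le> (1::real)"
  shows "cosh m \<le> 3"
proof -
  have "exp m \<le> 3" "exp (- m) \<le> 3"
    using exp_le[THEN order_trans[rotated]] assms by (simp_all add: abs_le_iff)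
  then show ?thesis by (simp add: cosh_def)
qed

text \<open>
  The second derivatives are at most \<open>cmod \<Lambda> \<le> 2 * s\<close> times the functions bounded here. So all functions and
  derivatives that enter the domain are at most \<open>24 * s\<close>, whereas those that enter the norm of the state space are at most
  \<open>12\<close>.
\<close>

lemma eig_bounds:
  assumes ep: "eigenpair \<Lambda> \<mu>" and s: "s \<ge> 200" and close: "cmod (\<Lambda> - \<i> * complex_of_real s) \<le> 5 / sqrt s"
  shows "\<bar>Re \<Lambda>\<bar> * sqrt s \<le> 5" "cmod \<Lambda> \<le> 2 * s"
    "x \<in> {-1..0} \<Longrightarrow> cmod (eig_u \<Lambda> x) \<le> 12"
    "x \<in> {-1..0} \<Longrightarrow> cmod (eig_u' \<Lambda> x) \<le> 12"
    "x \<in> {-1..0} \<Longrightarrow> cmod (eig_v \<Lambda> x) \<le> 12"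
    "x \<in> {0..1} \<Longrightarrow> cmod (eig_w \<Lambda> \<mu> x) \<le> 12"
    "x \<in> {0..1} \<Longrightarrow> cmod (eig_w' \<Lambda> \<mu> x) \<le> 24 * s"
proof -
  have sqrt_s: "sqrt s \<ge> 14" using s by (intro real_le_rsqrt) simp
  have "\<bar>Re \<Lambda>\<bar> \<le> cmod (\<Lambda> - \<i> * complex_of_real s)"
    using abs_Re_le_cmod[of "\<Lambda> - \<i> * complex_of_real s"] by simp
  then have Re: "\<bar>Re \<Lambda>\<bar> \<le> 5 / sqrt s" using close by simp
  then show "\<bar>Re \<Lambda>\<bar> * sqrt s \<le> 5" using sqrt_s s by (simp add: pos_le_divide_eq)
  have small: "5 / sqrt s \<le> 1" using sqrt_s s by (simp add: pos_divide_le_eq)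
  have Re1: "\<bar>Re \<Lambda>\<bar> \<le> 1" using Re small by simp
  have "cmod \<Lambda> \<le> cmod (\<Lambda> - \<i> * complex_of_real s) + cmod (\<i> * complex_of_real s)"
    by (metis diff_add_cancel norm_triangle_ineq)
  then show up: "cmod \<Lambda> \<le> 2 * s" using order_trans[OF close small] s by (simp add: norm_mult)
  have sq: "\<mu>\<^sup>2 = \<Lambda>" and R\<mu>: "Re \<mu> \<ge> 1" using ep by (auto simp: eigenpair_def)
  have \<mu>1: "cmod \<mu> \<ge> 1" using R\<mu> complex_Re_le_cmod[of \<mu>] by simp
  have \<mu>2: "cmod \<mu> * cmod \<mu> = cmod \<Lambda>" by (simp add: norm_mult power2_eq_square flip: sq)
  have \<Lambda>1: "cmod \<Lambda> \<ge> 1" using \<mu>1 mult_mono[OF \<mu>1 \<mu>1] by (simp flip: \<mu>2)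
  have \<mu>\<Lambda>: "cmod \<mu> \<le> 2 * s"
    using mult_left_mono[OF \<mu>1, of "cmod \<mu>"] \<mu>2 up by simp
  have hyp: "cmod (cosh (\<Lambda> * of_real y)) \<le> 3" "cmod (sinh (\<Lambda> * of_real y)) \<le> 3" if "0 \<le> y" "y \<le> 1" for y
  proof -
    have "\<bar>Re \<Lambda>\<bar> * \<bar>y\<bar> \<le> 1 * 1" using that Re1 by (intro mult_mono) auto
    then have "cosh (Re (\<Lambda> * of_real y)) \<le> 3"
      by (intro cosh_real_le_3) (simp add: abs_mult)
    then show "cmod (cosh (\<Lambda> * of_real y)) \<le> 3" "cmod (sinh (\<Lambda> * of_real y)) \<le> 3"
      using cmod_sinh_cosh_le[of "\<Lambda> * of_real y"] by linarith+
  qed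
  show "cmod (eig_v \<Lambda> x) \<le> 12" if "x \<in> {-1..0}"
    using hyp(1)[of "x + 1"] that by (simp add: eig_v_def)
  show "cmod (eig_u' \<Lambda> x) \<le> 12" if "x \<in> {-1..0}"
    using hyp(2)[of "x + 1"] that by (simp add: eig_u'_def)
  show "cmod (eig_u \<Lambda> x) \<le> 12" if "x \<in> {-1..0}"
  proof -
    have "cmod (eig_u \<Lambda> x) \<le> cmod (cosh (\<Lambda> * of_real (x + 1))) / 1"
      unfolding eig_u_def norm_divide using \<Lambda>1 by (intro divide_left_mono) auto
    then show ?thesis using hyp(1)[of "x + 1"] that by simp
  qed
  have sh: "cosh (Re \<mu>) \<le> 2 * sinh (Re \<mu>)" "0 < sinh (Re \<mu>)" "sinh (Re \<mu>) \<le> cmod (sinh \<mu>)"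
    using cosh_le_2_sinh[OF R\<mu>] cmod_sinh_cosh_ge by auto
  have mono: "cosh (Re (\<mu> * of_real y)) \<le> 2 * cmod (sinh \<mu>)" if "0 \<le> y" "y \<le> 1" for y
  proof -
    have "Re (\<mu> * of_real y) \<le> Re \<mu> * 1"
      using that R\<mu> by (simp add: mult_left_le)
    then have "cosh (Re (\<mu> * of_real y)) \<le> cosh (Re \<mu>)"
      using that R\<mu> by (subst cosh_real_nonneg_le_iff) auto
    then show ?thesis using sh by linarith
  qed
  have ratio: "cmod (cosh \<Lambda> / sinh \<mu> * z) \<le> 6" if "cmod z \<le> 2 * cmod (sinh \<mu>)" for z
  proof -
    have "cmod (cosh \<Lambda>) * cmod z \<le> 3 * (2 * cmod (sinh \<mu>))"
      using hyp(1)[of 1] that by (intro mult_mono) auto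
    moreover have "cmod (sinh \<mu>) > 0" using sh by linarith
    ultimately have "cmod (cosh \<Lambda>) * cmod z / cmod (sinh \<mu>) \<le> 6"
      by (simp add: pos_divide_le_eq)
    then show ?thesis by (simp add: norm_mult norm_divide)
  qed
  show "cmod (eig_w \<Lambda> \<mu> x) \<le> 12" if "x \<in> {0..1}"
  proof -
    have "cmod (sinh (\<mu> * of_real (1 - x))) \<le> 2 * cmod (sinh \<mu>)"
      by (rule order_trans[OF cmod_sinh_cosh_le(1) mono]) (use that in auto)
    from ratio[OF this] show ?thesis unfolding eig_w_def by simp
  qed
  show "cmod (eig_w' \<Lambda> \<mu> x) \<le> 24 * s" if "x \<in> {0..1}"
  proof -
    have "cmod (cosh (\<mu> * of_real (1 - x))) \<le> 2 * cmod (sinh \<mu>)"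
      by (rule order_trans[OF cmod_sinh_cosh_le(2) mono]) (use that in auto)
    from ratio[OF this] have "cmod \<mu> * cmod (cosh \<Lambda> / sinh \<mu> * cosh (\<mu> * of_real (1 - x))) \<le> (2 * s) * 6"
      using \<mu>\<Lambda> s by (intro mult_mono) auto
    then have "cmod (eig_w' \<Lambda> \<mu> x) \<le> (2 * s) * 6"
      unfolding eig_w'_def norm_minus_cancel norm_mult .
    then show ?thesis using s by simp
  qed
qed

lemma state_sum:
  "(\<Sum>j\<le>(k::nat). state_scale (c j) (u j, v j, w j))
    = (\<lambda>x. \<Sum>j\<le>k. c j * u j x, \<lambda>x. \<Sum>j\<le>k. c j * v j x, \<lambda>x. \<Sum>j\<le>k. c j * w j x)"
  by (induction k) (simp_all add: state_scale_simp plus_fun_def)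

text \<open>
  The coefficients \<open>(1/2) ^ j / s j\<close> absorb the growth of the derivatives, so that all series needed in the
  domain converge uniformly. The remainder in the norm of the state space involves only functions bounded by 12.
\<close>

lemma eigvec_series:
  fixes \<Lambda> \<mu> :: "nat \<Rightarrow> complex" and s :: "nat \<Rightarrow> real"
  assumes ep: "\<And>j. eigenpair (\<Lambda> j) (\<mu> j)" and s: "\<And>j. s j \<ge> 200"
    and close: "\<And>j. cmod (\<Lambda> j - \<i> * complex_of_real (s j)) \<le> 5 / sqrt (s j)"
  shows "\<exists>x\<in>wh_dom. \<forall>k A. (\<forall>j>k. 1 / s j \<le> A) \<longrightarrow>
    wh_norm (x - (\<Sum>j\<le>k. state_scale (complex_of_real ((1/2) ^ j / s j)) (eigvec (\<Lambda> j) (\<mu> j)))) \<le> 24 * A"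
proof -
  define a where "a j = (1/2) ^ j / s j" for j
  have sp: "s j > 0" "s j \<ge> 1" for j using s[of j] by auto
  have a_pos: "a j > 0" for j using sp by (simp add: a_def)
  define c where "c j = 24 * (1/2::real) ^ j" for j
  have c: "summable c"
    unfolding c_def by (intro summable_mult summable_geometric) simp
  have nz: "\<Lambda> j \<noteq> 0" for j using eigenpair_nonzero[OF ep] by simp
  note B = eig_bounds[OF ep s close]
  have sc: "cmod (complex_of_real (a j) * z) \<le> c j" if "cmod z \<le> 24 * s j" for j z
  proof -
    have "a j * cmod z \<le> a j * (24 * s j)" using that a_pos[of j] by (intro mult_left_mono) auto
    also have "\<dots> = c j" using sp[of j] by (simp add: a_def c_def)
    finally show ?thesis using a_pos[of j] by (simp add: norm_mult)
  qed
  have sc12: "cmod (complex_of_real (a j) * z) \<le> c j" if "cmod z \<le> 12" for j z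
    by (rule sc) (use that sp[of j] in simp)
  have sc\<Lambda>: "cmod (complex_of_real (a j) * (\<Lambda> j * z)) \<le> c j" if "cmod z \<le> 12" for j z
    by (rule sc) (use mult_mono[OF B(2)[of j] that] sp[of j] in \<open>simp add: norm_mult\<close>)
  define S where "S f x = (\<Sum>j. complex_of_real (a j) * f j x)" for f :: "nat \<Rightarrow> real \<Rightarrow> complex" and x
  define u u1 v w w1 where "u = (\<lambda>j. eig_u (\<Lambda> j))" and "u1 = (\<lambda>j. eig_u' (\<Lambda> j))" and "v = (\<lambda>j. eig_v (\<Lambda> j))"
    and "w = (\<lambda>j. eig_w (\<Lambda> j) (\<mu> j))" and "w1 = (\<lambda>j. eig_w' (\<Lambda> j) (\<mu> j))"
  have sq: "(\<mu> j)\<^sup>2 = \<Lambda> j" for j using ep by (simp add: eigenpair_def)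
  have D: "(u j has_vector_derivative u1 j x) (at x within X)"
    "(u1 j has_vector_derivative \<Lambda> j * v j x) (at x within X)"
    "(v j has_vector_derivative \<Lambda> j * u1 j x) (at x within X)"
    "(w j has_vector_derivative w1 j x) (at x within X)"
    "(w1 j has_vector_derivative \<Lambda> j * w j x) (at x within X)" for j x X
    unfolding u_def u1_def v_def w_def w1_def
    using eig_derivs(1-4)[OF nz[of j]] eig_derivs(5)[OF nz[of j], where \<mu> = "\<mu> j", unfolded sq] by blast+
  have C: "continuous_on X (u j)" "continuous_on X (u1 j)" "continuous_on X (v j)" "continuous_on X (w j)" for j X
    unfolding u_def u1_def v_def w_def by (rule eig_continuous[OF nz])+
  have SD: "(S f has_vector_derivative S f' x) (at x within {l..m})"
    if "\<And>j x. (f j has_vector_derivative f' j x) (at x within {l..m})"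
      "\<And>j x. x \<in> {l..m} \<Longrightarrow> cmod (complex_of_real (a j) * f j x) \<le> c j"
      "\<And>j x. x \<in> {l..m} \<Longrightarrow> cmod (complex_of_real (a j) * f' j x) \<le> c j" "x \<in> {l..m}" for f f' l m x
    unfolding S_def[abs_def]
    by (rule suminf_has_vector_derivative[OF _ that(2,3) c that(4)])
      (rule has_vector_derivative_mult_right[OF that(1)])
  have SC: "continuous_on {l..m} (S f)"
    if "\<And>j. continuous_on {l..m} (f j)" "\<And>j x. x \<in> {l..m} \<Longrightarrow> cmod (complex_of_real (a j) * f j x) \<le> c j" for f l m
    unfolding S_def[abs_def]
    by (rule suminf_continuous_on[OF _ that(2) c]) (rule continuous_on_mult_left[OF that(1)])
  have bu: "cmod (u j x) \<le> 12" "cmod (u1 j x) \<le> 12" "cmod (v j x) \<le> 12" if "x \<in> {-1..0}" for j x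
    unfolding u_def u1_def v_def using B(3-5)[OF that] by auto
  have bw: "cmod (w j x) \<le> 12" "cmod (w1 j x) \<le> 24 * s j" if "x \<in> {0..1}" for j x
    unfolding w_def w1_def using B(6,7)[OF that] by auto
  have SU: "(S u has_vector_derivative S u1 x) (at x within {-1..0})" if "x \<in> {-1..0}" for x
    by (rule SD[OF D(1) _ _ that]) (intro sc12 bu; assumption)+
  have CU1: "continuous_on {-1..0} (S u1)" and CV: "continuous_on {-1..0} (S v)" and CW: "continuous_on {0..1} (S w)"
    by (rule SC[OF C(2)], intro sc12 bu, assumption, rule SC[OF C(3)], intro sc12 bu, assumption,
        rule SC[OF C(4)], intro sc12 bw, assumption)
  define x where "x = (S u, S v, S w)"
  have "x \<in> wh_dom"
    unfolding x_def
  proof (rule wh_dom_classical[where ?u1.0 = "S u1" and ?u2.0 = "S (\<lambda>j x. \<Lambda> j * v j x)"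
        and ?v1.0 = "S (\<lambda>j x. \<Lambda> j * u1 j x)" and ?w1.0 = "S w1" and ?w2.0 = "S (\<lambda>j x. \<Lambda> j * w j x)"])
    fix x :: real assume x: "x \<in> {-1..0}"
    show "(S u has_vector_derivative S u1 x) (at x within {-1..0})" by (rule SU[OF x])
    show "(S u1 has_vector_derivative S (\<lambda>j x. \<Lambda> j * v j x) x) (at x within {-1..0})"
      by (rule SD[OF D(2) _ _ x], intro sc12 bu, assumption, intro sc\<Lambda> bu, assumption)
    show "(S v has_vector_derivative S (\<lambda>j x. \<Lambda> j * u1 j x) x) (at x within {-1..0})"
      by (rule SD[OF D(3) _ _ x], intro sc12 bu, assumption, intro sc\<Lambda> bu, assumption)
  next
    fix x :: real assume x: "x \<in> {0..1}"
    show "(S w has_vector_derivative S w1 x) (at x within {0..1})"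
      by (rule SD[OF D(4) _ _ x], intro sc12 bw, assumption, intro sc bw, assumption)
    show "(S w1 has_vector_derivative S (\<lambda>j x. \<Lambda> j * w j x) x) (at x within {0..1})"
      by (rule SD[OF D(5) _ _ x], intro sc bw, assumption, intro sc\<Lambda> bw, assumption)
  next
    show "continuous_on {-1..0} (S (\<lambda>j x. \<Lambda> j * v j x))"
      by (rule SC[OF continuous_on_mult_left[OF C(3)]], intro sc\<Lambda> bu, assumption)
    show "continuous_on {-1..0} (S (\<lambda>j x. \<Lambda> j * u1 j x))"
      by (rule SC[OF continuous_on_mult_left[OF C(2)]], intro sc\<Lambda> bu, assumption)
    show "continuous_on {0..1} (S (\<lambda>j x. \<Lambda> j * w j x))"
      by (rule SC[OF continuous_on_mult_left[OF C(4)]], intro sc\<Lambda> bw, assumption)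
  qed (simp_all add: S_def u1_def v_def w_def w1_def eig_boundary[OF ep])
  moreover have "wh_norm (x - (\<Sum>j\<le>k. state_scale (complex_of_real (a j)) (eigvec (\<Lambda> j) (\<mu> j)))) \<le> 24 * A"
    if A: "\<forall>j>k. 1 / s j \<le> A" for k A
  proof -
    have "0 < 1 / s (Suc k)" using sp by simp
    also have "\<dots> \<le> A" using A by blast
    finally have A0: "A > 0" .
    define R where "R f x = S f x - (\<Sum>j\<le>k. complex_of_real (a j) * f j x)" for f x
    have R: "cmod (R f x) \<le> 12 * A" if "\<And>j. cmod (f j x) \<le> 12" for f x
      unfolding R_def S_def
    proof (rule suminf_tail_le)
      fix j assume "j > k"
      then have "1 / s j * (1/2) ^ j \<le> A * (1/2) ^ j"
        using A by (intro mult_right_mono) auto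
      then have "a j \<le> A * (1/2) ^ j" by (simp add: a_def)
      then have "a j * cmod (f j x) \<le> (A * (1/2) ^ j) * 12"
        using that[of j] A0 by (intro mult_mono) auto
      then show "cmod (complex_of_real (a j) * f j x) \<le> 12 * A * (1/2) ^ j"
        using a_pos[of j] by (simp add: norm_mult mult_ac)
    qed (use A0 in simp)
    have eq: "x - (\<Sum>j\<le>k. state_scale (complex_of_real (a j)) (eigvec (\<Lambda> j) (\<mu> j))) = (R u, R v, R w)"
      unfolding x_def eigvec_def state_sum R_def[abs_def] u_def v_def w_def by (simp add: fun_diff_def)
    have "wh_norm (R u, R v, R w) \<le> 2 * (12 * A)"
    proof (rule wh_norm_classical_bound)
      show "(R u has_vector_derivative R u1 x) (at x within {-1..0})" if "x \<in> {-1..0}" for x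
        unfolding R_def[abs_def]
        by (intro has_vector_derivative_diff SU that has_vector_derivative_sum has_vector_derivative_mult_right D)
      show "continuous_on {-1..0} (R u1)" "continuous_on {-1..0} (R v)" "continuous_on {0..1} (R w)"
        unfolding R_def[abs_def]
        by (intro continuous_on_diff CU1 CV CW continuous_on_sum continuous_on_mult_left C)+
    qed (auto intro!: R bu bw)
    then show ?thesis unfolding eq by simp
  qed
  ultimately show ?thesis unfolding a_def by blast
qed

section \<open>The decay rate is optimal\<close>

theorem mainTheorem2:
  fixes T :: "real \<Rightarrow> state \<Rightarrow> state" and r :: "real \<Rightarrow> real"
  assumes "wh_semigroup T"
    and "\<And>t. t > 0 \<Longrightarrow> r t > 0"
    and "((\<lambda>t. r t / t powi (-4)) \<longlongrightarrow> 0) at_top"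
  shows "\<exists>x\<in>wh_dom. \<not> ((\<lambda>t. energy (T t x) / r t) \<longlongrightarrow> 0) at_top"
proof -
  have sg: "C0_semigroup wh_space state_scale wh_norm T"
    and gen: "is_generator wh_space state_scale wh_norm wh_dom wh_op T"
    using assms(1) by (auto simp: wh_semigroup_def)
  interpret T: quasi_normed_semigroup state_scale wh_space wh_norm T
    by unfold_locales (rule sg)
  have "\<exists>\<Lambda> \<mu>. eigenpair \<Lambda> \<mu> \<and> cmod (\<Lambda> - \<i> * complex_of_real (freq n)) \<le> 5 / sqrt (freq n)" for n
    using eigenpair_exists[OF freq_ge(1) cos_freq] by metis
  then obtain \<Lambda> \<mu> where ep: "\<And>n. eigenpair (\<Lambda> n) (\<mu> n)"
    and close: "\<And>n. cmod (\<Lambda> n - \<i> * complex_of_real (freq n)) \<le> 5 / sqrt (freq n)"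
    by metis
  have mem: "eigvec (\<Lambda> n) (\<mu> n) \<in> wh_space" for n
    using eigvec_dom[OF ep] wh_dom_subset by blast
  show ?thesis
  proof (rule T.gliding_hump[where e = "\<lambda>n. eigvec (\<Lambda> n) (\<mu> n)" and \<Lambda> = \<Lambda> and s = freq
        and C = 5 and \<kappa> = "1/2" and B = 24])
    show "wh.eqv (T t (eigvec (\<Lambda> n) (\<mu> n))) (state_scale (exp (\<Lambda> n * complex_of_real t)) (eigvec (\<Lambda> n) (\<mu> n)))"
      if "t \<ge> 0" for n t
    proof (rule T.T_simple_eigenvector[OF gen mem eigvec_dom[OF ep] eigvec_eigen[OF ep] _ _ that])
      show "wh_norm (eigvec (\<Lambda> n) (\<mu> n)) \<noteq> 0"
        using energy_le_norm[OF mem[of n]] eigvec_energy[OF ep[of n]] by auto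
    qed (rule eigenspace_simple[OF ep])
    show "filterlim freq at_top sequentially"
      by (rule filterlim_at_top_mono[OF filterlim_real_sequentially]) (simp add: freq_ge)
    show "1 / 2 \<le> energy (eigvec (\<Lambda> n) (\<mu> n))" for n
      by (rule eigvec_energy[OF ep])
    show "freq n > 0" for n using freq_ge(1)[of n] by simp
    show "\<bar>Re (\<Lambda> n)\<bar> * sqrt (freq n) \<le> 5" for n
      by (rule eig_bounds(1)[OF ep freq_ge(1) close])
    show "((\<lambda>t. r t * t ^ 4) \<longlongrightarrow> 0) at_top"
      using assms(3) by (simp add: power_int_minus field_simps)
    show "\<exists>x\<in>wh_dom. \<forall>k A. (\<forall>j>k. 1 / freq (\<nu> j) \<le> A) \<longrightarrow>
        wh_norm (x - (\<Sum>j\<le>k. state_scale (complex_of_real ((1/2) ^ j / freq (\<nu> j))) (eigvec (\<Lambda> (\<nu> j)) (\<mu> (\<nu> j))))) \<le> 24 * A" for \<nu>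
      by (rule eigvec_series[OF ep freq_ge(1) close])
  qed (auto simp: wh_norm_energy_add wh_norm_sq_scale energy_nonneg energy_le_norm
      eigvec_dom[OF ep] eigvec_energy[OF ep] wh_dom_subset assms(2))
qed

end
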